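(* Let $K$ be any field, let $p$ be an irrational infinite path in the finite directed graph $E$, and let $T$ be any Chen simple left $L_K(E)$-module. Then $\operatorname{Ext}^1_{L_K(E)}(V_{[p]},T)\neq 0$ if and only if $r(X_i(p))\cap U(T)\neq\emptyset$ for infinitely many $i\ge 0$. In such a situation, $\dim_K\operatorname{Ext}^1_{L_K(E)}(V_{[p]},T)$ is infinite.
   Context: A directed graph $E=(E^0,E^1,s,r)$ consists of a set $E^0$ of vertices, a set $E^1$ of edges, and maps $s,r:E^1\to E^0$ (source and range); $E$ is finite if $E^0$ and $E^1$ are finite. A sink is a vertex $w$ with $s^{-1}(w)=\emptyset$. A path of length $n\ge 1$ is a sequence $\alpha=e_1\cdots e_n$ of edges with $r(e_i)=s(e_{i+1})$; vertices are the paths of length $0$. A path of length $\ge1$ is closed if its source equals its range. The Leavitt path algebra $L_K(E)$ is the $K$-algebra generated by $\{v: v\in E^0\}\cup\{e,e^*: e\in E^1\}$ with relations: (V) $vu=\delta_{v,u}v$ for $v,u\in E^0$; (E1) $s(e)e=er(e)=e$; (E2) $r(e)e^*=e^*s(e)=e^*$ for $e\in E^1$; (CK1) $e^*e'=\delta_{e,e'}r(e)$ for $e,e'\in E^1$; (CK2) $v=\sum_{e\in s^{-1}(v)}ee^*$ for every $v\in E^0$ with $0<|s^{-1}(v)|<\infty$. Since $L_K(E)$ is a $K$-algebra, $\operatorname{Ext}^1$ groups are $K$-vector spaces. An infinite path is a sequence $p=e_1e_2e_3\cdots$ of edges with $r(e_i)=s(e_{i+1})$ for all $i$; $\tau_{>n}(p)=e_{n+1}e_{n+2}\cdots$.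 Infinite paths $p,q$ are tail equivalent if $\tau_{>m}(p)=\tau_{>n}(q)$ for some $m,n\ge0$; $[p]$ is the class of $p$. An infinite path is rational if it is tail equivalent to $c^\infty=ccc\cdots$ for some closed path $c$, and irrational otherwise. For an infinite path $p$, $V_{[p]}$ is the $K$-vector space with basis $[p]$ and left $L_K(E)$-action determined, for $q=f_1f_2\cdots\in[p]$, $v\in E^0$, $e\in E^1$, by: $v\cdot q=q$ if $v=s(f_1)$ and $0$ otherwise; $e\cdot q=eq$ if $r(e)=s(f_1)$ and $0$ otherwise; $e^*\cdot q=\tau_{>1}(q)$ if $e=f_1$ and $0$ otherwise. For a sink $w$, $V_{[w^\infty]}$ denotes the left ideal $L_K(E)w$ (which has as $K$-basis the finite paths ending in $w$). A Chen simple module is a module $V_{[p]}$ with $p$ an infinite path, or $V_{[w^\infty]}$ with $w$ a sink. For a Chen simple module $T$, $U(T)=\{v\in E^0: vT\ne\{0\}\}$. For $p=e_1e_2\cdots$ and $i\ge0$, $X_i(p)=\{f\in E^1: s(f)=s(e_{i+1}),\ f\ne e_{i+1}\}$ and $r(X_i(p))=\{r(f): f\in X_i(p)\}$. *)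

theory Defs
  imports
    "HOL-Algebra.QuotRing"
    "HOL-Algebra.Module"
    "HOL-Library.Poly_Mapping"
    "HOL-Library.Stream"
    "Graph_Theory.Arc_Walk"
begin

section \<open>Leavitt path algebras\<close>

text \<open>
  A directed graph is an \<open>('v, 'e) pre_digraph\<close>: \<open>verts\<close>, \<open>arcs\<close>, \<open>tail\<close>, \<open>head\<close> are
  $E^0$, $E^1$, $s$, $r$.  Words over an alphabet are written additively, so that
  \<open>'a fword \<Rightarrow>\<^sub>0 'k\<close> with the convolution product is the free unital $K$-algebra on \<open>'a\<close>.
\<close>

datatype 'a fword = FWord (letters: "'a list")

instantiation fword :: (type) monoid_add
begin

definition zero_fword :: "'a fword" where
  "0 = FWord []"

definition plus_fword :: "'a fword \<Rightarrow> 'a fword \<Rightarrow> 'a fword" where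
  "u + w = FWord (letters u @ letters w)"

instance
  by standard (simp_all add: zero_fword_def plus_fword_def)

end

datatype ('v, 'e) lpa_gen = Vert 'v | Edge 'e | Ghost 'e

type_synonym ('v, 'e, 'k) free_elem = "('v, 'e) lpa_gen fword \<Rightarrow>\<^sub>0 'k"

type_synonym ('v, 'e, 'k) lpa_elem = "('v, 'e, 'k) free_elem set"

definition lpa_gens :: "('v, 'e) pre_digraph \<Rightarrow> ('v, 'e) lpa_gen set" where
  "lpa_gens G = Vert ` verts G \<union> Edge ` arcs G \<union> Ghost ` arcs G"

definition free_alg :: "('v, 'e) pre_digraph \<Rightarrow> ('v, 'e, 'k::field) free_elem ring" where
  "free_alg G =
    \<lparr>carrier = {x. \<forall>w \<in> Poly_Mapping.keys x. set (letters w) \<subseteq> lpa_gens G},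
     mult = (*), one = 1, zero = 0, add = (+)\<rparr>"

abbreviation gvar :: "('v, 'e) lpa_gen \<Rightarrow> ('v, 'e, 'k::field) free_elem" where
  "gvar g \<equiv> Poly_Mapping.single (FWord [g]) 1"

definition lpa_relators :: "('v, 'e) pre_digraph \<Rightarrow> ('v, 'e, 'k::field) free_elem set" where
  "lpa_relators G =
     {gvar (Vert v) * gvar (Vert u) - (if v = u then gvar (Vert v) else 0) |
        v u. v \<in> verts G \<and> u \<in> verts G} \<union>
     {gvar (Vert (tail G e)) * gvar (Edge e) - gvar (Edge e) | e. e \<in> arcs G} \<union>
     {gvar (Edge e) * gvar (Vert (head G e)) - gvar (Edge e) | e. e \<in> arcs G} \<union>
     {gvar (Vert (head G e)) * gvar (Ghost e) - gvar (Ghost e) | e. e \<in> arcs G} \<union>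
     {gvar (Ghost e) * gvar (Vert (tail G e)) - gvar (Ghost e) | e. e \<in> arcs G} \<union>
     {gvar (Ghost e) * gvar (Edge e') - (if e = e' then gvar (Vert (head G e)) else 0) |
        e e'. e \<in> arcs G \<and> e' \<in> arcs G} \<union>
     {gvar (Vert v) - (\<Sum>e\<in>out_arcs G v. gvar (Edge e) * gvar (Ghost e)) |
        v. v \<in> verts G \<and> finite (out_arcs G v) \<and> out_arcs G v \<noteq> {}}"

definition lpa_ideal :: "('v, 'e) pre_digraph \<Rightarrow> ('v, 'e, 'k::field) free_elem set" where
  "lpa_ideal G = Idl\<^bsub>free_alg G\<^esub> (lpa_relators G)"

definition lpa_class ::
  "('v, 'e) pre_digraph \<Rightarrow> ('v, 'e, 'k::field) free_elem \<Rightarrow> ('v, 'e, 'k) lpa_elem" where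
  "lpa_class G x = lpa_ideal G +>\<^bsub>free_alg G\<^esub> x"

text \<open>
  $L_K(E)$ is presented as a $K$-algebra that is not required to be unital, so only cosets of
  elements without constant term belong to it (in the quotient of the unital free algebra, $1$
  would be a spurious element different from the sum of the vertices).  As the relators have
  no constant term, this is the free non-unital algebra modulo the ideal they generate there.
  The component \<open>one\<close>, the sum of all vertices, is the identity of this algebra when the graph
  is finite, and \<open>smult\<close> is the $K$-algebra structure.
\<close>

definition lpa :: "('v, 'e) pre_digraph \<Rightarrow> ('k::field, ('v, 'e, 'k) lpa_elem) module" where
  "lpa G =
    \<lparr>carrier = {lpa_class G x | x. x \<in> carrier (free_alg G) \<and> Poly_Mapping.lookup x 0 = 0},
     mult = rcoset_mult (free_alg G) (lpa_ideal G),
     one = lpa_class G (\<Sum>v\<in>verts G. gvar (Vert v)),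
     zero = lpa_ideal G,
     add = set_add (free_alg G),
     smult = (\<lambda>k X. \<Union>x\<in>X. lpa_class G (Poly_Mapping.single 0 k * x))\<rparr>"

definition lpa_vert :: "('v, 'e) pre_digraph \<Rightarrow> 'v \<Rightarrow> ('v, 'e, 'k::field) lpa_elem" where
  "lpa_vert G v = lpa_class G (gvar (Vert v))"


section \<open>Left modules over a not necessarily commutative ring\<close>

text \<open>
  Modules reuse the record \<open>module\<close>, whose ring components \<open>mult\<close> and \<open>one\<close> are
  irrelevant; the library locale \<open>module\<close> itself requires commutative scalars.
\<close>

locale left_module = R?: ring R + M?: abelian_group M for R (structure) and M (structure) +
  assumes smult_closed:
      "\<lbrakk>a \<in> carrier R; x \<in> carrier M\<rbrakk> \<Longrightarrow> a \<odot>\<^bsub>M\<^esub> x \<in> carrier M"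
    and smult_l_distr:
      "\<lbrakk>a \<in> carrier R; b \<in> carrier R; x \<in> carrier M\<rbrakk>
        \<Longrightarrow> (a \<oplus> b) \<odot>\<^bsub>M\<^esub> x = a \<odot>\<^bsub>M\<^esub> x \<oplus>\<^bsub>M\<^esub> b \<odot>\<^bsub>M\<^esub> x"
    and smult_r_distr:
      "\<lbrakk>a \<in> carrier R; x \<in> carrier M; y \<in> carrier M\<rbrakk>
        \<Longrightarrow> a \<odot>\<^bsub>M\<^esub> (x \<oplus>\<^bsub>M\<^esub> y) = a \<odot>\<^bsub>M\<^esub> x \<oplus>\<^bsub>M\<^esub> a \<odot>\<^bsub>M\<^esub> y"
    and smult_assoc:
      "\<lbrakk>a \<in> carrier R; b \<in> carrier R; x \<in> carrier M\<rbrakk>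
        \<Longrightarrow> (a \<otimes> b) \<odot>\<^bsub>M\<^esub> x = a \<odot>\<^bsub>M\<^esub> (b \<odot>\<^bsub>M\<^esub> x)"
    and smult_one: "x \<in> carrier M \<Longrightarrow> \<one> \<odot>\<^bsub>M\<^esub> x = x"

definition mod_hom ::
  "('r, 'x) ring_scheme \<Rightarrow> ('r, 'm) module \<Rightarrow> ('r, 'n) module \<Rightarrow> ('m \<Rightarrow> 'n) set" where
  "mod_hom R M N =
    {f \<in> carrier M \<rightarrow>\<^sub>E carrier N.
       (\<forall>x \<in> carrier M. \<forall>y \<in> carrier M. f (x \<oplus>\<^bsub>M\<^esub> y) = f x \<oplus>\<^bsub>N\<^esub> f y) \<and>
       (\<forall>a \<in> carrier R. \<forall>x \<in> carrier M. f (a \<odot>\<^bsub>M\<^esub> x) = a \<odot>\<^bsub>N\<^esub> f x)}"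

definition mod_isomorphic ::
  "('r, 'x) ring_scheme \<Rightarrow> ('r, 'm) module \<Rightarrow> ('r, 'n) module \<Rightarrow> bool" where
  "mod_isomorphic R M N \<longleftrightarrow> (\<exists>f \<in> mod_hom R M N. bij_betw f (carrier M) (carrier N))"


section \<open>Ext over an algebra\<close>

definition free_mod :: "('r, 'x) ring_scheme \<Rightarrow> 's set \<Rightarrow> ('r, 's \<Rightarrow> 'r) module" where
  "free_mod R S =
    \<lparr>carrier = {x. (\<forall>s \<in> S. x s \<in> carrier R) \<and> (\<forall>s. s \<notin> S \<longrightarrow> x s = \<zero>\<^bsub>R\<^esub>) \<and>
                  finite {s. x s \<noteq> \<zero>\<^bsub>R\<^esub>}},
     mult = undefined, one = undefined,
     zero = (\<lambda>_. \<zero>\<^bsub>R\<^esub>),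
     add = (\<lambda>x y s. x s \<oplus>\<^bsub>R\<^esub> y s),
     smult = (\<lambda>a x s. a \<otimes>\<^bsub>R\<^esub> x s)\<rparr>"

definition free_eval ::
  "('r, 'x) ring_scheme \<Rightarrow> ('r, 'm) module \<Rightarrow> ('m \<Rightarrow> 'r) \<Rightarrow> 'm" where
  "free_eval R M x = (\<Oplus>\<^bsub>M\<^esub>s\<in>{s. x s \<noteq> \<zero>\<^bsub>R\<^esub>}. x s \<odot>\<^bsub>M\<^esub> s)"

definition free_kernel ::
  "('r, 'x) ring_scheme \<Rightarrow> ('r, 'm) module \<Rightarrow> 'm set \<Rightarrow> ('m \<Rightarrow> 'r) set" where
  "free_kernel R M S = {x \<in> carrier (free_mod R S). free_eval R M x = \<zero>\<^bsub>M\<^esub>}"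

text \<open>
  For a $K$-algebra \<open>A\<close> the vector space structure on Hom is
  $(k f)(x) = (k \cdot 1_A) f(x)$.
\<close>

definition hom_space ::
  "('k::field, 'r) module \<Rightarrow> ('r, 'm) module \<Rightarrow> ('r, 'n) module \<Rightarrow> ('k, 'm \<Rightarrow> 'n) module" where
  "hom_space A M N =
    \<lparr>carrier = mod_hom A M N,
     mult = undefined, one = undefined,
     zero = (\<lambda>x\<in>carrier M. \<zero>\<^bsub>N\<^esub>),
     add = (\<lambda>f g. \<lambda>x\<in>carrier M. f x \<oplus>\<^bsub>N\<^esub> g x),
     smult = (\<lambda>k f. \<lambda>x\<in>carrier M. (k \<odot>\<^bsub>A\<^esub> \<one>\<^bsub>A\<^esub>) \<odot>\<^bsub>N\<^esub> f x)\<rparr>"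

definition quot_space :: "('k::field, 'a) module \<Rightarrow> 'a set \<Rightarrow> ('k, 'a set) module" where
  "quot_space V B =
    \<lparr>carrier = a_rcosets\<^bsub>V\<^esub> B,
     mult = undefined, one = undefined,
     zero = B,
     add = set_add V,
     smult = (\<lambda>k X. \<Union>x\<in>X. B +>\<^bsub>V\<^esub> (k \<odot>\<^bsub>V\<^esub> x))\<rparr>"

text \<open>
  $\mathrm{Ext}^1_A(M, N)$ is $H^1$ of $\mathrm{Hom}_A(F_\bullet, N)$ for the canonical free
  resolution $\cdots \to F_2 \to F_1 \to F_0 \to M \to 0$: \<open>F0\<close> is free on the
  elements of $M$, and each further $F_{i+1}$ is free on the elements of the kernel of the
  preceding map.
\<close>

definition Ext1 ::
  "('k::field, 'r) module \<Rightarrow> ('r, 'm) module \<Rightarrow> ('r, 'n) module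
    \<Rightarrow> ('k, ((('m \<Rightarrow> 'r) \<Rightarrow> 'r) \<Rightarrow> 'n) set) module" where
  "Ext1 A M N =
    (let F0 = free_mod A (carrier M); Z0 = free_kernel A M (carrier M);
         F1 = free_mod A Z0;          Z1 = free_kernel A F0 Z0;
         F2 = free_mod A Z1;
         cocycles = {f \<in> mod_hom A F1 N. \<forall>y \<in> carrier F2. f (free_eval A F1 y) = \<zero>\<^bsub>N\<^esub>};
         coboundaries = {\<lambda>x\<in>carrier F1. g (free_eval A F0 x) | g. g \<in> mod_hom A F0 N}
     in quot_space ((hom_space A F1 N)\<lparr>carrier := cocycles\<rparr>) coboundaries)"

definition fin_dim :: "('k::field, 'a) module \<Rightarrow> bool" where
  "fin_dim V \<longleftrightarrow>
    (\<exists>B. finite B \<and> B \<subseteq> carrier V \<and>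
      (\<forall>v \<in> carrier V. \<exists>c. v = (\<Oplus>\<^bsub>V\<^esub>b\<in>B. c b \<odot>\<^bsub>V\<^esub> b)))"


section \<open>Infinite paths and Chen simple modules\<close>

text \<open>
  The infinite path $e_1 e_2 \cdots$ is the stream \<open>p\<close> with $e_{i+1}$ = \<open>p !! i\<close>, and
  $\tau_{>n}(p)$ is \<open>sdrop n p\<close>.
\<close>

definition inf_path :: "('v, 'e) pre_digraph \<Rightarrow> 'e stream \<Rightarrow> bool" where
  "inf_path G p \<longleftrightarrow> (\<forall>i. p !! i \<in> arcs G \<and> head G (p !! i) = tail G (p !! Suc i))"

definition tail_equiv :: "'e stream \<Rightarrow> 'e stream \<Rightarrow> bool" where
  "tail_equiv p q \<longleftrightarrow> (\<exists>m n. sdrop m p = sdrop n q)"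

definition closed_path :: "('v, 'e) pre_digraph \<Rightarrow> 'e list \<Rightarrow> bool" where
  "closed_path G c \<longleftrightarrow> c \<noteq> [] \<and> (\<exists>u. pre_digraph.awalk G u c u)"

definition rational_path :: "('v, 'e) pre_digraph \<Rightarrow> 'e stream \<Rightarrow> bool" where
  "rational_path G p \<longleftrightarrow> inf_path G p \<and> (\<exists>c. closed_path G c \<and> tail_equiv p (cycle c))"

definition irrational_path :: "('v, 'e) pre_digraph \<Rightarrow> 'e stream \<Rightarrow> bool" where
  "irrational_path G p \<longleftrightarrow> inf_path G p \<and> \<not> rational_path G p"

definition path_class :: "('v, 'e) pre_digraph \<Rightarrow> 'e stream \<Rightarrow> 'e stream set" where
  "path_class G p = {q. inf_path G q \<and> tail_equiv p q}"

text \<open>Action of generators and of words on basis elements; \<open>None\<close> stands for the zero vector.\<close>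

fun gen_act ::
  "('v, 'e) pre_digraph \<Rightarrow> ('v, 'e) lpa_gen \<Rightarrow> 'e stream \<Rightarrow> 'e stream option" where
  "gen_act G (Vert v) q = (if v = tail G (shd q) then Some q else None)"
| "gen_act G (Edge e) q = (if head G e = tail G (shd q) then Some (e ## q) else None)"
| "gen_act G (Ghost e) q = (if e = shd q then Some (stl q) else None)"

fun word_act ::
  "('v, 'e) pre_digraph \<Rightarrow> ('v, 'e) lpa_gen list \<Rightarrow> 'e stream \<Rightarrow> 'e stream option" where
  "word_act G [] q = Some q"
| "word_act G (g # gs) q = Option.bind (word_act G gs q) (gen_act G g)"

definition free_act ::
  "('v, 'e) pre_digraph \<Rightarrow> ('v, 'e, 'k::field) free_elem \<Rightarrow> ('e stream \<Rightarrow>\<^sub>0 'k)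
    \<Rightarrow> ('e stream \<Rightarrow>\<^sub>0 'k)" where
  "free_act G x m =
    (\<Sum>w\<in>Poly_Mapping.keys x. \<Sum>q\<in>Poly_Mapping.keys m.
       case word_act G (letters w) q of
         None \<Rightarrow> 0
       | Some q' \<Rightarrow>
           Poly_Mapping.single q' (Poly_Mapping.lookup x w * Poly_Mapping.lookup m q))"

text \<open>
  The module $V_{[p]}$.  The relators act as zero, so the action of a coset does not depend on
  the representative.
\<close>

definition chen_module ::
  "('v, 'e) pre_digraph \<Rightarrow> 'e stream
    \<Rightarrow> (('v, 'e, 'k::field) lpa_elem, 'e stream \<Rightarrow>\<^sub>0 'k) module" where
  "chen_module G p =
    \<lparr>carrier = {m. Poly_Mapping.keys m \<subseteq> path_class G p},
     mult = undefined, one = undefined,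
     zero = 0, add = (+),
     smult = (\<lambda>X. free_act G (SOME x. x \<in> X))\<rparr>"

definition is_sink :: "('v, 'e) pre_digraph \<Rightarrow> 'v \<Rightarrow> bool" where
  "is_sink G w \<longleftrightarrow> w \<in> verts G \<and> out_arcs G w = {}"

definition sink_module ::
  "('v, 'e) pre_digraph \<Rightarrow> 'v \<Rightarrow> (('v, 'e, 'k::field) lpa_elem, ('v, 'e, 'k) lpa_elem) module"
  where
  "sink_module G w =
    \<lparr>carrier = {a \<otimes>\<^bsub>lpa G\<^esub> lpa_vert G w | a. a \<in> carrier (lpa G)},
     mult = undefined, one = undefined,
     zero = \<zero>\<^bsub>lpa G\<^esub>, add = add (lpa G), smult = mult (lpa G)\<rparr>"

text \<open>
  The two kinds of Chen simple modules have carriers of different types; a left module over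
  an arbitrary carrier type counts as one if it is isomorphic to one of them.
\<close>

definition chen_simple ::
  "('v, 'e) pre_digraph \<Rightarrow> (('v, 'e, 'k::field) lpa_elem, 't) module \<Rightarrow> bool" where
  "chen_simple G T \<longleftrightarrow> left_module (lpa G) T \<and>
    ((\<exists>q. inf_path G q \<and> mod_isomorphic (lpa G) (chen_module G q) T) \<or>
     (\<exists>w. is_sink G w \<and> mod_isomorphic (lpa G) (sink_module G w) T))"

definition U_set ::
  "('v, 'e) pre_digraph \<Rightarrow> (('v, 'e, 'k::field) lpa_elem, 't) module \<Rightarrow> 'v set" where
  "U_set G T = {v \<in> verts G. \<exists>t \<in> carrier T. lpa_vert G v \<odot>\<^bsub>T\<^esub> t \<noteq> \<zero>\<^bsub>T\<^esub>}"

text \<open>\<open>exits G p i\<close> is $X_i(p)$, the arcs leaving \<open>p\<close> at its vertex number \<open>i\<close>.\<close>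

definition exits :: "('v, 'e) pre_digraph \<Rightarrow> 'e stream \<Rightarrow> nat \<Rightarrow> 'e set" where
  "exits G p i = {f \<in> arcs G. tail G f = tail G (p !! i) \<and> f \<noteq> p !! i}"

end

theory Submission
  imports Defs
begin

text \<open>
  Write $p = e_1 e_2 \cdots$, $\alpha_n = e_1 \cdots e_n$ and $\pi_n = \alpha_n \alpha_n^*$; these are
  idempotents with $\pi_n \pi_{n+1} = \pi_{n+1} = \pi_{n+1} \pi_n$. Since $p$ is irrational, the
  annihilator of the generator $p$ of $V_{[p]}$ is the increasing union of the left ideals
  $L (1 - \pi_n)$. Hence $\mathrm{Ext}^1(V_{[p]}, T)$ is the space of sequences
  $(s_n) \in \prod_n (\pi_n - \pi_{n+1}) T$ modulo the sequences $((\pi_n - \pi_{n+1}) t)_n$ with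
  $t \in T$. In a Chen simple module the sequence $\pi_n t$ is eventually constant, so the latter
  sequences have finite support. The quotient therefore vanishes if only finitely many factors are
  nonzero, and otherwise indicators of infinitely many disjoint infinite sets of indices give
  linearly independent classes. Finally, (CK2) identifies $\pi_n - \pi_{n+1}$ with
  $\sum_{f \in X_n(p)} \alpha_n f f^* \alpha_n^*$, and so the nonzero factors with the indices $n$ such
  that $r(X_n(p)) \cap U(T) \neq \emptyset$.
\<close>

section \<open>Free modules\<close>

text \<open>\<open>Ext1\<close> is built from the resolution that is free on all elements, so its
  cocycles live on very large free modules. They are compared with 0 -> I -> L -> V_[p] -> 0, where
  I is the annihilator of p: a cocycle becomes a homomorphism I -> T, a coboundary a map x \<mapsto>
  x t with t in T. A homomorphism on I amounts to a compatible family of values at the idempotents 1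
  - \<pi>_n, and the increments of this family are its values at \<pi>_n - \<pi>_{n+1}; this is the
  origin of the sequences. The isomorphism itself is not constructed: it is enough that increments
  can be prescribed, and that those of a coboundary vanish from some index on.

  Irrationality is what makes I a union of left ideals generated by idempotents. For p =
  c^\<infinity> with c closed, c - s(c) kills p, but (c - s(c)) \<alpha>_n is a difference of paths
  of different lengths and never vanishes. For irrational p a given tail of p occurs at only one
  position of a path, which excludes such cancellations.\<close>

lemma (in abelian_group) minus_eq_zero_iff:
  assumes "x \<in> carrier G" "y \<in> carrier G" shows "x \<ominus> y = \<zero> \<longleftrightarrow> x = y"
proof
  assume "x \<ominus> y = \<zero>"
  then show "x = y" using assms minus_equality[of x "\<ominus> y"] by (simp add: minus_eq)
qed (use assms in \<open>simp add: minus_eq r_neg\<close>)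

lemma (in abelian_group) minus_zero_right:
  assumes "x \<in> carrier G" shows "x \<ominus> \<zero> = x"
  using assms by (simp add: minus_eq)

lemma (in abelian_group) add_minus_cancel:
  assumes "x \<in> carrier G" "y \<in> carrier G" shows "y \<oplus> (x \<ominus> y) = x"
  using assms by (simp add: minus_eq a_lcomm r_neg)

lemma (in abelian_group) add_minus_add:
  assumes "a \<in> carrier G" "b \<in> carrier G" "c \<in> carrier G" "d \<in> carrier G"
  shows "(a \<oplus> b) \<ominus> (c \<oplus> d) = (a \<ominus> c) \<oplus> (b \<ominus> d)"
  using assms by (simp add: minus_eq minus_add a_ac)

context left_module begin

lemma smult_zero_right [simp]:
  assumes "a \<in> carrier R" shows "a \<odot>\<^bsub>M\<^esub> \<zero>\<^bsub>M\<^esub> = \<zero>\<^bsub>M\<^esub>"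
proof -
  have "a \<odot>\<^bsub>M\<^esub> \<zero>\<^bsub>M\<^esub> \<oplus>\<^bsub>M\<^esub> a \<odot>\<^bsub>M\<^esub> \<zero>\<^bsub>M\<^esub> = a \<odot>\<^bsub>M\<^esub> \<zero>\<^bsub>M\<^esub>"
    using smult_r_distr[of a "\<zero>\<^bsub>M\<^esub>" "\<zero>\<^bsub>M\<^esub>"] assms by simp
  then show ?thesis
    using M.add.l_cancel_one' smult_closed[OF assms, of "\<zero>\<^bsub>M\<^esub>"] by (metis M.zero_closed)
qed

lemma smult_zero_left [simp]:
  assumes "x \<in> carrier M" shows "\<zero> \<odot>\<^bsub>M\<^esub> x = \<zero>\<^bsub>M\<^esub>"
proof -
  have "\<zero> \<odot>\<^bsub>M\<^esub> x \<oplus>\<^bsub>M\<^esub> \<zero> \<odot>\<^bsub>M\<^esub> x = \<zero> \<odot>\<^bsub>M\<^esub> x"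
    using smult_l_distr[of \<zero> \<zero> x] assms by simp
  then show ?thesis
    using M.add.l_cancel_one' smult_closed[of \<zero> x] assms by (metis R.zero_closed)
qed

lemma smult_minus_left:
  assumes "a \<in> carrier R" "x \<in> carrier M" shows "(\<ominus> a) \<odot>\<^bsub>M\<^esub> x = \<ominus>\<^bsub>M\<^esub> (a \<odot>\<^bsub>M\<^esub> x)"
proof -
  have "(\<ominus> a) \<odot>\<^bsub>M\<^esub> x \<oplus>\<^bsub>M\<^esub> a \<odot>\<^bsub>M\<^esub> x = \<zero>\<^bsub>M\<^esub>"
    using smult_l_distr[of "\<ominus> a" a x] assms by (simp add: R.l_neg)
  then show ?thesis
    using M.minus_equality smult_closed assms by (metis R.a_inv_closed)
qed

lemma smult_minus_right:
  assumes "a \<in> carrier R" "x \<in> carrier M" shows "a \<odot>\<^bsub>M\<^esub> (\<ominus>\<^bsub>M\<^esub> x) = \<ominus>\<^bsub>M\<^esub> (a \<odot>\<^bsub>M\<^esub> x)"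
proof -
  have "a \<odot>\<^bsub>M\<^esub> (\<ominus>\<^bsub>M\<^esub> x) \<oplus>\<^bsub>M\<^esub> a \<odot>\<^bsub>M\<^esub> x = \<zero>\<^bsub>M\<^esub>"
    using smult_r_distr[of a "\<ominus>\<^bsub>M\<^esub> x" x] assms by (simp add: M.l_neg)
  then show ?thesis
    using M.minus_equality smult_closed assms by (metis M.a_inv_closed)
qed

lemma smult_diff_left:
  assumes "a \<in> carrier R" "b \<in> carrier R" "x \<in> carrier M"
  shows "(a \<ominus> b) \<odot>\<^bsub>M\<^esub> x = a \<odot>\<^bsub>M\<^esub> x \<ominus>\<^bsub>M\<^esub> b \<odot>\<^bsub>M\<^esub> x"
  using assms by (simp add: R.minus_eq M.minus_eq smult_l_distr smult_minus_left)

lemma smult_diff_right: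
  assumes "a \<in> carrier R" "x \<in> carrier M" "y \<in> carrier M"
  shows "a \<odot>\<^bsub>M\<^esub> (x \<ominus>\<^bsub>M\<^esub> y) = a \<odot>\<^bsub>M\<^esub> x \<ominus>\<^bsub>M\<^esub> a \<odot>\<^bsub>M\<^esub> y"
  using assms by (simp add: M.minus_eq smult_r_distr smult_minus_right smult_closed)

lemma smult_finsum:
  assumes "finite I" "a \<in> carrier R" "f \<in> I \<rightarrow> carrier M"
  shows "a \<odot>\<^bsub>M\<^esub> (\<Oplus>\<^bsub>M\<^esub>i\<in>I. f i) = (\<Oplus>\<^bsub>M\<^esub>i\<in>I. a \<odot>\<^bsub>M\<^esub> f i)"
  using assms(1,3)
proof (induction I)
  case empty
  then show ?case using assms by simp
next
  case (insert i I)
  then have "f \<in> I \<rightarrow> carrier M" "f i \<in> carrier M" by auto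
  with insert show ?case
    using assms(2) by (simp add: smult_r_distr smult_closed Pi_def)
qed

end

lemma free_mod_simps [simp]:
  "carrier (free_mod R S) = {x. (\<forall>s \<in> S. x s \<in> carrier R) \<and> (\<forall>s. s \<notin> S \<longrightarrow> x s = \<zero>\<^bsub>R\<^esub>) \<and>
     finite {s. x s \<noteq> \<zero>\<^bsub>R\<^esub>}}"
  "\<zero>\<^bsub>free_mod R S\<^esub> = (\<lambda>_. \<zero>\<^bsub>R\<^esub>)"
  "x \<oplus>\<^bsub>free_mod R S\<^esub> y = (\<lambda>s. x s \<oplus>\<^bsub>R\<^esub> y s)"
  "a \<odot>\<^bsub>free_mod R S\<^esub> x = (\<lambda>s. a \<otimes>\<^bsub>R\<^esub> x s)"
  by (simp_all add: free_mod_def)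

lemma free_mod_coeff_closed:
  assumes "ring R" "x \<in> carrier (free_mod R S)" shows "x s \<in> carrier R"
  using assms ring.ring_simprules(2) by (cases "s \<in> S") auto

lemma left_module_free_mod:
  assumes "ring R" shows "left_module R (free_mod R S)"
proof -
  interpret R: ring R by fact
  have *: "x s \<in> carrier R" if "x \<in> carrier (free_mod R S)" for x s
    using assms that by (rule free_mod_coeff_closed)
  have add_closed: "x \<oplus>\<^bsub>free_mod R S\<^esub> y \<in> carrier (free_mod R S)"
    if "x \<in> carrier (free_mod R S)" "y \<in> carrier (free_mod R S)" for x y
  proof -
    have "{s. x s \<oplus>\<^bsub>R\<^esub> y s \<noteq> \<zero>\<^bsub>R\<^esub>} \<subseteq> {s. x s \<noteq> \<zero>\<^bsub>R\<^esub>} \<union> {s. y s \<noteq> \<zero>\<^bsub>R\<^esub>}"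
      by auto
    then have "finite {s. x s \<oplus>\<^bsub>R\<^esub> y s \<noteq> \<zero>\<^bsub>R\<^esub>}"
      using that by (auto intro: finite_subset)
    then show ?thesis using that by simp
  qed
  have smult_closed: "a \<odot>\<^bsub>free_mod R S\<^esub> x \<in> carrier (free_mod R S)"
    if "a \<in> carrier R" "x \<in> carrier (free_mod R S)" for a x
  proof -
    have "{s. a \<otimes>\<^bsub>R\<^esub> x s \<noteq> \<zero>\<^bsub>R\<^esub>} \<subseteq> {s. x s \<noteq> \<zero>\<^bsub>R\<^esub>}"
      using that by auto
    then have "finite {s. a \<otimes>\<^bsub>R\<^esub> x s \<noteq> \<zero>\<^bsub>R\<^esub>}"
      using that by (auto intro: finite_subset)
    then show ?thesis using that by simp
  qed
  have group: "abelian_group (free_mod R S)"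
  proof (rule abelian_groupI)
    fix x assume x: "x \<in> carrier (free_mod R S)"
    have "(\<lambda>s. \<ominus>\<^bsub>R\<^esub> x s) \<oplus>\<^bsub>free_mod R S\<^esub> x = \<zero>\<^bsub>free_mod R S\<^esub>"
      using *[OF x] by (simp add: R.l_neg)
    moreover have "{s. \<ominus>\<^bsub>R\<^esub> x s \<noteq> \<zero>\<^bsub>R\<^esub>} \<subseteq> {s. x s \<noteq> \<zero>\<^bsub>R\<^esub>}"
      by auto
    then have "finite {s. \<ominus>\<^bsub>R\<^esub> x s \<noteq> \<zero>\<^bsub>R\<^esub>}"
      using x by (auto intro: finite_subset)
    then have "(\<lambda>s. \<ominus>\<^bsub>R\<^esub> x s) \<in> carrier (free_mod R S)"
      using x by simp
    ultimately show "\<exists>y\<in>carrier (free_mod R S). y \<oplus>\<^bsub>free_mod R S\<^esub> x = \<zero>\<^bsub>free_mod R S\<^esub>"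
      by blast
  next
    fix x y z
    assume "x \<in> carrier (free_mod R S)" "y \<in> carrier (free_mod R S)" "z \<in> carrier (free_mod R S)"
    then show "x \<oplus>\<^bsub>free_mod R S\<^esub> y \<oplus>\<^bsub>free_mod R S\<^esub> z =
        x \<oplus>\<^bsub>free_mod R S\<^esub> (y \<oplus>\<^bsub>free_mod R S\<^esub> z)"
      using *[of x] *[of y] *[of z] by (simp add: R.a_assoc)
  next
    fix x y assume "x \<in> carrier (free_mod R S)" "y \<in> carrier (free_mod R S)"
    then show "x \<oplus>\<^bsub>free_mod R S\<^esub> y = y \<oplus>\<^bsub>free_mod R S\<^esub> x"
      using *[of x] *[of y] by (simp add: R.a_comm)
  next
    fix x assume "x \<in> carrier (free_mod R S)"
    then show "\<zero>\<^bsub>free_mod R S\<^esub> \<oplus>\<^bsub>free_mod R S\<^esub> x = x"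
      using *[of x] by simp
  qed (use add_closed in auto)
  show ?thesis
  proof (intro left_module.intro left_module_axioms.intro assms group smult_closed)
    fix a b x assume "a \<in> carrier R" "b \<in> carrier R" "x \<in> carrier (free_mod R S)"
    then show "(a \<oplus>\<^bsub>R\<^esub> b) \<odot>\<^bsub>free_mod R S\<^esub> x =
        a \<odot>\<^bsub>free_mod R S\<^esub> x \<oplus>\<^bsub>free_mod R S\<^esub> b \<odot>\<^bsub>free_mod R S\<^esub> x"
      and "(a \<otimes>\<^bsub>R\<^esub> b) \<odot>\<^bsub>free_mod R S\<^esub> x =
        a \<odot>\<^bsub>free_mod R S\<^esub> (b \<odot>\<^bsub>free_mod R S\<^esub> x)"
      using *[of x] by (simp_all add: R.l_distr R.m_assoc)
  next
    fix a x y assume "a \<in> carrier R" "x \<in> carrier (free_mod R S)" "y \<in> carrier (free_mod R S)"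
    then show "a \<odot>\<^bsub>free_mod R S\<^esub> (x \<oplus>\<^bsub>free_mod R S\<^esub> y) =
        a \<odot>\<^bsub>free_mod R S\<^esub> x \<oplus>\<^bsub>free_mod R S\<^esub> a \<odot>\<^bsub>free_mod R S\<^esub> y"
      using *[of x] *[of y] by (simp add: R.r_distr)
  next
    fix x assume "x \<in> carrier (free_mod R S)"
    then show "\<one>\<^bsub>R\<^esub> \<odot>\<^bsub>free_mod R S\<^esub> x = x"
      using *[of x] by simp
  qed
qed

text \<open>The basis vector of the free module at \<open>s\<close>.\<close>

definition free_unit :: "('r, 'x) ring_scheme \<Rightarrow> 's \<Rightarrow> 's \<Rightarrow> 'r" where
  "free_unit R s = (\<lambda>s'. if s' = s then \<one>\<^bsub>R\<^esub> else \<zero>\<^bsub>R\<^esub>)"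

lemma free_unit_closed:
  assumes "ring R" "s \<in> S" shows "free_unit R s \<in> carrier (free_mod R S)"
proof -
  interpret R: ring R by fact
  have "{s'. free_unit R s s' \<noteq> \<zero>\<^bsub>R\<^esub>} \<subseteq> {s}" by (auto simp: free_unit_def)
  then have "finite {s'. free_unit R s s' \<noteq> \<zero>\<^bsub>R\<^esub>}" by (auto intro: finite_subset)
  then show ?thesis using assms by (auto simp: free_unit_def)
qed

text \<open>The linear map on a free module that sends the basis vector at \<open>s\<close> to
  \<open>w s\<close>. The sum runs over the support of \<open>x\<close>, so the index set of the
  free module is not an argument.\<close>

definition lin_ext ::
  "('r, 'x) ring_scheme \<Rightarrow> ('r, 'n, 'y) module_scheme \<Rightarrow> ('s \<Rightarrow> 'n) \<Rightarrow> ('s \<Rightarrow> 'r) \<Rightarrow> 'n" where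
  "lin_ext R N w x = (\<Oplus>\<^bsub>N\<^esub>s\<in>{s. x s \<noteq> \<zero>\<^bsub>R\<^esub>}. x s \<odot>\<^bsub>N\<^esub> w s)"

lemma free_eval_eq_lin_ext: "free_eval R M = lin_ext R M (\<lambda>s. s)"
  by (simp add: fun_eq_iff free_eval_def lin_ext_def)

context left_module begin

text \<open>The supports of \<open>x\<close>, \<open>y\<close> and their sum differ; linearity is
  proved by summing over one common finite set instead.\<close>

lemma lin_ext_eq_finsum:
  assumes "x \<in> carrier (free_mod R S)" "w \<in> S \<rightarrow> carrier M"
    and "finite A" "{s. x s \<noteq> \<zero>} \<subseteq> A" "A \<subseteq> S"
  shows "lin_ext R M w x = (\<Oplus>\<^bsub>M\<^esub>s\<in>A. x s \<odot>\<^bsub>M\<^esub> w s)"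
proof -
  have "x s \<odot>\<^bsub>M\<^esub> w s \<in> carrier M" if "s \<in> A" for s
    using assms that by (intro smult_closed) (auto simp: Pi_def)
  moreover have "x s \<odot>\<^bsub>M\<^esub> w s = \<zero>\<^bsub>M\<^esub>" if "s \<in> A - {s. x s \<noteq> \<zero>}" for s
    using assms that by (auto simp: Pi_def subset_iff)
  ultimately show ?thesis
    unfolding lin_ext_def using assms
    by (intro M.add.finprod_mono_neutral_cong_left) auto
qed

lemma lin_ext_closed:
  assumes "x \<in> carrier (free_mod R S)" "w \<in> S \<rightarrow> carrier M"
  shows "lin_ext R M w x \<in> carrier M"
proof -
  have "x s \<odot>\<^bsub>M\<^esub> w s \<in> carrier M" if "x s \<noteq> \<zero>" for s
    using assms that smult_closed by (cases "s \<in> S") (auto simp: Pi_def)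
  then show ?thesis unfolding lin_ext_def by (intro M.finsum_closed) auto
qed

lemma lin_ext_add:
  assumes "x \<in> carrier (free_mod R S)" "y \<in> carrier (free_mod R S)" "w \<in> S \<rightarrow> carrier M"
  shows "lin_ext R M w (x \<oplus>\<^bsub>free_mod R S\<^esub> y) = lin_ext R M w x \<oplus>\<^bsub>M\<^esub> lin_ext R M w y"
proof -
  interpret F: left_module R "free_mod R S"
    by (rule left_module_free_mod) (rule R.ring_axioms)
  define A where "A = {s. x s \<noteq> \<zero>} \<union> {s. y s \<noteq> \<zero>}"
  have A: "finite A" "A \<subseteq> S" "{s. x s \<noteq> \<zero>} \<subseteq> A" "{s. y s \<noteq> \<zero>} \<subseteq> A"
    "{s. (x \<oplus>\<^bsub>free_mod R S\<^esub> y) s \<noteq> \<zero>} \<subseteq> A"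
    using assms by (auto simp: A_def)
  have *: "(\<lambda>s. x s \<odot>\<^bsub>M\<^esub> w s) \<in> A \<rightarrow> carrier M" "(\<lambda>s. y s \<odot>\<^bsub>M\<^esub> w s) \<in> A \<rightarrow> carrier M"
    using assms A(2) by (auto intro!: smult_closed simp: Pi_def)
  have "lin_ext R M w (x \<oplus>\<^bsub>free_mod R S\<^esub> y) =
      (\<Oplus>\<^bsub>M\<^esub>s\<in>A. (x \<oplus>\<^bsub>free_mod R S\<^esub> y) s \<odot>\<^bsub>M\<^esub> w s)"
    using assms A by (intro lin_ext_eq_finsum[where S = S] F.a_closed)
  also have "\<dots> = (\<Oplus>\<^bsub>M\<^esub>s\<in>A. x s \<odot>\<^bsub>M\<^esub> w s \<oplus>\<^bsub>M\<^esub> y s \<odot>\<^bsub>M\<^esub> w s)"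
    using assms A(2) *
    by (intro M.finsum_cong') (auto simp: smult_l_distr smult_closed Pi_def subset_iff)
  also have "\<dots> = (\<Oplus>\<^bsub>M\<^esub>s\<in>A. x s \<odot>\<^bsub>M\<^esub> w s) \<oplus>\<^bsub>M\<^esub> (\<Oplus>\<^bsub>M\<^esub>s\<in>A. y s \<odot>\<^bsub>M\<^esub> w s)"
    using * by (rule M.finsum_addf)
  also have "\<dots> = lin_ext R M w x \<oplus>\<^bsub>M\<^esub> lin_ext R M w y"
    using lin_ext_eq_finsum[OF assms(1,3) A(1,3,2)] lin_ext_eq_finsum[OF assms(2,3) A(1,4,2)]
    by simp
  finally show ?thesis .
qed

lemma lin_ext_smult:
  assumes "a \<in> carrier R" "x \<in> carrier (free_mod R S)" "w \<in> S \<rightarrow> carrier M"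
  shows "lin_ext R M w (a \<odot>\<^bsub>free_mod R S\<^esub> x) = a \<odot>\<^bsub>M\<^esub> lin_ext R M w x"
proof -
  interpret F: left_module R "free_mod R S"
    by (rule left_module_free_mod) (rule R.ring_axioms)
  define A where "A = {s. x s \<noteq> \<zero>}"
  have A: "finite A" "A \<subseteq> S" "{s. (a \<odot>\<^bsub>free_mod R S\<^esub> x) s \<noteq> \<zero>} \<subseteq> A"
    using assms by (auto simp: A_def)
  have *: "(\<lambda>s. x s \<odot>\<^bsub>M\<^esub> w s) \<in> A \<rightarrow> carrier M"
    using assms A(2) by (auto intro!: smult_closed simp: Pi_def)
  have "lin_ext R M w (a \<odot>\<^bsub>free_mod R S\<^esub> x) =
      (\<Oplus>\<^bsub>M\<^esub>s\<in>A. (a \<odot>\<^bsub>free_mod R S\<^esub> x) s \<odot>\<^bsub>M\<^esub> w s)"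
    using assms A by (intro lin_ext_eq_finsum[where S = S] F.smult_closed)
  also have "\<dots> = (\<Oplus>\<^bsub>M\<^esub>s\<in>A. a \<odot>\<^bsub>M\<^esub> (x s \<odot>\<^bsub>M\<^esub> w s))"
    using assms A(2) *
    by (intro M.finsum_cong') (auto simp: smult_assoc smult_closed Pi_def subset_iff)
  also have "\<dots> = a \<odot>\<^bsub>M\<^esub> (\<Oplus>\<^bsub>M\<^esub>s\<in>A. x s \<odot>\<^bsub>M\<^esub> w s)"
    using smult_finsum[OF A(1) assms(1) *] by simp
  finally show ?thesis by (simp add: lin_ext_def A_def)
qed

lemma lin_ext_free_unit:
  assumes "s \<in> S" "w \<in> S \<rightarrow> carrier M"
  shows "lin_ext R M w (free_unit R s) = w s"
proof -
  have "w s \<in> carrier M" using assms by auto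
  have "lin_ext R M w (free_unit R s) = (\<Oplus>\<^bsub>M\<^esub>s'\<in>{s}. free_unit R s s' \<odot>\<^bsub>M\<^esub> w s')"
    using assms
    by (intro lin_ext_eq_finsum[where S = S] free_unit_closed R.ring_axioms) (auto simp: free_unit_def)
  also have "\<dots> = w s"
    using \<open>w s \<in> carrier M\<close> by (simp add: free_unit_def smult_one)
  finally show ?thesis .
qed

lemma lin_ext_zero:
  assumes "\<And>s. s \<in> S \<Longrightarrow> w s = \<zero>\<^bsub>M\<^esub>" "x \<in> carrier (free_mod R S)"
  shows "lin_ext R M w x = \<zero>\<^bsub>M\<^esub>"
proof -
  have "x s \<odot>\<^bsub>M\<^esub> w s = \<zero>\<^bsub>M\<^esub>" if "x s \<noteq> \<zero>" for s
    using assms that by (cases "s \<in> S") auto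
  then show ?thesis unfolding lin_ext_def by (intro M.add.finprod_one_eqI) auto
qed

end

text \<open>Differs from \<open>mod_hom\<close> in not demanding extensionality, so that sums,
  multiples and composites need no restriction to the carrier; \<open>restrict_mod_hom\<close> goes
  back.\<close>

definition is_mod_hom ::
  "('r, 'x) ring_scheme \<Rightarrow> ('r, 'm) module \<Rightarrow> ('r, 'n) module \<Rightarrow> ('m \<Rightarrow> 'n) \<Rightarrow> bool" where
  "is_mod_hom R M N f \<longleftrightarrow> f \<in> carrier M \<rightarrow> carrier N \<and>
     (\<forall>x \<in> carrier M. \<forall>y \<in> carrier M. f (x \<oplus>\<^bsub>M\<^esub> y) = f x \<oplus>\<^bsub>N\<^esub> f y) \<and>
     (\<forall>a \<in> carrier R. \<forall>x \<in> carrier M. f (a \<odot>\<^bsub>M\<^esub> x) = a \<odot>\<^bsub>N\<^esub> f x)"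

lemma mod_hom_iff: "f \<in> mod_hom R M N \<longleftrightarrow> is_mod_hom R M N f \<and> f \<in> extensional (carrier M)"
  by (auto simp: mod_hom_def is_mod_hom_def PiE_def)

lemma is_mod_homD:
  assumes "is_mod_hom R M N f"
  shows "x \<in> carrier M \<Longrightarrow> f x \<in> carrier N"
    and "x \<in> carrier M \<Longrightarrow> y \<in> carrier M \<Longrightarrow> f (x \<oplus>\<^bsub>M\<^esub> y) = f x \<oplus>\<^bsub>N\<^esub> f y"
    and "a \<in> carrier R \<Longrightarrow> x \<in> carrier M \<Longrightarrow> f (a \<odot>\<^bsub>M\<^esub> x) = a \<odot>\<^bsub>N\<^esub> f x"
  using assms by (auto simp: is_mod_hom_def)

lemma restrict_mod_hom:
  assumes "left_module R M" "is_mod_hom R M N f"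
  shows "restrict f (carrier M) \<in> mod_hom R M N"
proof -
  interpret M: left_module R M by fact
  show ?thesis
    using assms(2) by (auto simp: mod_hom_def is_mod_hom_def M.smult_closed)
qed

locale left_module_hom = M: left_module R M + N: left_module R N
  for R :: "('r, 'x) ring_scheme" (structure) and M :: "('r, 'm) module" and N :: "('r, 'n) module" +
  fixes f
  assumes is_hom: "is_mod_hom R M N f"
begin

lemmas hom_closed = is_mod_homD(1)[OF is_hom]
  and hom_add = is_mod_homD(2)[OF is_hom]
  and hom_smult = is_mod_homD(3)[OF is_hom]

sublocale abelian_group_hom M N f
  by (rule abelian_group_homI)
     (auto intro!: group_hom.intro group_hom_axioms.intro M.M.a_group N.M.a_group
           simp: hom_def hom_closed hom_add M.M.abelian_group_axioms N.M.abelian_group_axioms)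

lemma hom_diff:
  assumes "x \<in> carrier M" "y \<in> carrier M"
  shows "f (x \<ominus>\<^bsub>M\<^esub> y) = f x \<ominus>\<^bsub>N\<^esub> f y"
  using assms by (simp add: M.M.minus_eq N.M.minus_eq)

lemma hom_finsum:
  assumes "finite I" "g \<in> I \<rightarrow> carrier M"
  shows "f (\<Oplus>\<^bsub>M\<^esub>i\<in>I. g i) = (\<Oplus>\<^bsub>N\<^esub>i\<in>I. f (g i))"
  using assms
proof (induction I)
  case empty
  then show ?case by simp
next
  case (insert i I)
  then have "g \<in> I \<rightarrow> carrier M" "g i \<in> carrier M" by auto
  with insert show ?case by (simp add: Pi_def)
qed

lemma hom_lin_ext:
  assumes "x \<in> carrier (free_mod R S)" "w \<in> S \<rightarrow> carrier M"
  shows "f (lin_ext R M w x) = lin_ext R N (\<lambda>s. f (w s)) x"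
proof -
  have *: "x s \<in> carrier R \<and> w s \<in> carrier M" if "x s \<noteq> \<zero>" for s
    using assms that by (cases "s \<in> S") (auto simp: Pi_def)
  have "f (lin_ext R M w x) = (\<Oplus>\<^bsub>N\<^esub>s\<in>{s. x s \<noteq> \<zero>}. f (x s \<odot>\<^bsub>M\<^esub> w s))"
    unfolding lin_ext_def using assms *
    by (intro hom_finsum) (auto intro: M.smult_closed)
  also have "\<dots> = lin_ext R N (\<lambda>s. f (w s)) x"
    unfolding lin_ext_def using *
    by (intro N.M.finsum_cong') (auto simp: hom_smult N.smult_closed hom_closed)
  finally show ?thesis .
qed

end

section \<open>Cocycles and coboundaries\<close>

text \<open>As in \<open>hom_space\<close>, scalars act through the elements
  \<open>k \<odot> \<one>\<close>. The assumptions say that k \<mapsto> k 1 is a unital ring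
  homomorphism from K into the centre of A.\<close>

locale algebra_modules = M: left_module A M + N: left_module A N
  for A :: "('k::field, 'r) module" (structure) and M :: "('r, 'm) module" and N :: "('r, 'n) module" +
  assumes scalar_closed: "k \<odot> \<one> \<in> carrier A"
    and scalar_commute: "a \<in> carrier A \<Longrightarrow> (k \<odot> \<one>) \<otimes> a = a \<otimes> (k \<odot> \<one>)"
    and scalar_add: "(k + l) \<odot> \<one> = k \<odot> \<one> \<oplus> l \<odot> \<one>"
    and scalar_mult: "(k * l) \<odot> \<one> = (k \<odot> \<one>) \<otimes> (l \<odot> \<one>)"
    and scalar_one: "1 \<odot> \<one> = \<one>"
begin

abbreviation scale :: "'k \<Rightarrow> 'n \<Rightarrow> 'n" (infixr "\<cdot>" 70) where
  "k \<cdot> x \<equiv> (k \<odot> \<one>) \<odot>\<^bsub>N\<^esub> x"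

definition "F0 = free_mod A (carrier M)"
definition "Z0 = free_kernel A M (carrier M)"
definition "F1 = free_mod A Z0"
definition "Z1 = free_kernel A F0 Z0"
definition "F2 = free_mod A Z1"
definition "cocycles = {f \<in> mod_hom A F1 N. \<forall>y \<in> carrier F2. f (free_eval A F1 y) = \<zero>\<^bsub>N\<^esub>}"
definition "coboundaries = {\<lambda>x\<in>carrier F1. g (free_eval A F0 x) | g. g \<in> mod_hom A F0 N}"
definition "cocycle_space = (hom_space A F1 N)\<lparr>carrier := cocycles\<rparr>"

lemma Ext1_eq: "Ext1 A M N = quot_space cocycle_space coboundaries"
  by (simp add: Ext1_def cocycle_space_def cocycles_def coboundaries_def F0_def F1_def F2_def
      Z0_def Z1_def Let_def)

sublocale F0: left_module A F0
  unfolding F0_def by (rule left_module_free_mod) (rule M.R.ring_axioms)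

sublocale F1: left_module A F1
  unfolding F1_def by (rule left_module_free_mod) (rule M.R.ring_axioms)

lemma Z0_subset: "Z0 \<subseteq> carrier F0" and Z1_subset: "Z1 \<subseteq> carrier F1"
  by (auto simp: Z0_def Z1_def free_kernel_def F0_def F1_def)

lemma is_mod_hom_eval0: "is_mod_hom A F0 M (free_eval A M)"
  unfolding is_mod_hom_def free_eval_eq_lin_ext F0_def
  by (intro conjI ballI funcsetI M.lin_ext_closed[where S = "carrier M"]
      M.lin_ext_add[where S = "carrier M"] M.lin_ext_smult[where S = "carrier M"]) auto

lemma is_mod_hom_eval1: "is_mod_hom A F1 F0 (free_eval A F0)"
  unfolding is_mod_hom_def free_eval_eq_lin_ext F1_def using Z0_subset
  by (intro conjI ballI funcsetI F0.lin_ext_closed[where S = Z0]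
      F0.lin_ext_add[where S = Z0] F0.lin_ext_smult[where S = Z0]) auto

sublocale d0: left_module_hom A F0 M "free_eval A M"
  by unfold_locales (rule is_mod_hom_eval0)

sublocale d1: left_module_hom A F1 F0 "free_eval A F0"
  by unfold_locales (rule is_mod_hom_eval1)

lemma Z0_iff: "z \<in> Z0 \<longleftrightarrow> z \<in> carrier F0 \<and> free_eval A M z = \<zero>\<^bsub>M\<^esub>"
  by (auto simp: Z0_def free_kernel_def F0_def)

lemma Z1_iff: "y \<in> Z1 \<longleftrightarrow> y \<in> carrier F1 \<and> free_eval A F0 y = \<zero>\<^bsub>F0\<^esub>"
  by (auto simp: Z1_def free_kernel_def F1_def)

lemma eval1_in_Z0:
  assumes "y \<in> carrier F1" shows "free_eval A F0 y \<in> Z0"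
proof -
  have "free_eval A M (free_eval A F0 y) = \<zero>\<^bsub>M\<^esub>"
    using assms Z0_subset unfolding F1_def
    by (subst free_eval_eq_lin_ext[of A F0], subst d0.hom_lin_ext[where S = Z0])
       (auto intro: M.lin_ext_zero[where S = Z0] simp: Z0_iff)
  then show ?thesis using assms by (simp add: Z0_iff)
qed

lemma unit_in_F0: "m \<in> carrier M \<Longrightarrow> free_unit A m \<in> carrier F0"
  and unit_in_F1: "z \<in> Z0 \<Longrightarrow> free_unit A z \<in> carrier F1"
  unfolding F0_def F1_def by (simp_all add: free_unit_closed M.R.ring_axioms del: free_mod_simps)

lemma eval0_unit: "m \<in> carrier M \<Longrightarrow> free_eval A M (free_unit A m) = m"
  unfolding free_eval_eq_lin_ext by (rule M.lin_ext_free_unit) auto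

lemma eval1_unit: "z \<in> Z0 \<Longrightarrow> free_eval A F0 (free_unit A z) = z"
  unfolding free_eval_eq_lin_ext using Z0_subset by (intro F0.lin_ext_free_unit) auto

text \<open>\<open>F2\<close> is free on the kernel of F1 -> F0, hence its image is that whole
  kernel. This eliminates \<open>F2\<close>: a cocycle is a homomorphism on \<open>F1\<close> that
  factors through the image \<open>Z0\<close> of \<open>F1\<close>.\<close>

lemma cocycles_iff:
  "f \<in> cocycles \<longleftrightarrow> is_mod_hom A F1 N f \<and> f \<in> extensional (carrier F1) \<and>
     (\<forall>y \<in> carrier F1. free_eval A F0 y = \<zero>\<^bsub>F0\<^esub> \<longrightarrow> f y = \<zero>\<^bsub>N\<^esub>)"
proof -
  have "(\<forall>y \<in> carrier F2. f (free_eval A F1 y) = \<zero>\<^bsub>N\<^esub>) \<longleftrightarrow>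
      (\<forall>y \<in> carrier F1. free_eval A F0 y = \<zero>\<^bsub>F0\<^esub> \<longrightarrow> f y = \<zero>\<^bsub>N\<^esub>)"
    if "is_mod_hom A F1 N f"
  proof -
    interpret f: left_module_hom A F1 N f by unfold_locales fact
    show ?thesis
    proof
      assume *: "\<forall>y \<in> carrier F2. f (free_eval A F1 y) = \<zero>\<^bsub>N\<^esub>"
      show "\<forall>y \<in> carrier F1. free_eval A F0 y = \<zero>\<^bsub>F0\<^esub> \<longrightarrow> f y = \<zero>\<^bsub>N\<^esub>"
      proof (intro ballI impI)
        fix y assume "y \<in> carrier F1" "free_eval A F0 y = \<zero>\<^bsub>F0\<^esub>"
        then have y: "y \<in> Z1" by (simp add: Z1_iff)
        then have "free_unit A y \<in> carrier F2"
          unfolding F2_def by (rule free_unit_closed[OF M.R.ring_axioms])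
        moreover have "free_eval A F1 (free_unit A y) = y"
          unfolding free_eval_eq_lin_ext using y Z1_subset by (intro F1.lin_ext_free_unit) auto
        ultimately show "f y = \<zero>\<^bsub>N\<^esub>" using * by metis
      qed
    next
      assume *: "\<forall>y \<in> carrier F1. free_eval A F0 y = \<zero>\<^bsub>F0\<^esub> \<longrightarrow> f y = \<zero>\<^bsub>N\<^esub>"
      show "\<forall>y \<in> carrier F2. f (free_eval A F1 y) = \<zero>\<^bsub>N\<^esub>"
      proof
        fix y assume "y \<in> carrier F2"
        then show "f (free_eval A F1 y) = \<zero>\<^bsub>N\<^esub>"
          unfolding F2_def free_eval_eq_lin_ext[of A F1] using Z1_subset *
          by (subst f.hom_lin_ext[where S = Z1])
             (auto intro!: N.lin_ext_zero[where S = Z1] simp: Z1_iff)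
      qed
    qed
  qed
  then show ?thesis by (auto simp: cocycles_def mod_hom_iff)
qed

lemma cocycle_cong:
  assumes "f \<in> cocycles" "y \<in> carrier F1" "y' \<in> carrier F1" "free_eval A F0 y = free_eval A F0 y'"
  shows "f y = f y'"
proof -
  interpret f: left_module_hom A F1 N f using assms(1) by unfold_locales (simp add: cocycles_iff)
  have "free_eval A F0 (y \<ominus>\<^bsub>F1\<^esub> y') = \<zero>\<^bsub>F0\<^esub>"
    using assms by (simp add: d1.hom_diff F0.M.minus_eq F0.M.r_neg)
  then have "f (y \<ominus>\<^bsub>F1\<^esub> y') = \<zero>\<^bsub>N\<^esub>"
    using assms by (simp add: cocycles_iff)
  then show ?thesis
    using assms f.hom_diff[of y y'] f.hom_closed by (simp add: N.M.minus_eq_zero_iff)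
qed

text \<open>The map z \<mapsto> f (free_unit z) is the homomorphism Z0 -> N through which the
  cocycle factors. It is additive although \<open>free_unit\<close> is not, because both sides have
  the same image in \<open>F0\<close>.\<close>

lemma cocycle_unit_add:
  assumes "f \<in> cocycles" "z \<in> Z0" "z' \<in> Z0"
  shows "z \<oplus>\<^bsub>F0\<^esub> z' \<in> Z0"
    and "f (free_unit A (z \<oplus>\<^bsub>F0\<^esub> z')) = f (free_unit A z) \<oplus>\<^bsub>N\<^esub> f (free_unit A z')"
proof -
  interpret f: left_module_hom A F1 N f using assms(1) by unfold_locales (simp add: cocycles_iff)
  show *: "z \<oplus>\<^bsub>F0\<^esub> z' \<in> Z0" using assms(2,3) by (simp add: Z0_iff)
  note u = unit_in_F1[OF assms(2)] unit_in_F1[OF assms(3)]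
  have "f (free_unit A (z \<oplus>\<^bsub>F0\<^esub> z')) = f (free_unit A z \<oplus>\<^bsub>F1\<^esub> free_unit A z')"
    by (rule cocycle_cong[OF assms(1) unit_in_F1[OF *] F1.M.a_closed[OF u]])
       (simp only: d1.hom_add[OF u] eval1_unit[OF *] eval1_unit[OF assms(2)] eval1_unit[OF assms(3)])
  then show "f (free_unit A (z \<oplus>\<^bsub>F0\<^esub> z')) = f (free_unit A z) \<oplus>\<^bsub>N\<^esub> f (free_unit A z')"
    by (simp only: f.hom_add[OF u])
qed

lemma cocycle_unit_smult:
  assumes "f \<in> cocycles" "a \<in> carrier A" "z \<in> Z0"
  shows "a \<odot>\<^bsub>F0\<^esub> z \<in> Z0"
    and "f (free_unit A (a \<odot>\<^bsub>F0\<^esub> z)) = a \<odot>\<^bsub>N\<^esub> f (free_unit A z)"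
proof -
  interpret f: left_module_hom A F1 N f using assms(1) by unfold_locales (simp add: cocycles_iff)
  show *: "a \<odot>\<^bsub>F0\<^esub> z \<in> Z0"
    using assms(2,3) by (simp add: Z0_iff F0.smult_closed d0.hom_smult)
  note u = assms(2) unit_in_F1[OF assms(3)]
  have "f (free_unit A (a \<odot>\<^bsub>F0\<^esub> z)) = f (a \<odot>\<^bsub>F1\<^esub> free_unit A z)"
    by (rule cocycle_cong[OF assms(1) unit_in_F1[OF *] F1.smult_closed[OF u]])
       (simp only: d1.hom_smult[OF u] eval1_unit[OF *] eval1_unit[OF assms(3)])
  then show "f (free_unit A (a \<odot>\<^bsub>F0\<^esub> z)) = a \<odot>\<^bsub>N\<^esub> f (free_unit A z)"
    by (simp only: f.hom_smult[OF u])
qed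

lemma cocycle_eq_unit:
  assumes "f \<in> cocycles" "y \<in> carrier F1"
  shows "f y = f (free_unit A (free_eval A F0 y))"
  by (rule cocycle_cong[OF assms unit_in_F1[OF eval1_in_Z0[OF assms(2)]]])
     (simp only: eval1_unit[OF eval1_in_Z0[OF assms(2)]])

lemma coboundaryI:
  assumes "is_mod_hom A F0 N g" "f \<in> extensional (carrier F1)"
    and "\<And>y. y \<in> carrier F1 \<Longrightarrow> f y = g (free_eval A F0 y)"
  shows "f \<in> coboundaries"
proof -
  have "f = (\<lambda>y\<in>carrier F1. restrict g (carrier F0) (free_eval A F0 y))"
    using assms(2,3) by (auto intro!: extensionalityI[of f "carrier F1"])
  moreover have "restrict g (carrier F0) \<in> mod_hom A F0 N"
    using F0.left_module_axioms assms(1) by (rule restrict_mod_hom)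
  ultimately show ?thesis unfolding coboundaries_def by blast
qed

lemma coboundaryD:
  assumes "f \<in> coboundaries"
  shows "\<exists>g. is_mod_hom A F0 N g \<and> (\<forall>y\<in>carrier F1. f y = g (free_eval A F0 y))"
    and "f \<in> extensional (carrier F1)"
  using assms unfolding coboundaries_def by (auto simp: mod_hom_iff)

lemma coboundaries_subset: "coboundaries \<subseteq> cocycles"
proof
  fix f assume "f \<in> coboundaries"
  then obtain g where g: "is_mod_hom A F0 N g" and f: "f \<in> extensional (carrier F1)"
    "\<forall>y\<in>carrier F1. f y = g (free_eval A F0 y)"
    using coboundaryD by blast
  interpret g: left_module_hom A F0 N g by unfold_locales fact
  have "is_mod_hom A F1 N f"
    unfolding is_mod_hom_def using f
    by (auto simp: g.hom_closed d1.hom_smult g.hom_smult F1.smult_closed)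
  then show "f \<in> cocycles" using f by (simp add: cocycles_iff)
qed

section \<open>The quotient space\<close>

lemma scalar_smult_add:
  assumes "x \<in> carrier N"
  shows "(k + l) \<cdot> x = k \<cdot> x \<oplus>\<^bsub>N\<^esub> l \<cdot> x"
  using assms by (simp add: scalar_add N.smult_l_distr scalar_closed)

lemma scalar_smult_mult:
  assumes "x \<in> carrier N"
  shows "(k * l) \<cdot> x = k \<cdot> (l \<cdot> x)"
  using assms by (simp add: scalar_mult N.smult_assoc scalar_closed)

lemma scalar_smult_zero:
  assumes "x \<in> carrier N" shows "0 \<cdot> x = \<zero>\<^bsub>N\<^esub>"
proof -
  have "0 \<cdot> x \<oplus>\<^bsub>N\<^esub> 0 \<cdot> x = 0 \<cdot> x"
    using scalar_smult_add[OF assms, of 0 0] by simp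
  then show ?thesis
    by (metis N.M.add.l_cancel_one' N.smult_closed assms scalar_closed)
qed

lemma scalar_smult_commute:
  assumes "a \<in> carrier A" "x \<in> carrier N"
  shows "a \<odot>\<^bsub>N\<^esub> (k \<cdot> x) = k \<cdot> (a \<odot>\<^bsub>N\<^esub> x)"
  using assms by (metis N.smult_assoc scalar_closed scalar_commute)

lemma cocycle_space_simps:
  "carrier cocycle_space = cocycles"
  "\<zero>\<^bsub>cocycle_space\<^esub> = (\<lambda>x\<in>carrier F1. \<zero>\<^bsub>N\<^esub>)"
  "f \<oplus>\<^bsub>cocycle_space\<^esub> g = (\<lambda>x\<in>carrier F1. f x \<oplus>\<^bsub>N\<^esub> g x)"
  "k \<odot>\<^bsub>cocycle_space\<^esub> f = (\<lambda>x\<in>carrier F1. k \<cdot> f x)"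
  by (simp_all add: cocycle_space_def hom_space_def)

lemma is_mod_hom_zero:
  assumes "left_module A L" shows "is_mod_hom A L N (\<lambda>x. \<zero>\<^bsub>N\<^esub>)"
  by (simp add: is_mod_hom_def)

lemma is_mod_hom_add:
  assumes "left_module A L" "is_mod_hom A L N f" "is_mod_hom A L N g"
  shows "is_mod_hom A L N (\<lambda>x. f x \<oplus>\<^bsub>N\<^esub> g x)"
proof -
  interpret f: left_module_hom A L N f by (intro left_module_hom.intro assms N.left_module_axioms left_module_hom_axioms.intro)
  interpret g: left_module_hom A L N g by (intro left_module_hom.intro assms N.left_module_axioms left_module_hom_axioms.intro)
  have "f x \<oplus>\<^bsub>N\<^esub> f y \<oplus>\<^bsub>N\<^esub> (g x \<oplus>\<^bsub>N\<^esub> g y) = f x \<oplus>\<^bsub>N\<^esub> g x \<oplus>\<^bsub>N\<^esub> (f y \<oplus>\<^bsub>N\<^esub> g y)"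
    if "x \<in> carrier L" "y \<in> carrier L" for x y
    using f.hom_closed g.hom_closed that
    by (metis N.M.a_assoc N.M.a_lcomm N.M.a_closed)
  then show ?thesis unfolding is_mod_hom_def
    by (intro conjI ballI funcsetI)
       (simp_all add: f.hom_closed g.hom_closed f.hom_add g.hom_add f.hom_smult g.hom_smult N.smult_r_distr)
qed

lemma is_mod_hom_scale:
  assumes "left_module A L" "is_mod_hom A L N f"
  shows "is_mod_hom A L N (\<lambda>x. k \<cdot> f x)"
proof -
  interpret f: left_module_hom A L N f by (intro left_module_hom.intro assms N.left_module_axioms left_module_hom_axioms.intro)
  show ?thesis unfolding is_mod_hom_def
    by (intro conjI ballI funcsetI)
       (simp_all add: f.hom_closed f.hom_add f.hom_smult scalar_smult_commute N.smult_closed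
         scalar_closed N.smult_r_distr)
qed

lemma is_mod_hom_cong:
  assumes "left_module A L" "is_mod_hom A L N f" "\<And>x. x \<in> carrier L \<Longrightarrow> f x = g x"
  shows "is_mod_hom A L N g"
proof -
  interpret L: left_module A L by fact
  show ?thesis using assms(2,3) by (auto simp: is_mod_hom_def L.smult_closed Pi_def)
qed

lemma cocycles_closed:
  assumes "f \<in> cocycles"
  shows "g \<in> cocycles \<Longrightarrow> f \<oplus>\<^bsub>cocycle_space\<^esub> g \<in> cocycles"
    and "k \<odot>\<^bsub>cocycle_space\<^esub> f \<in> cocycles"
proof -
  note F1 = F1.left_module_axioms
  show "f \<oplus>\<^bsub>cocycle_space\<^esub> g \<in> cocycles" if "g \<in> cocycles"
    unfolding cocycles_iff cocycle_space_simps using assms that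
    by (auto simp: cocycles_iff intro: is_mod_hom_cong[OF F1 is_mod_hom_add[OF F1]])
  show "k \<odot>\<^bsub>cocycle_space\<^esub> f \<in> cocycles"
    unfolding cocycles_iff cocycle_space_simps using assms
    by (auto simp: cocycles_iff scalar_closed intro: is_mod_hom_cong[OF F1 is_mod_hom_scale[OF F1]])
qed

lemma coboundaries_closed:
  assumes "f \<in> coboundaries"
  shows "g \<in> coboundaries \<Longrightarrow> f \<oplus>\<^bsub>cocycle_space\<^esub> g \<in> coboundaries"
    and "k \<odot>\<^bsub>cocycle_space\<^esub> f \<in> coboundaries"
proof -
  from assms obtain f' where f': "is_mod_hom A F0 N f'"
    "\<forall>y\<in>carrier F1. f y = f' (free_eval A F0 y)"
    using coboundaryD(1) by blast
  note F0 = F0.left_module_axioms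
  show "k \<odot>\<^bsub>cocycle_space\<^esub> f \<in> coboundaries"
    by (rule coboundaryI[OF is_mod_hom_scale[OF F0 f'(1), of k]]) (auto simp: cocycle_space_simps f'(2))
  assume "g \<in> coboundaries"
  then obtain g' where g': "is_mod_hom A F0 N g'"
    "\<forall>y\<in>carrier F1. g y = g' (free_eval A F0 y)"
    using coboundaryD(1) by blast
  show "f \<oplus>\<^bsub>cocycle_space\<^esub> g \<in> coboundaries"
    by (rule coboundaryI[OF is_mod_hom_add[OF F0 f'(1) g'(1)]])
       (auto simp: cocycle_space_simps f'(2) g'(2))
qed

lemma zero_coboundary: "\<zero>\<^bsub>cocycle_space\<^esub> \<in> coboundaries"
  by (rule coboundaryI[OF is_mod_hom_zero[OF F0.left_module_axioms]]) (auto simp: cocycle_space_simps)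

lemma cocycle_value_closed: "f \<in> cocycles \<Longrightarrow> y \<in> carrier F1 \<Longrightarrow> f y \<in> carrier N"
  by (auto simp: cocycles_iff dest: is_mod_homD(1))

text \<open>Inverses come from the scalar -1, so closure under scalars also gives closure under
  negation, for cocycles and for coboundaries.\<close>

lemma scale_minus_one:
  assumes "f \<in> cocycles"
  shows "(-1) \<odot>\<^bsub>cocycle_space\<^esub> f \<oplus>\<^bsub>cocycle_space\<^esub> f = \<zero>\<^bsub>cocycle_space\<^esub>"
proof -
  have "(-1) \<cdot> x \<oplus>\<^bsub>N\<^esub> x = \<zero>\<^bsub>N\<^esub>" if "x \<in> carrier N" for x
    using scalar_smult_add[OF that, of "-1" 1] scalar_smult_zero[OF that] that
    by (simp add: scalar_one N.smult_one)
  then show ?thesis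
    unfolding cocycle_space_simps
    by (intro restrict_ext) (simp add: cocycle_value_closed[OF assms])
qed

sublocale V: abelian_group cocycle_space
proof (rule abelian_groupI; unfold cocycle_space_simps(1))
  fix f assume f: "f \<in> cocycles"
  have ext: "f \<in> extensional (carrier F1)" using f by (simp add: cocycles_iff)
  show "\<zero>\<^bsub>cocycle_space\<^esub> \<oplus>\<^bsub>cocycle_space\<^esub> f = f"
    by (rule extensionalityI[of _ "carrier F1"])
       (simp_all add: cocycle_space_simps ext cocycle_value_closed[OF f])
  show "\<exists>g\<in>cocycles. g \<oplus>\<^bsub>cocycle_space\<^esub> f = \<zero>\<^bsub>cocycle_space\<^esub>"
    using f scale_minus_one cocycles_closed(2) by blast
next
  fix f g assume f: "f \<in> cocycles" and g: "g \<in> cocycles"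
  show "f \<oplus>\<^bsub>cocycle_space\<^esub> g \<in> cocycles"
    using f g by (rule cocycles_closed(1))
  show "f \<oplus>\<^bsub>cocycle_space\<^esub> g = g \<oplus>\<^bsub>cocycle_space\<^esub> f"
    unfolding cocycle_space_simps
    by (rule restrict_ext) (simp add: cocycle_value_closed[OF f] cocycle_value_closed[OF g] N.M.a_comm)
  fix h assume h: "h \<in> cocycles"
  show "f \<oplus>\<^bsub>cocycle_space\<^esub> g \<oplus>\<^bsub>cocycle_space\<^esub> h =
      f \<oplus>\<^bsub>cocycle_space\<^esub> (g \<oplus>\<^bsub>cocycle_space\<^esub> h)"
    unfolding cocycle_space_simps
    by (rule restrict_ext) (simp add: cocycle_value_closed[OF f] cocycle_value_closed[OF g]
        cocycle_value_closed[OF h] N.M.a_assoc)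
qed (use coboundaries_subset zero_coboundary in blast)

sublocale B: abelian_subgroup coboundaries cocycle_space
proof (rule abelian_subgroupI3)
  show "additive_subgroup coboundaries cocycle_space"
  proof (rule additive_subgroup.intro, rule group.subgroupI)
    show "group (add_monoid cocycle_space)" by (rule V.a_group)
    show "coboundaries \<subseteq> carrier (add_monoid cocycle_space)"
      using coboundaries_subset by (simp add: cocycle_space_simps)
    show "coboundaries \<noteq> {}" using zero_coboundary by blast
    fix f assume f: "f \<in> coboundaries"
    then have "f \<in> carrier cocycle_space"
      using coboundaries_subset by (auto simp: cocycle_space_simps)
    moreover have "(-1) \<odot>\<^bsub>cocycle_space\<^esub> f \<in> coboundaries"
      using f by (rule coboundaries_closed(2))
    moreover from this have "(-1) \<odot>\<^bsub>cocycle_space\<^esub> f \<in> carrier cocycle_space"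
      using coboundaries_subset by (auto simp: cocycle_space_simps(1))
    ultimately have "\<ominus>\<^bsub>cocycle_space\<^esub> f = (-1) \<odot>\<^bsub>cocycle_space\<^esub> f"
      using V.minus_equality scale_minus_one by (metis cocycle_space_simps(1))
    with \<open>(-1) \<odot>\<^bsub>cocycle_space\<^esub> f \<in> coboundaries\<close>
    show "inv\<^bsub>add_monoid cocycle_space\<^esub> f \<in> coboundaries"
      by (simp add: a_inv_def)
    fix g assume "g \<in> coboundaries"
    with f show "f \<otimes>\<^bsub>add_monoid cocycle_space\<^esub> g \<in> coboundaries"
      using coboundaries_closed(1) by simp
  qed
qed (rule V.abelian_group_axioms)

lemma Ext1_simps:
  "carrier (Ext1 A M N) = a_rcosets\<^bsub>cocycle_space\<^esub> coboundaries"
  "\<zero>\<^bsub>Ext1 A M N\<^esub> = coboundaries"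
  "add (Ext1 A M N) = set_add cocycle_space"
  "k \<odot>\<^bsub>Ext1 A M N\<^esub> X = (\<Union>f\<in>X. coboundaries +>\<^bsub>cocycle_space\<^esub> (k \<odot>\<^bsub>cocycle_space\<^esub> f))"
  by (simp_all add: Ext1_eq quot_space_def)

lemma Ext1_carrier:
  "carrier (Ext1 A M N) = (\<lambda>f. coboundaries +>\<^bsub>cocycle_space\<^esub> f) ` cocycles"
  by (auto simp: Ext1_simps A_RCOSETS_def' cocycle_space_simps)

sublocale E: abelian_group "Ext1 A M N"
proof -
  interpret Q: comm_group "cocycle_space A_Mod coboundaries" by (rule B.a_factorgroup_is_comm_group)
  \<comment> \<open>Additively \<open>Ext1\<close> is the factor group of cocycles by coboundaries,
    whose laws are inherited.\<close>
  have *: "carrier (Ext1 A M N) = carrier (cocycle_space A_Mod coboundaries)"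
    "add (Ext1 A M N) = mult (cocycle_space A_Mod coboundaries)"
    "\<zero>\<^bsub>Ext1 A M N\<^esub> = \<one>\<^bsub>cocycle_space A_Mod coboundaries\<^esub>"
    by (simp_all add: A_FactGroup_def' Ext1_simps)
  show "abelian_group (Ext1 A M N)"
  proof (rule abelian_groupI; unfold *)
    fix x y z
    assume x: "x \<in> carrier (cocycle_space A_Mod coboundaries)"
      and y: "y \<in> carrier (cocycle_space A_Mod coboundaries)"
    show "x \<otimes>\<^bsub>cocycle_space A_Mod coboundaries\<^esub> y \<in> carrier (cocycle_space A_Mod coboundaries)"
      by (rule Q.m_closed[OF x y])
    show "x \<otimes>\<^bsub>cocycle_space A_Mod coboundaries\<^esub> y = y \<otimes>\<^bsub>cocycle_space A_Mod coboundaries\<^esub> x"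
      by (rule Q.m_comm[OF x y])
    assume z: "z \<in> carrier (cocycle_space A_Mod coboundaries)"
    show "x \<otimes>\<^bsub>cocycle_space A_Mod coboundaries\<^esub> y \<otimes>\<^bsub>cocycle_space A_Mod coboundaries\<^esub> z =
        x \<otimes>\<^bsub>cocycle_space A_Mod coboundaries\<^esub> (y \<otimes>\<^bsub>cocycle_space A_Mod coboundaries\<^esub> z)"
      by (rule Q.m_assoc[OF x y z])
  qed (rule Q.one_closed Q.l_one Q.l_inv_ex | assumption)+
qed

lemma mem_coset_iff:
  "g \<in> coboundaries +>\<^bsub>cocycle_space\<^esub> f \<longleftrightarrow> (\<exists>h\<in>coboundaries. g = h \<oplus>\<^bsub>cocycle_space\<^esub> f)"
  unfolding a_r_coset_def' by blast

text \<open>Scalar multiplication on the quotient is a union over all representatives. All members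
  of this union are the same coset, as coboundaries are closed under scalars.\<close>

lemma coset_smult:
  assumes "f \<in> cocycles"
  shows "k \<odot>\<^bsub>Ext1 A M N\<^esub> (coboundaries +>\<^bsub>cocycle_space\<^esub> f) =
    coboundaries +>\<^bsub>cocycle_space\<^esub> (k \<odot>\<^bsub>cocycle_space\<^esub> f)"
proof -
  have "coboundaries +>\<^bsub>cocycle_space\<^esub> (k \<odot>\<^bsub>cocycle_space\<^esub> g) =
      coboundaries +>\<^bsub>cocycle_space\<^esub> (k \<odot>\<^bsub>cocycle_space\<^esub> f)"
    if g: "g \<in> coboundaries +>\<^bsub>cocycle_space\<^esub> f" for g
  proof -
    obtain h where h: "h \<in> coboundaries" "g = h \<oplus>\<^bsub>cocycle_space\<^esub> f"
      using g unfolding mem_coset_iff by blast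
    have "k \<odot>\<^bsub>cocycle_space\<^esub> g =
        k \<odot>\<^bsub>cocycle_space\<^esub> h \<oplus>\<^bsub>cocycle_space\<^esub> k \<odot>\<^bsub>cocycle_space\<^esub> f"
      unfolding h(2) cocycle_space_simps
      by (rule restrict_ext) (simp add: N.smult_r_distr scalar_closed cocycle_value_closed[OF assms]
          cocycle_value_closed[OF subsetD[OF coboundaries_subset h(1)]])
    then have *: "k \<odot>\<^bsub>cocycle_space\<^esub> g \<in> coboundaries +>\<^bsub>cocycle_space\<^esub> (k \<odot>\<^bsub>cocycle_space\<^esub> f)"
      using coboundaries_closed(2)[OF h(1)] unfolding mem_coset_iff by blast
    show ?thesis
      by (rule B.a_repr_independence'[OF *, symmetric])
         (simp only: cocycle_space_simps(1) cocycles_closed(2)[OF assms])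
  qed
  moreover have "f \<in> coboundaries +>\<^bsub>cocycle_space\<^esub> f"
    by (rule B.a_rcos_self) (simp only: cocycle_space_simps assms)
  ultimately show ?thesis unfolding Ext1_simps by (intro UN_constant_eq ballI)
qed

lemma coset_add:
  assumes "f \<in> cocycles" "g \<in> cocycles"
  shows "(coboundaries +>\<^bsub>cocycle_space\<^esub> f) \<oplus>\<^bsub>Ext1 A M N\<^esub> (coboundaries +>\<^bsub>cocycle_space\<^esub> g) =
    coboundaries +>\<^bsub>cocycle_space\<^esub> (f \<oplus>\<^bsub>cocycle_space\<^esub> g)"
  using assms B.a_rcos_sum by (simp add: Ext1_simps cocycle_space_simps(1))

lemma coset_eq_coboundaries_iff:
  assumes "f \<in> cocycles"
  shows "coboundaries +>\<^bsub>cocycle_space\<^esub> f = coboundaries \<longleftrightarrow> f \<in> coboundaries"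
proof
  show "f \<in> coboundaries" if "coboundaries +>\<^bsub>cocycle_space\<^esub> f = coboundaries"
    using that B.a_rcos_self[of f] assms by (simp add: cocycle_space_simps)
  show "coboundaries +>\<^bsub>cocycle_space\<^esub> f = coboundaries" if "f \<in> coboundaries"
    using that by (simp add: B.a_rcos_const)
qed

section \<open>Vanishing and finite generation of the quotient\<close>

lemma Ext1_trivial_iff: "carrier (Ext1 A M N) = {\<zero>\<^bsub>Ext1 A M N\<^esub>} \<longleftrightarrow> cocycles \<subseteq> coboundaries"
proof -
  have "carrier (Ext1 A M N) = {\<zero>\<^bsub>Ext1 A M N\<^esub>} \<longleftrightarrow> carrier (Ext1 A M N) \<subseteq> {\<zero>\<^bsub>Ext1 A M N\<^esub>}"
    using E.zero_closed by blast
  also have "\<dots> \<longleftrightarrow> cocycles \<subseteq> coboundaries"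
    unfolding Ext1_carrier Ext1_simps(2) using coset_eq_coboundaries_iff by blast
  finally show ?thesis .
qed

text \<open>By contraposition, infinite dimension already implies non-vanishing, so a single
  argument settles both claims for infinitely many indices.\<close>

lemma fin_dim_if_trivial:
  assumes "carrier (Ext1 A M N) = {\<zero>\<^bsub>Ext1 A M N\<^esub>}" shows "fin_dim (Ext1 A M N)"
  unfolding fin_dim_def using assms by (intro exI[of _ "{}"]) simp

lemma finsum_cocycles_apply:
  assumes "finite I" "f \<in> I \<rightarrow> cocycles" "y \<in> carrier F1"
  shows "(\<Oplus>\<^bsub>cocycle_space\<^esub>i\<in>I. f i) y = (\<Oplus>\<^bsub>N\<^esub>i\<in>I. f i y)"
  using assms(1,2)
proof (induction I)
  case empty
  then show ?case using assms(3) by (simp add: cocycle_space_simps)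
next
  case (insert i I)
  then have "f \<in> I \<rightarrow> carrier cocycle_space" "f i \<in> carrier cocycle_space"
    "(\<lambda>i. f i y) \<in> I \<rightarrow> carrier N" "f i y \<in> carrier N"
    using cocycle_value_closed[OF _ assms(3)] by (auto simp: cocycle_space_simps(1))
  with insert show ?case
    using assms(3) by (simp add: cocycle_space_simps(3) Pi_def)
qed

lemma finsum_cosets:
  assumes "finite I" "f \<in> I \<rightarrow> cocycles"
  shows "(\<Oplus>\<^bsub>Ext1 A M N\<^esub>i\<in>I. coboundaries +>\<^bsub>cocycle_space\<^esub> f i) =
    coboundaries +>\<^bsub>cocycle_space\<^esub> (\<Oplus>\<^bsub>cocycle_space\<^esub>i\<in>I. f i)"
  using assms
proof (induction I)
  case empty
  have "coboundaries +>\<^bsub>cocycle_space\<^esub> \<zero>\<^bsub>cocycle_space\<^esub> = coboundaries"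
    using zero_coboundary coboundaries_subset by (subst coset_eq_coboundaries_iff) auto
  then show ?case by (simp add: Ext1_simps(2))
next
  case (insert i I)
  then have *: "f \<in> I \<rightarrow> carrier cocycle_space" "f i \<in> carrier cocycle_space"
    by (auto simp: cocycle_space_simps(1))
  have "(\<Oplus>\<^bsub>cocycle_space\<^esub>i\<in>I. f i) \<in> cocycles"
    using V.finsum_closed[OF *(1)] by (simp add: cocycle_space_simps(1))
  moreover have "(\<lambda>i. coboundaries +>\<^bsub>cocycle_space\<^esub> f i) \<in> I \<rightarrow> carrier (Ext1 A M N)"
    "coboundaries +>\<^bsub>cocycle_space\<^esub> f i \<in> carrier (Ext1 A M N)"
    using insert.prems by (auto simp: Ext1_carrier)
  ultimately show ?case
    using insert * by (simp add: coset_add cocycle_space_simps(1) Pi_def)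
qed

text \<open>A finite spanning set of cosets is turned into finitely many cocycles that span modulo
  coboundaries, in a pointwise form that can be evaluated. The spanning cosets themselves serve as
  the index set.\<close>

lemma fin_dim_generators:
  assumes "fin_dim (Ext1 A M N)"
  shows "\<exists>(I :: ((('m \<Rightarrow> 'r) \<Rightarrow> 'r) \<Rightarrow> 'n) set set) b. finite I \<and> b \<in> I \<rightarrow> cocycles \<and>
    (\<forall>f\<in>cocycles. \<exists>c. \<exists>h\<in>coboundaries. \<forall>y\<in>carrier F1.
      f y = h y \<oplus>\<^bsub>N\<^esub> (\<Oplus>\<^bsub>N\<^esub>i\<in>I. c i \<cdot> b i y))"
proof -
  from assms[unfolded fin_dim_def] obtain I where I: "finite I" "I \<subseteq> carrier (Ext1 A M N)"
    "\<forall>v \<in> carrier (Ext1 A M N). \<exists>c. v = (\<Oplus>\<^bsub>Ext1 A M N\<^esub>i\<in>I. c i \<odot>\<^bsub>Ext1 A M N\<^esub> i)"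
    by (elim exE conjE)
  have "\<forall>i\<in>I. \<exists>f\<in>cocycles. i = coboundaries +>\<^bsub>cocycle_space\<^esub> f"
    using I(2) by (auto simp: Ext1_carrier)
  then have "\<forall>i\<in>I. \<exists>f. f \<in> cocycles \<and> i = coboundaries +>\<^bsub>cocycle_space\<^esub> f"
    by blast
  from bchoice[OF this]
  obtain b where b: "\<forall>i\<in>I. b i \<in> cocycles \<and> i = coboundaries +>\<^bsub>cocycle_space\<^esub> b i"
    by blast
  show ?thesis
  proof (intro exI[of _ I] exI[of _ b] conjI ballI)
    show "finite I" by (rule I(1))
    show "b \<in> I \<rightarrow> cocycles" using b by blast
    fix f assume f: "f \<in> cocycles"
    then obtain c where c: "coboundaries +>\<^bsub>cocycle_space\<^esub> f =
        (\<Oplus>\<^bsub>Ext1 A M N\<^esub>i\<in>I. c i \<odot>\<^bsub>Ext1 A M N\<^esub> i)"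
      using I(3) unfolding Ext1_carrier by blast
    define g where "g = (\<lambda>i. c i \<odot>\<^bsub>cocycle_space\<^esub> b i)"
    have g: "g \<in> I \<rightarrow> cocycles"
      unfolding g_def using b by (intro funcsetI cocycles_closed(2)) blast
    have "(\<Oplus>\<^bsub>Ext1 A M N\<^esub>i\<in>I. c i \<odot>\<^bsub>Ext1 A M N\<^esub> i) =
        (\<Oplus>\<^bsub>Ext1 A M N\<^esub>i\<in>I. coboundaries +>\<^bsub>cocycle_space\<^esub> g i)"
    proof (rule E.finsum_cong')
      show "(\<lambda>i. coboundaries +>\<^bsub>cocycle_space\<^esub> g i) \<in> I \<rightarrow> carrier (Ext1 A M N)"
        unfolding Ext1_carrier using g by blast
      show "c i \<odot>\<^bsub>Ext1 A M N\<^esub> i = coboundaries +>\<^bsub>cocycle_space\<^esub> g i" if "i \<in> I" for i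
      proof -
        have "b i \<in> cocycles" "i = coboundaries +>\<^bsub>cocycle_space\<^esub> b i" using b that by blast+
        then show ?thesis
          using coset_smult[of "b i" "c i"] by (simp only: g_def)
      qed
    qed simp
    also have "\<dots> = coboundaries +>\<^bsub>cocycle_space\<^esub> (\<Oplus>\<^bsub>cocycle_space\<^esub>i\<in>I. g i)"
      using I(1) g by (rule finsum_cosets)
    finally have "f \<in> coboundaries +>\<^bsub>cocycle_space\<^esub> (\<Oplus>\<^bsub>cocycle_space\<^esub>i\<in>I. g i)"
      using c f B.a_rcos_self[of f] by (simp add: cocycle_space_simps(1))
    then obtain h where h: "h \<in> coboundaries"
      "f = h \<oplus>\<^bsub>cocycle_space\<^esub> (\<Oplus>\<^bsub>cocycle_space\<^esub>i\<in>I. g i)"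
      by (auto simp: mem_coset_iff)
    have "f y = h y \<oplus>\<^bsub>N\<^esub> (\<Oplus>\<^bsub>N\<^esub>i\<in>I. c i \<cdot> b i y)"
      if "y \<in> carrier F1" for y
    proof -
      have "f y = h y \<oplus>\<^bsub>N\<^esub> (\<Oplus>\<^bsub>cocycle_space\<^esub>i\<in>I. g i) y"
        by (subst h(2)) (simp only: cocycle_space_simps(3) restrict_apply that if_True)
      also have "(\<Oplus>\<^bsub>cocycle_space\<^esub>i\<in>I. g i) y = (\<Oplus>\<^bsub>N\<^esub>i\<in>I. g i y)"
        by (rule finsum_cocycles_apply[OF I(1) g that])
      also have "(\<lambda>i. g i y) = (\<lambda>i. c i \<cdot> b i y)"
        by (simp only: g_def cocycle_space_simps(4) restrict_apply that if_True)
      finally show ?thesis .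
    qed
    then show "\<exists>c. \<exists>h\<in>coboundaries. \<forall>y\<in>carrier F1.
        f y = h y \<oplus>\<^bsub>N\<^esub> (\<Oplus>\<^bsub>N\<^esub>i\<in>I. c i \<cdot> b i y)"
      by (intro exI[of _ c] bexI[OF _ h(1)] ballI)
  qed
qed

end

section \<open>Linear algebra\<close>

text \<open>More vectors than coordinates are dependent: Gaussian elimination, one coordinate at a
  time.\<close>

lemma exists_linear_dependence:
  fixes c :: "'j \<Rightarrow> 'i \<Rightarrow> 'k::field"
  assumes "finite I" "finite J" "card I < card J"
  shows "\<exists>a. (\<exists>j\<in>J. a j \<noteq> 0) \<and> (\<forall>i\<in>I. (\<Sum>j\<in>J. a j * c j i) = 0)"
  using assms
proof (induction I arbitrary: J c rule: finite_induct)
  case empty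
  then have "J \<noteq> {}" by auto
  then show ?case by (intro exI[of _ "\<lambda>_. 1"]) auto
next
  case (insert i I)
  show ?case
  proof (cases "\<exists>j\<in>J. c j i \<noteq> 0")
    case False
    have "card I < card J" using insert by simp
    then obtain a where "\<exists>j\<in>J. a j \<noteq> 0" "\<forall>i\<in>I. (\<Sum>j\<in>J. a j * c j i) = 0"
      using insert.IH[OF \<open>finite J\<close>, of c] by blast
    then show ?thesis using False by (intro exI[of _ a]) simp
  next
    case True
    then obtain l where l: "l \<in> J" "c l i \<noteq> 0" by blast
    define J' where "J' = J - {l}"
    have J': "finite J'" "card I < card J'" "J = insert l J'" "l \<notin> J'"
      using insert l by (auto simp: J'_def)
    \<comment> \<open>Clear the coordinate \<open>i\<close> of the remaining vectors with the pivot
      vector \<open>l\<close>.\<close>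
    define c' where "c' j k = c j k - c j i / c l i * c l k" for j k
    obtain a where a: "\<exists>j\<in>J'. a j \<noteq> 0" "\<And>k. k \<in> I \<Longrightarrow> (\<Sum>j\<in>J'. a j * c' j k) = 0"
      using insert.IH[OF J'(1,2), of c'] by blast
    \<comment> \<open>The coefficient at \<open>l\<close> collects the multiples of the pivot
      subtracted in \<open>c'\<close>, so the combination of the old vectors equals that of the new
      ones.\<close>
    define b where "b = a(l := - (\<Sum>j\<in>J'. a j * c j i / c l i))"
    have b: "(\<Sum>j\<in>J. b j * c j k) = (\<Sum>j\<in>J'. a j * c' j k)" for k
    proof -
      have "(\<Sum>j\<in>J'. b j * c j k) = (\<Sum>j\<in>J'. a j * c j k)"
        using J'(4) by (intro sum.cong) (auto simp: b_def)
      then have "(\<Sum>j\<in>J. b j * c j k) =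
          (\<Sum>j\<in>J'. a j * c j k) - (\<Sum>j\<in>J'. a j * c j i / c l i) * c l k"
        using J' by (simp add: b_def)
      also have "\<dots> = (\<Sum>j\<in>J'. a j * c' j k)"
        by (simp add: c'_def sum_distrib_right sum_distrib_left right_diff_distrib sum_subtractf algebra_simps)
      finally show ?thesis .
    qed
    have "(\<Sum>j\<in>J'. a j * c' j i) = 0"
      using l by (simp add: c'_def)
    then have "\<forall>k\<in>insert i I. (\<Sum>j\<in>J. b j * c j k) = 0"
      using a(2) b by auto
    moreover have "\<exists>j\<in>J. b j \<noteq> 0"
      using a(1) J' by (auto simp: b_def)
    ultimately show ?thesis by blast
  qed
qed

text \<open>Element number (j, m) of \<open>D\<close>, with the pair encoded as a natural number, is
  put into class \<open>j\<close>.\<close>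

lemma infinite_nat_partition:
  fixes D :: "nat set"
  assumes "infinite D"
  shows "\<exists>g :: nat \<Rightarrow> nat. \<forall>j. infinite {n \<in> D. g n = j}"
proof -
  let ?e = "enumerate D"
  have inj: "inj ?e" using assms by (simp add: strict_mono_enumerate strict_mono_imp_inj_on)
  define g where "g n = fst (prod_decode (the_inv ?e n))" for n
  have "infinite {n \<in> D. g n = j}" for j
  proof -
    have "inj (\<lambda>m. ?e (prod_encode (j, m)))"
      by (auto intro!: injI dest: injD[OF inj])
    then have "infinite (range (\<lambda>m. ?e (prod_encode (j, m))))"
      by (rule range_inj_infinite)
    moreover have "range (\<lambda>m. ?e (prod_encode (j, m))) \<subseteq> {n \<in> D. g n = j}"
      using assms inj by (auto simp: g_def enumerate_in_set the_inv_f_f)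
    ultimately show ?thesis using finite_subset by blast
  qed
  then show ?thesis by blast
qed

section \<open>Extensions of a cyclic module\<close>

definition reg_mod :: "('r, 'x) ring_scheme \<Rightarrow> ('r, 'r) module" where
  "reg_mod R = \<lparr>carrier = carrier R, mult = mult R, one = \<one>\<^bsub>R\<^esub>, zero = \<zero>\<^bsub>R\<^esub>, add = add R,
    smult = mult R\<rparr>"

lemma reg_mod_simps [simp]:
  "carrier (reg_mod R) = carrier R" "\<zero>\<^bsub>reg_mod R\<^esub> = \<zero>\<^bsub>R\<^esub>" "add (reg_mod R) = add R"
  "smult (reg_mod R) = mult R"
  by (simp_all add: reg_mod_def)

lemma left_module_reg_mod:
  assumes "ring R" shows "left_module R (reg_mod R)"
proof -
  interpret R: ring R by fact
  have "abelian_group (reg_mod R)"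
    by (rule abelian_groupI) (auto simp: R.a_assoc intro: R.a_comm R.add.l_inv_ex)
  then show ?thesis
    by (intro left_module.intro left_module_axioms.intro assms)
       (auto simp: R.l_distr R.r_distr R.m_assoc)
qed

lemma (in left_module) lin_ext_cong:
  assumes "x \<in> carrier (free_mod R S)" "w \<in> S \<rightarrow> carrier M" "\<And>s. s \<in> S \<Longrightarrow> v s = w s"
  shows "lin_ext R M v x = lin_ext R M w x"
proof -
  have "x s \<in> carrier R \<and> w s \<in> carrier M \<and> v s = w s" if "x s \<noteq> \<zero>" for s
    using assms that by (cases "s \<in> S") (auto simp: Pi_def)
  then show ?thesis
    unfolding lin_ext_def by (intro M.finsum_cong') (auto intro: smult_closed)
qed

text \<open>For M = A p with annihilator I of p, the short exact sequence 0 -> I -> A -> M -> 0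
  describes Ext^1(M, N) as Hom(I, N) modulo the maps x \<mapsto> x t. This locale establishes what
  is needed of this description for the canonical resolution; \<open>value_at f\<close> is the
  homomorphism on I that belongs to the cocycle \<open>f\<close>.\<close>

locale cyclic_ext = algebra_modules A M N
  for A :: "('k::field, 'r) module" (structure) and M :: "('r, 'm) module" and N :: "('r, 'n) module" +
  fixes p :: 'm
  assumes gen_closed: "p \<in> carrier M"
    and generates: "m \<in> carrier M \<Longrightarrow> \<exists>x\<in>carrier A. x \<odot>\<^bsub>M\<^esub> p = m"
begin

definition "ann = {x \<in> carrier A. x \<odot>\<^bsub>M\<^esub> p = \<zero>\<^bsub>M\<^esub>}"

text \<open>The embedding of A into \<open>F0\<close> along the basis vector at \<open>p\<close>. It
  carries \<open>ann\<close> into the module \<open>Z0\<close> of relations of M.\<close>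

definition relation :: "'r \<Rightarrow> 'm \<Rightarrow> 'r" where
  "relation x = x \<odot>\<^bsub>F0\<^esub> free_unit A p"

definition value_at :: "((('m \<Rightarrow> 'r) \<Rightarrow> 'r) \<Rightarrow> 'n) \<Rightarrow> 'r \<Rightarrow> 'n" where
  "value_at f x = f (free_unit A (relation x))"

lemma ann_closed: "x \<in> ann \<Longrightarrow> x \<in> carrier A"
  by (simp add: ann_def)

lemma ann_add: "x \<in> ann \<Longrightarrow> y \<in> ann \<Longrightarrow> x \<oplus> y \<in> ann"
  by (simp add: ann_def M.smult_l_distr gen_closed)

lemma ann_mult: "a \<in> carrier A \<Longrightarrow> x \<in> ann \<Longrightarrow> a \<otimes> x \<in> ann"
  by (simp add: ann_def M.smult_assoc gen_closed)

lemma relation_closed: "x \<in> carrier A \<Longrightarrow> relation x \<in> carrier F0"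
  unfolding relation_def by (intro F0.smult_closed unit_in_F0 gen_closed)

lemma eval_relation: "x \<in> carrier A \<Longrightarrow> free_eval A M (relation x) = x \<odot>\<^bsub>M\<^esub> p"
  unfolding relation_def
  by (simp only: d0.hom_smult unit_in_F0 gen_closed eval0_unit)

lemma relation_in_Z0: "x \<in> ann \<Longrightarrow> relation x \<in> Z0"
  unfolding Z0_iff using relation_closed eval_relation by (simp add: ann_def)

lemma relation_add:
  "x \<in> carrier A \<Longrightarrow> y \<in> carrier A \<Longrightarrow> relation (x \<oplus> y) = relation x \<oplus>\<^bsub>F0\<^esub> relation y"
  unfolding relation_def by (intro F0.smult_l_distr unit_in_F0 gen_closed)

lemma relation_mult:
  "a \<in> carrier A \<Longrightarrow> x \<in> carrier A \<Longrightarrow> relation (a \<otimes> x) = a \<odot>\<^bsub>F0\<^esub> relation x"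
  unfolding relation_def by (intro F0.smult_assoc unit_in_F0 gen_closed)

lemma value_at_closed: "f \<in> cocycles \<Longrightarrow> x \<in> ann \<Longrightarrow> value_at f x \<in> carrier N"
  unfolding value_at_def by (rule cocycle_value_closed[OF _ unit_in_F1[OF relation_in_Z0]])

lemma value_at_add:
  assumes "f \<in> cocycles" "x \<in> ann" "y \<in> ann"
  shows "value_at f (x \<oplus> y) = value_at f x \<oplus>\<^bsub>N\<^esub> value_at f y"
  unfolding value_at_def relation_add[OF ann_closed ann_closed, OF assms(2,3)]
  by (rule cocycle_unit_add(2)[OF assms(1) relation_in_Z0[OF assms(2)] relation_in_Z0[OF assms(3)]])

lemma value_at_mult:
  assumes "f \<in> cocycles" "a \<in> carrier A" "x \<in> ann"
  shows "value_at f (a \<otimes> x) = a \<odot>\<^bsub>N\<^esub> value_at f x"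
  unfolding value_at_def relation_mult[OF assms(2) ann_closed[OF assms(3)]]
  by (rule cocycle_unit_smult(2)[OF assms(1,2) relation_in_Z0[OF assms(3)]])

lemma coboundary_value_at:
  assumes "f \<in> coboundaries"
  shows "\<exists>t\<in>carrier N. \<forall>x\<in>ann. value_at f x = x \<odot>\<^bsub>N\<^esub> t"
proof -
  obtain g where g: "is_mod_hom A F0 N g" and f: "\<forall>y\<in>carrier F1. f y = g (free_eval A F0 y)"
    using coboundaryD(1)[OF assms] by (elim exE conjE)
  show ?thesis
  proof (intro bexI[of _ "g (free_unit A p)"] ballI)
    show "g (free_unit A p) \<in> carrier N"
      using g unit_in_F0[OF gen_closed] by (rule is_mod_homD(1))
    fix x assume x: "x \<in> ann"
    have "value_at f x = g (relation x)"
      unfolding value_at_def bspec[OF f unit_in_F1[OF relation_in_Z0[OF x]]]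
        eval1_unit[OF relation_in_Z0[OF x]] by (rule refl)
    also have "\<dots> = x \<odot>\<^bsub>N\<^esub> g (free_unit A p)"
      unfolding relation_def using g ann_closed[OF x] unit_in_F0[OF gen_closed]
      by (rule is_mod_homD(3))
    finally show "value_at f x = x \<odot>\<^bsub>N\<^esub> g (free_unit A p)" .
  qed
qed

lemma left_module_A: "left_module A (reg_mod A)"
  by (rule left_module_reg_mod) (rule M.R.ring_axioms)

text \<open>\<open>F0\<close> is free, so the evaluation F0 -> M lifts along the surjection A -> M,
  x \<mapsto> x p.\<close>

lemma exists_lift:
  "\<exists>Y. is_mod_hom A F0 (reg_mod A) Y \<and>
    (\<forall>z\<in>carrier F0. Y z \<odot>\<^bsub>M\<^esub> p = free_eval A M z) \<and> Y (free_unit A p) = \<one>"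
proof -
  interpret reg: left_module A "reg_mod A" by (rule left_module_A)
  have "\<forall>m\<in>carrier M. \<exists>x. x \<in> carrier A \<and> x \<odot>\<^bsub>M\<^esub> p = m"
    using generates by blast
  from bchoice[OF this] obtain w' where
    w': "\<forall>m\<in>carrier M. w' m \<in> carrier A \<and> w' m \<odot>\<^bsub>M\<^esub> p = m" by (elim exE)
  \<comment> \<open>With the value \<one> at \<open>p\<close> the lift is a left inverse of
    \<open>relation\<close>.\<close>
  define w where "w = w'(p := \<one>)"
  have w: "w \<in> carrier M \<rightarrow> carrier (reg_mod A)" "\<And>m. m \<in> carrier M \<Longrightarrow> w m \<odot>\<^bsub>M\<^esub> p = m"
    "w p = \<one>"
    using w' by (auto simp: w_def M.smult_one)
  have hom: "is_mod_hom A (reg_mod A) M (\<lambda>x. x \<odot>\<^bsub>M\<^esub> p)"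
    by (simp add: is_mod_hom_def M.smult_closed M.smult_l_distr M.smult_assoc gen_closed)
  interpret h: left_module_hom A "reg_mod A" M "\<lambda>x. x \<odot>\<^bsub>M\<^esub> p"
    by unfold_locales (rule hom)
  show ?thesis
  proof (intro exI[of _ "lin_ext A (reg_mod A) w"] conjI ballI)
    show "is_mod_hom A F0 (reg_mod A) (lin_ext A (reg_mod A) w)"
      unfolding is_mod_hom_def F0_def
      by (intro conjI ballI funcsetI reg.lin_ext_closed[OF _ w(1)] reg.lin_ext_add[OF _ _ w(1)]
          reg.lin_ext_smult[OF _ _ w(1)])
    show "lin_ext A (reg_mod A) w (free_unit A p) = \<one>"
      using reg.lin_ext_free_unit[OF gen_closed w(1)] w(3) by simp
    fix z assume z: "z \<in> carrier F0"
    then have "lin_ext A (reg_mod A) w z \<odot>\<^bsub>M\<^esub> p = lin_ext A M (\<lambda>s. w s \<odot>\<^bsub>M\<^esub> p) z"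
      unfolding F0_def using w(1) by (rule h.hom_lin_ext)
    also have "\<dots> = free_eval A M z"
      using z unfolding free_eval_eq_lin_ext F0_def
      by (rule M.lin_ext_cong) (use w(2) in auto)
    finally show "lin_ext A (reg_mod A) w z \<odot>\<^bsub>M\<^esub> p = free_eval A M z" .
  qed
qed

lemma coboundary_if_value_at:
  assumes f: "f \<in> cocycles" and t: "t \<in> carrier N" "\<And>x. x \<in> ann \<Longrightarrow> value_at f x = x \<odot>\<^bsub>N\<^esub> t"
  shows "f \<in> coboundaries"
proof -
  obtain Y where Y: "is_mod_hom A F0 (reg_mod A) Y"
    "\<forall>z\<in>carrier F0. Y z \<odot>\<^bsub>M\<^esub> p = free_eval A M z"
    using exists_lift by (elim exE conjE)
  have Y_closed: "Y z \<in> carrier A" if "z \<in> carrier F0" for z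
    using is_mod_homD(1)[OF Y(1) that] by simp
  have Y_add: "Y (z \<oplus>\<^bsub>F0\<^esub> z') = Y z \<oplus> Y z'" if "z \<in> carrier F0" "z' \<in> carrier F0" for z z'
    using is_mod_homD(2)[OF Y(1) that] by simp
  have Y_smult: "Y (a \<odot>\<^bsub>F0\<^esub> z) = a \<otimes> Y z" if "a \<in> carrier A" "z \<in> carrier F0" for a z
    using is_mod_homD(3)[OF Y(1) that] by simp
  \<comment> \<open>The lift splits every z in \<open>F0\<close> as \<open>relation (Y z)\<close>
    plus a remainder \<open>r z\<close> in \<open>Z0\<close>, where the cocycle is defined.\<close>
  define r where "r z = z \<ominus>\<^bsub>F0\<^esub> relation (Y z)" for z
  define fb where "fb z = f (free_unit A z)" for z
  have fb_closed: "fb z \<in> carrier N" if "z \<in> Z0" for z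
    unfolding fb_def using f unit_in_F1[OF that] by (rule cocycle_value_closed)
  have r_Z0: "r z \<in> Z0" if z: "z \<in> carrier F0" for z
  proof -
    note rel = relation_closed[OF Y_closed[OF z]]
    have "free_eval A M (r z) = free_eval A M z \<ominus>\<^bsub>M\<^esub> free_eval A M (relation (Y z))"
      unfolding r_def by (rule d0.hom_diff[OF z rel])
    also have "\<dots> = \<zero>\<^bsub>M\<^esub>"
      using d0.hom_closed[OF z] eval_relation[OF Y_closed[OF z]] bspec[OF Y(2) z]
      by (simp add: M.M.minus_eq_zero_iff)
    finally show ?thesis
      unfolding Z0_iff r_def using F0.M.minus_closed[OF z rel] by blast
  qed
  have r_add: "r (z \<oplus>\<^bsub>F0\<^esub> z') = r z \<oplus>\<^bsub>F0\<^esub> r z'" if z: "z \<in> carrier F0" "z' \<in> carrier F0" for z z'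
  proof -
    have "relation (Y (z \<oplus>\<^bsub>F0\<^esub> z')) = relation (Y z) \<oplus>\<^bsub>F0\<^esub> relation (Y z')"
      unfolding Y_add[OF z] by (intro relation_add Y_closed z)
    then show ?thesis
      unfolding r_def
      by (simp only: F0.M.add_minus_add[OF z relation_closed[OF Y_closed[OF z(1)]]
            relation_closed[OF Y_closed[OF z(2)]]])
  qed
  have r_smult: "r (a \<odot>\<^bsub>F0\<^esub> z) = a \<odot>\<^bsub>F0\<^esub> r z" if a: "a \<in> carrier A" and z: "z \<in> carrier F0" for a z
    unfolding r_def Y_smult[OF a z] relation_mult[OF a Y_closed[OF z]]
    by (rule F0.smult_diff_right[symmetric, OF a z relation_closed[OF Y_closed[OF z]]])
  \<comment> \<open>Extends the homomorphism Z0 -> N to all of \<open>F0\<close>: on the first part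
    of the splitting by multiplication with \<open>t\<close>, on the remainder by the cocycle
    itself. Both prescriptions agree on relations coming from \<open>ann\<close>.\<close>
  define g where "g z = Y z \<odot>\<^bsub>N\<^esub> t \<oplus>\<^bsub>N\<^esub> fb (r z)" for z
  have "is_mod_hom A F0 N g"
    unfolding is_mod_hom_def
  proof (intro conjI ballI funcsetI)
    fix z assume z: "z \<in> carrier F0"
    note c = N.smult_closed[OF Y_closed[OF z] t(1)] fb_closed[OF r_Z0[OF z]]
    show "g z \<in> carrier N"
      unfolding g_def using c by simp
    show "g (z \<oplus>\<^bsub>F0\<^esub> z') = g z \<oplus>\<^bsub>N\<^esub> g z'" if z': "z' \<in> carrier F0" for z'
    proof -
      note c' = N.smult_closed[OF Y_closed[OF z'] t(1)] fb_closed[OF r_Z0[OF z']]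
      have "fb (r (z \<oplus>\<^bsub>F0\<^esub> z')) = fb (r z) \<oplus>\<^bsub>N\<^esub> fb (r z')"
        unfolding r_add[OF z z'] fb_def by (rule cocycle_unit_add[OF f r_Z0[OF z] r_Z0[OF z']])
      then show ?thesis
        unfolding g_def Y_add[OF z z'] N.smult_l_distr[OF Y_closed[OF z] Y_closed[OF z'] t(1)]
        using c c' by (simp add: N.M.a_ac)
    qed
    show "g (a \<odot>\<^bsub>F0\<^esub> z) = a \<odot>\<^bsub>N\<^esub> g z" if a: "a \<in> carrier A" for a
    proof -
      have "fb (r (a \<odot>\<^bsub>F0\<^esub> z)) = a \<odot>\<^bsub>N\<^esub> fb (r z)"
        unfolding r_smult[OF a z] fb_def by (rule cocycle_unit_smult[OF f a r_Z0[OF z]])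
      then show ?thesis
        unfolding g_def Y_smult[OF a z] N.smult_assoc[OF a Y_closed[OF z] t(1)]
        using N.smult_r_distr[OF a c] by simp
    qed
  qed
  moreover have "f y = g (free_eval A F0 y)" if y: "y \<in> carrier F1" for y
  proof -
    define z where "z = free_eval A F0 y"
    have z: "z \<in> Z0" "z \<in> carrier F0"
      using eval1_in_Z0[OF y] Z0_subset by (auto simp: z_def)
    have Yz: "Y z \<in> ann"
      unfolding ann_def using bspec[OF Y(2) z(2)] Y_closed[OF z(2)] z(1) by (simp add: Z0_iff)
    have "z = relation (Y z) \<oplus>\<^bsub>F0\<^esub> r z"
      unfolding r_def
      by (rule F0.M.add_minus_cancel[symmetric, OF z(2) relation_closed[OF Y_closed[OF z(2)]]])
    then have "fb z = fb (relation (Y z)) \<oplus>\<^bsub>N\<^esub> fb (r z)"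
      unfolding fb_def using cocycle_unit_add(2)[OF f relation_in_Z0[OF Yz] r_Z0[OF z(2)]] by simp
    also have "fb (relation (Y z)) = Y z \<odot>\<^bsub>N\<^esub> t"
      unfolding fb_def using t(2)[OF Yz] by (simp add: value_at_def)
    finally have "fb z = g z" by (simp add: g_def)
    then show ?thesis
      using cocycle_eq_unit[OF f y] by (simp add: fb_def z_def)
  qed
  ultimately show ?thesis
    using f by (intro coboundaryI[of g]) (auto simp: cocycles_iff)
qed

lemma exists_cocycle_value_at:
  assumes "\<And>x. x \<in> ann \<Longrightarrow> \<phi> x \<in> carrier N"
    and "\<And>x y. x \<in> ann \<Longrightarrow> y \<in> ann \<Longrightarrow> \<phi> (x \<oplus> y) = \<phi> x \<oplus>\<^bsub>N\<^esub> \<phi> y"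
    and "\<And>a x. a \<in> carrier A \<Longrightarrow> x \<in> ann \<Longrightarrow> \<phi> (a \<otimes> x) = a \<odot>\<^bsub>N\<^esub> \<phi> x"
  shows "\<exists>f\<in>cocycles. \<forall>x\<in>ann. value_at f x = \<phi> x"
proof -
  obtain Y where Y: "is_mod_hom A F0 (reg_mod A) Y"
    "\<forall>z\<in>carrier F0. Y z \<odot>\<^bsub>M\<^esub> p = free_eval A M z" "Y (free_unit A p) = \<one>"
    using exists_lift by (elim exE conjE)
  interpret Y: left_module_hom A F0 "reg_mod A" Y
    by (intro left_module_hom.intro F0.left_module_axioms left_module_A
        left_module_hom_axioms.intro Y(1))
  have Y_ann: "Y z \<in> ann" if z: "z \<in> Z0" for z
  proof -
    have "z \<in> carrier F0" "free_eval A M z = \<zero>\<^bsub>M\<^esub>" using z by (auto simp: Z0_iff)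
    then show ?thesis
      unfolding ann_def using Y(2) Y.hom_closed by simp
  qed
  \<comment> \<open>The lift maps \<open>Z0\<close> into \<open>ann\<close>, so \<phi> can be
    composed with it on the image of \<open>F1\<close>.\<close>
  define f where "f = (\<lambda>y\<in>carrier F1. \<phi> (Y (free_eval A F0 y)))"
  have f_eq: "f y = \<phi> (Y (free_eval A F0 y))" if "y \<in> carrier F1" for y
    using that by (simp add: f_def)
  have Yd: "Y (free_eval A F0 y) \<in> ann" if "y \<in> carrier F1" for y
    by (rule Y_ann[OF eval1_in_Z0[OF that]])
  show ?thesis
  proof (intro bexI[of _ f] ballI)
    have "\<phi> \<zero> = \<zero>\<^bsub>N\<^esub>"
    proof -
      have 0: "\<zero> \<in> ann" by (simp add: ann_def gen_closed)
      show ?thesis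
        using assms(3)[OF M.R.zero_closed 0] assms(1)[OF 0] by simp
    qed
    moreover have "Y \<zero>\<^bsub>F0\<^esub> = \<zero>" using Y.hom_zero by simp
    moreover have "is_mod_hom A F1 N f"
      unfolding is_mod_hom_def
    proof (intro conjI ballI funcsetI)
      fix y assume y: "y \<in> carrier F1"
      show "f y \<in> carrier N"
        unfolding f_eq[OF y] by (rule assms(1)[OF Yd[OF y]])
      show "f (y \<oplus>\<^bsub>F1\<^esub> y') = f y \<oplus>\<^bsub>N\<^esub> f y'" if y': "y' \<in> carrier F1" for y'
        unfolding f_eq[OF y] f_eq[OF y'] f_eq[OF F1.M.a_closed[OF y y']] d1.hom_add[OF y y']
          Y.hom_add[OF d1.hom_closed[OF y] d1.hom_closed[OF y']]
        using assms(2)[OF Yd[OF y] Yd[OF y']] by simp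
      show "f (a \<odot>\<^bsub>F1\<^esub> y) = a \<odot>\<^bsub>N\<^esub> f y" if a: "a \<in> carrier A" for a
        unfolding f_eq[OF y] f_eq[OF F1.smult_closed[OF a y]] d1.hom_smult[OF a y]
          Y.hom_smult[OF a d1.hom_closed[OF y]]
        using assms(3)[OF a Yd[OF y]] by simp
    qed
    ultimately show "f \<in> cocycles"
      unfolding cocycles_iff using f_eq by (simp add: f_def)
    fix x assume x: "x \<in> ann"
    have "value_at f x = \<phi> (Y (relation x))"
      unfolding value_at_def f_eq[OF unit_in_F1[OF relation_in_Z0[OF x]]]
        eval1_unit[OF relation_in_Z0[OF x]] by (rule refl)
    also have "Y (relation x) = x"
      unfolding relation_def Y.hom_smult[OF ann_closed[OF x] unit_in_F0[OF gen_closed]] Y(3)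
      using ann_closed[OF x] by simp
    finally show "value_at f x = \<phi> x" .
  qed
qed

end

text \<open>These are the only properties of paths on which the dichotomy depends. Irrationality
  enters through \<open>annihilator_iff\<close>, and the restriction to Chen simple modules through
  \<open>eventually_stable\<close>.\<close>

locale filtered_cyclic_ext = cyclic_ext A M N p
  for A :: "('k::field, 'r) module" (structure) and M :: "('r, 'm) module" and N :: "('r, 'n) module" and p +
  fixes pi :: "nat \<Rightarrow> 'r"
  assumes pi_closed: "pi n \<in> carrier A"
    and pi_idem: "pi n \<otimes> pi n = pi n"
    and pi_Suc_left: "pi (Suc n) \<otimes> pi n = pi (Suc n)"
    and pi_Suc_right: "pi n \<otimes> pi (Suc n) = pi (Suc n)"
    and annihilator_iff:
      "x \<in> carrier A \<Longrightarrow> x \<odot>\<^bsub>M\<^esub> p = \<zero>\<^bsub>M\<^esub> \<longleftrightarrow> (\<exists>n. x \<otimes> pi n = \<zero>)"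
    and eventually_stable:
      "t \<in> carrier N \<Longrightarrow> \<exists>m. \<forall>n\<ge>m. pi n \<odot>\<^bsub>N\<^esub> t = pi (Suc n) \<odot>\<^bsub>N\<^esub> t"
begin

definition "eps n = \<one> \<ominus> pi n"
definition "jump n = pi n \<ominus> pi (Suc n)"

lemma pi_mult:
  assumes "m \<le> n"
  shows "pi m \<otimes> pi n = pi n" and "pi n \<otimes> pi m = pi n"
proof -
  have "pi m \<otimes> pi n = pi n \<and> pi n \<otimes> pi m = pi n"
    using assms
  proof (induction n rule: dec_induct)
    case base
    show ?case by (simp add: pi_idem)
  next
    case (step n)
    have "pi m \<otimes> pi (Suc n) = pi m \<otimes> (pi n \<otimes> pi (Suc n))"
      by (simp only: pi_Suc_right)
    also have "\<dots> = (pi m \<otimes> pi n) \<otimes> pi (Suc n)"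
      by (simp only: M.R.m_assoc pi_closed)
    also have "\<dots> = pi (Suc n)"
      using step.IH by (simp only: pi_Suc_right)
    finally have *: "pi m \<otimes> pi (Suc n) = pi (Suc n)" .
    have "pi (Suc n) \<otimes> pi m = (pi (Suc n) \<otimes> pi n) \<otimes> pi m"
      by (simp only: pi_Suc_left)
    also have "\<dots> = pi (Suc n) \<otimes> (pi n \<otimes> pi m)"
      by (simp only: M.R.m_assoc pi_closed)
    also have "\<dots> = pi (Suc n)"
      using step.IH by (simp only: pi_Suc_left)
    finally show ?case using * by simp
  qed
  then show "pi m \<otimes> pi n = pi n" and "pi n \<otimes> pi m = pi n" by auto
qed

lemma eps_closed: "eps n \<in> carrier A"
  by (simp add: eps_def pi_closed)

lemma mult_eps: "x \<in> carrier A \<Longrightarrow> x \<otimes> eps n = x \<ominus> x \<otimes> pi n"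
  by (simp add: eps_def M.R.minus_eq M.R.r_distr M.R.r_minus pi_closed)

lemma eps_smult: "t \<in> carrier N \<Longrightarrow> eps n \<odot>\<^bsub>N\<^esub> t = t \<ominus>\<^bsub>N\<^esub> pi n \<odot>\<^bsub>N\<^esub> t"
  by (simp add: eps_def N.smult_diff_left pi_closed N.smult_one)

lemma ann_iff: "x \<in> ann \<longleftrightarrow> x \<in> carrier A \<and> (\<exists>n. x \<otimes> pi n = \<zero>)"
  using annihilator_iff by (auto simp: ann_def)

lemma eps_in_ann: "eps n \<in> ann"
proof -
  have "eps n \<otimes> pi n = pi n \<ominus> pi n"
    by (simp add: eps_def M.R.minus_eq M.R.l_distr M.R.l_minus pi_closed pi_idem)
  then show ?thesis
    unfolding ann_iff using eps_closed pi_closed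
    by (intro conjI exI[of _ n]) (simp_all add: M.R.minus_eq_zero_iff)
qed

lemma mult_eps_eq_iff:
  assumes "x \<in> carrier A" shows "x \<otimes> eps n = x \<longleftrightarrow> x \<otimes> pi n = \<zero>"
proof -
  have c: "x \<otimes> pi n \<in> carrier A" using assms pi_closed by simp
  have "x \<ominus> x \<otimes> pi n = x \<longleftrightarrow> x \<otimes> pi n = \<zero>"
  proof
    assume "x \<ominus> x \<otimes> pi n = x"
    then have "x \<otimes> pi n \<oplus> x = x"
      using M.R.add_minus_cancel[OF assms c] by simp
    then show "x \<otimes> pi n = \<zero>"
      using assms c by simp
  next
    assume "x \<otimes> pi n = \<zero>"
    then show "x \<ominus> x \<otimes> pi n = x"
      using assms by (simp add: M.R.minus_eq)
  qed
  then show ?thesis by (simp only: mult_eps[OF assms])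
qed

text \<open>The elements \<open>eps m\<close> are local right units of the annihilator. A
  homomorphism on it is therefore determined by its values at them.\<close>

lemma ann_eventually:
  assumes "x \<in> ann"
  shows "\<exists>n. \<forall>m\<ge>n. x \<otimes> eps m = x"
proof -
  from assms obtain n where x: "x \<in> carrier A" and n: "x \<otimes> pi n = \<zero>"
    unfolding ann_iff by (elim exE conjE)
  show ?thesis
  proof (intro exI[of _ n] allI impI)
    fix m assume "n \<le> m"
    then have "x \<otimes> pi m = (x \<otimes> pi n) \<otimes> pi m"
      using x by (simp only: M.R.m_assoc pi_closed pi_mult)
    also have "\<dots> = \<zero>" using n pi_closed by simp
    finally show "x \<otimes> eps m = x" by (simp only: mult_eps_eq_iff[OF x])
  qed
qed

lemma pi_minus_pi_ann:
  assumes "m \<le> n"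
  shows "pi m \<ominus> pi n \<in> ann"
proof -
  have "(pi m \<ominus> pi n) \<otimes> pi n = pi n \<ominus> pi n"
    using assms by (simp add: M.R.minus_eq M.R.l_distr M.R.l_minus pi_closed pi_mult)
  then have "(pi m \<ominus> pi n) \<otimes> pi n = \<zero>"
    using pi_closed by (simp add: M.R.minus_eq_zero_iff)
  then show ?thesis
    unfolding ann_iff using pi_closed by (intro conjI exI[of _ n]) simp_all
qed

lemma jump_in_ann: "jump n \<in> ann"
  unfolding jump_def by (rule pi_minus_pi_ann) simp

lemma eps_eq_add:
  "eps n = eps m \<oplus> (pi m \<ominus> pi n)"
proof -
  have "eps m \<oplus> (pi m \<ominus> pi n) = \<one> \<oplus> (\<ominus> pi m \<oplus> (pi m \<oplus> \<ominus> pi n))"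
    unfolding eps_def by (simp add: M.R.minus_eq M.R.a_assoc pi_closed)
  also have "\<ominus> pi m \<oplus> (pi m \<oplus> \<ominus> pi n) = \<ominus> pi n"
    using pi_closed by (simp add: M.R.a_assoc[symmetric] M.R.l_neg)
  finally show ?thesis by (simp add: eps_def M.R.minus_eq)
qed

definition "active = {n. \<exists>t\<in>carrier N. pi n \<odot>\<^bsub>N\<^esub> t \<noteq> pi (Suc n) \<odot>\<^bsub>N\<^esub> t}"

lemma cocycle_trivial_if_finite:
  assumes "finite active" and f: "f \<in> cocycles"
  shows "f \<in> coboundaries"
proof -
  \<comment> \<open>Beyond \<open>N0\<close> there are no active indices, so all later
    \<open>pi n\<close> act on N in the same way as \<open>pi N0\<close>.\<close>
  obtain N0 where N0: "\<forall>n\<in>active. n < N0"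
    using assms(1) unfolding finite_nat_set_iff_bounded by (elim exE)
  have stable: "pi N0 \<odot>\<^bsub>N\<^esub> t = pi n \<odot>\<^bsub>N\<^esub> t" if t: "t \<in> carrier N" and n: "N0 \<le> n" for t n
    using n
  proof (induction n rule: dec_induct)
    case base
    show ?case by (rule refl)
  next
    case (step n)
    have "n \<notin> active" using N0 step.hyps by fastforce
    then show ?case using step.IH t by (simp add: active_def)
  qed
  \<comment> \<open>The element t is the value of the cocycle at \<open>eps N0\<close>; the index is
    left schematic until the final \<open>show\<close>.\<close>
  show ?thesis
  proof (rule coboundary_if_value_at[OF f value_at_closed[OF f eps_in_ann]])
    fix x assume x: "x \<in> ann"
    obtain k where k: "\<forall>m\<ge>k. x \<otimes> eps m = x"
      using ann_eventually[OF x] by (elim exE)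
    define n where "n = max k N0"
    have n: "N0 \<le> n" "x \<otimes> eps n = x" using k by (auto simp: n_def)
    define d where "d = pi N0 \<ominus> pi n"
    have d: "d \<in> ann" unfolding d_def by (rule pi_minus_pi_ann[OF n(1)])
    note vd = value_at_closed[OF f d]
    \<comment> \<open>Idempotence turns the value at \<open>d\<close> into d times this value. It
      vanishes because \<open>d\<close>, a difference of two projections beyond \<open>N0\<close>,
      annihilates N.\<close>
    have "d \<otimes> d = d"
    proof -
      have "d \<otimes> pi N0 = d" "d \<otimes> pi n = \<zero>"
        using n(1) by (simp_all add: d_def M.R.minus_eq M.R.l_distr M.R.l_minus pi_closed pi_mult
            M.R.r_neg pi_idem)
      then have "d \<otimes> (pi N0 \<ominus> pi n) = d"
        using ann_closed[OF d] by (simp add: M.R.minus_eq M.R.r_distr M.R.r_minus pi_closed)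
      then show ?thesis by (simp add: d_def)
    qed
    then have "value_at f d = d \<odot>\<^bsub>N\<^esub> value_at f d"
      using value_at_mult[OF f ann_closed[OF d] d] by simp
    also have "\<dots> = pi N0 \<odot>\<^bsub>N\<^esub> value_at f d \<ominus>\<^bsub>N\<^esub> pi n \<odot>\<^bsub>N\<^esub> value_at f d"
      unfolding d_def[symmetric] by (simp only: d_def N.smult_diff_left pi_closed vd[unfolded d_def])
    also have "\<dots> = \<zero>\<^bsub>N\<^esub>"
      using stable[OF vd n(1)] N.smult_closed[OF pi_closed vd] by (simp only: N.M.minus_eq_zero_iff)
    finally have d0: "value_at f d = \<zero>\<^bsub>N\<^esub>" .
    have "value_at f (eps n) = value_at f (eps N0) \<oplus>\<^bsub>N\<^esub> value_at f d"
      unfolding eps_eq_add[of n N0] d_def[symmetric] by (rule value_at_add[OF f eps_in_ann d])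
    then have e: "value_at f (eps n) = value_at f (eps N0)"
      using d0 value_at_closed[OF f eps_in_ann] by simp
    have "value_at f x = value_at f (x \<otimes> eps n)" using n(2) by simp
    also have "\<dots> = x \<odot>\<^bsub>N\<^esub> value_at f (eps n)"
      by (rule value_at_mult[OF f ann_closed[OF x] eps_in_ann])
    finally show "value_at f x = x \<odot>\<^bsub>N\<^esub> value_at f (eps N0)" using e by simp
  qed
qed

lemma coboundary_value_at_jump:
  assumes "f \<in> coboundaries"
  shows "\<exists>m. \<forall>n\<ge>m. value_at f (jump n) = \<zero>\<^bsub>N\<^esub>"
proof -
  obtain t where t: "t \<in> carrier N" "\<forall>x\<in>ann. value_at f x = x \<odot>\<^bsub>N\<^esub> t"
    using coboundary_value_at[OF assms] by (elim bexE)
  obtain m where m: "\<forall>n\<ge>m. pi n \<odot>\<^bsub>N\<^esub> t = pi (Suc n) \<odot>\<^bsub>N\<^esub> t"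
    using eventually_stable[OF t(1)] by (elim exE)
  have "value_at f (jump n) = \<zero>\<^bsub>N\<^esub>" if "m \<le> n" for n
  proof -
    have "value_at f (jump n) = pi n \<odot>\<^bsub>N\<^esub> t \<ominus>\<^bsub>N\<^esub> pi (Suc n) \<odot>\<^bsub>N\<^esub> t"
      unfolding bspec[OF t(2) jump_in_ann] unfolding jump_def
      by (rule N.smult_diff_left[OF pi_closed pi_closed t(1)])
    moreover have "pi n \<odot>\<^bsub>N\<^esub> t = pi (Suc n) \<odot>\<^bsub>N\<^esub> t" using m that by blast
    ultimately show ?thesis
      using N.smult_closed[OF pi_closed t(1)] by (simp only: N.M.minus_eq_zero_iff)
  qed
  then show ?thesis by (intro exI[of _ m] allI impI)
qed

text \<open>The intended value at \<open>eps n\<close>: since \<open>eps n\<close> is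
  \<open>eps 0\<close> plus the first n jumps, it is the sum of the first n prescribed increments,
  the value at \<open>eps 0\<close> being chosen as zero.\<close>

primrec partial_sum :: "(nat \<Rightarrow> 'n) \<Rightarrow> nat \<Rightarrow> 'n" where
  "partial_sum s 0 = \<zero>\<^bsub>N\<^esub>"
| "partial_sum s (Suc n) = partial_sum s n \<oplus>\<^bsub>N\<^esub> s n"

lemma exists_cocycle_jump:
  assumes s: "\<And>n. s n \<in> carrier N" "\<And>n. pi n \<odot>\<^bsub>N\<^esub> s n = s n"
    "\<And>n. pi (Suc n) \<odot>\<^bsub>N\<^esub> s n = \<zero>\<^bsub>N\<^esub>"
  shows "\<exists>f\<in>cocycles. \<forall>n. value_at f (jump n) = s n"
proof -
  let ?T = "partial_sum s"
  have T_closed: "?T n \<in> carrier N" for n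
    by (induction n) (simp_all add: s(1))
  have pi_le: "pi m \<odot>\<^bsub>N\<^esub> s i = s i" if "m \<le> i" for m i
  proof -
    have "pi m \<odot>\<^bsub>N\<^esub> s i = pi m \<odot>\<^bsub>N\<^esub> (pi i \<odot>\<^bsub>N\<^esub> s i)" by (simp only: s(2))
    also have "\<dots> = (pi m \<otimes> pi i) \<odot>\<^bsub>N\<^esub> s i"
      by (rule N.smult_assoc[symmetric, OF pi_closed pi_closed s(1)])
    also have "\<dots> = s i" using that by (simp only: pi_mult s(2))
    finally show ?thesis .
  qed
  have pi_gt: "pi m \<odot>\<^bsub>N\<^esub> s i = \<zero>\<^bsub>N\<^esub>" if "i < m" for m i
  proof -
    have "pi m \<odot>\<^bsub>N\<^esub> s i = (pi m \<otimes> pi (Suc i)) \<odot>\<^bsub>N\<^esub> s i"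
      using that by (simp only: pi_mult Suc_le_eq)
    also have "\<dots> = pi m \<odot>\<^bsub>N\<^esub> (pi (Suc i) \<odot>\<^bsub>N\<^esub> s i)"
      by (rule N.smult_assoc[OF pi_closed pi_closed s(1)])
    also have "\<dots> = \<zero>\<^bsub>N\<^esub>" using pi_closed by (simp add: s(3))
    finally show ?thesis .
  qed
  have piT: "pi n \<odot>\<^bsub>N\<^esub> ?T j = \<zero>\<^bsub>N\<^esub>" if "j \<le> n" for n j
    using that
    by (induction j) (simp_all add: pi_closed N.smult_r_distr T_closed s(1) pi_gt)
  \<comment> \<open>The compatibility of the family. It makes x T_m independent of m once x = x
    eps_m.\<close>
  have eps_T: "eps n \<odot>\<^bsub>N\<^esub> ?T m = ?T n" if "n \<le> m" for n m
    using that
  proof (induction m rule: dec_induct)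
    case base
    show ?case
      unfolding eps_smult[OF T_closed] piT[OF order_refl] using T_closed by (simp add: N.M.minus_eq)
  next
    case (step m)
    have "eps n \<odot>\<^bsub>N\<^esub> s m = \<zero>\<^bsub>N\<^esub>"
      unfolding eps_smult[OF s(1)] pi_le[OF step.hyps(1)] using s(1) by (simp add: N.M.minus_eq_zero_iff)
    then show ?case
      using step.IH T_closed by (simp add: N.smult_r_distr eps_closed s(1))
  qed
  \<comment> \<open>Any index with x eps_m = x would give the same \<phi>; the least one is below
    every other, which is the direction in which \<open>eps_T\<close> applies.\<close>
  define least where "least x = (LEAST n. x \<otimes> eps n = x)" for x
  define \<phi> where "\<phi> x = x \<odot>\<^bsub>N\<^esub> ?T (least x)" for x
  have \<phi>_eq: "\<phi> x = x \<odot>\<^bsub>N\<^esub> ?T m" if x: "x \<in> ann" and m: "x \<otimes> eps m = x" for x m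
  proof -
    have l: "x \<otimes> eps (least x) = x" and le: "least x \<le> m"
      unfolding least_def using m by (rule LeastI, rule Least_le)
    have "x \<odot>\<^bsub>N\<^esub> ?T m = (x \<otimes> eps (least x)) \<odot>\<^bsub>N\<^esub> ?T m" by (simp only: l)
    also have "\<dots> = x \<odot>\<^bsub>N\<^esub> (eps (least x) \<odot>\<^bsub>N\<^esub> ?T m)"
      by (rule N.smult_assoc[OF ann_closed[OF x] eps_closed T_closed])
    finally show ?thesis by (simp only: eps_T[OF le] \<phi>_def)
  qed
  \<comment> \<open>Linearity is checked at one index that is large enough for all elements
    involved.\<close>
  have \<phi>_evt: "\<exists>n. \<forall>m\<ge>n. \<phi> x = x \<odot>\<^bsub>N\<^esub> ?T m" if x: "x \<in> ann" for x
  proof -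
    obtain n where n: "\<forall>m\<ge>n. x \<otimes> eps m = x"
      using ann_eventually[OF x] by (elim exE)
    show ?thesis using n by (intro exI[of _ n] allI impI \<phi>_eq[OF x]) simp
  qed
  have c: "\<phi> x \<in> carrier N" if "x \<in> ann" for x
    unfolding \<phi>_def by (rule N.smult_closed[OF ann_closed[OF that] T_closed])
  have add: "\<phi> (x \<oplus> y) = \<phi> x \<oplus>\<^bsub>N\<^esub> \<phi> y" if x: "x \<in> ann" and y: "y \<in> ann" for x y
  proof -
    obtain n1 n2 n3 where "\<forall>m\<ge>n1. \<phi> x = x \<odot>\<^bsub>N\<^esub> ?T m" "\<forall>m\<ge>n2. \<phi> y = y \<odot>\<^bsub>N\<^esub> ?T m"
      "\<forall>m\<ge>n3. \<phi> (x \<oplus> y) = (x \<oplus> y) \<odot>\<^bsub>N\<^esub> ?T m"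
      using \<phi>_evt[OF x] \<phi>_evt[OF y] \<phi>_evt[OF ann_add[OF x y]] by (elim exE)
    moreover define m where "m = max n1 (max n2 n3)"
    ultimately have "\<phi> x = x \<odot>\<^bsub>N\<^esub> ?T m" "\<phi> y = y \<odot>\<^bsub>N\<^esub> ?T m"
      "\<phi> (x \<oplus> y) = (x \<oplus> y) \<odot>\<^bsub>N\<^esub> ?T m" by simp_all
    then show ?thesis
      using N.smult_l_distr[OF ann_closed[OF x] ann_closed[OF y] T_closed] by simp
  qed
  have smult: "\<phi> (a \<otimes> x) = a \<odot>\<^bsub>N\<^esub> \<phi> x" if a: "a \<in> carrier A" and x: "x \<in> ann" for a x
  proof -
    obtain n1 n2 where "\<forall>m\<ge>n1. \<phi> x = x \<odot>\<^bsub>N\<^esub> ?T m"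
      "\<forall>m\<ge>n2. \<phi> (a \<otimes> x) = (a \<otimes> x) \<odot>\<^bsub>N\<^esub> ?T m"
      using \<phi>_evt[OF x] \<phi>_evt[OF ann_mult[OF a x]] by (elim exE)
    moreover define m where "m = max n1 n2"
    ultimately have "\<phi> x = x \<odot>\<^bsub>N\<^esub> ?T m" "\<phi> (a \<otimes> x) = (a \<otimes> x) \<odot>\<^bsub>N\<^esub> ?T m"
      by simp_all
    then show ?thesis
      using N.smult_assoc[OF a ann_closed[OF x] T_closed] by simp
  qed
  have "\<exists>f\<in>cocycles. \<forall>x\<in>ann. value_at f x = \<phi> x"
    by (rule exists_cocycle_value_at[of \<phi>]) (simp_all only: c add smult)
  then obtain f where f: "f \<in> cocycles" "\<forall>x\<in>ann. value_at f x = \<phi> x"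
    by (elim bexE)
  show ?thesis
  proof (intro bexI[OF _ f(1)] allI)
    fix n
    \<comment> \<open>\<open>jump n\<close> is killed by \<open>pi (Suc n)\<close>, while
      multiplying it by \<open>pi n\<close> on the right leaves it unchanged. Hence the partial sum
      of index n + 1 is the right one, and it contains \<open>s n\<close>.\<close>
    have "jump n \<otimes> pi (Suc n) = \<zero>"
      by (simp add: jump_def M.R.minus_eq M.R.l_distr M.R.l_minus pi_closed pi_mult M.R.r_neg pi_idem)
    then have "value_at f (jump n) = jump n \<odot>\<^bsub>N\<^esub> ?T (Suc n)"
      unfolding bspec[OF f(2) jump_in_ann]
      by (intro \<phi>_eq[OF jump_in_ann]) (simp only: mult_eps_eq_iff[OF ann_closed[OF jump_in_ann]])
    also have "\<dots> = pi n \<odot>\<^bsub>N\<^esub> ?T (Suc n) \<ominus>\<^bsub>N\<^esub> pi (Suc n) \<odot>\<^bsub>N\<^esub> ?T (Suc n)"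
      unfolding jump_def by (rule N.smult_diff_left[OF pi_closed pi_closed T_closed])
    also have "\<dots> = pi n \<odot>\<^bsub>N\<^esub> ?T (Suc n)"
      unfolding piT[OF order_refl]
      by (rule N.M.minus_zero_right[OF N.smult_closed[OF pi_closed T_closed]])
    also have "\<dots> = s n"
      using piT[of n n] by (simp add: N.smult_r_distr pi_closed T_closed s(1) s(2))
    finally show "value_at f (jump n) = s n" .
  qed
qed

section \<open>Linear combinations with coefficients in the field\<close>

lemma scalar_comb_add:
  assumes "finite I" "w \<in> I \<rightarrow> carrier N"
  shows "(\<Oplus>\<^bsub>N\<^esub>i\<in>I. (c i + d i) \<cdot> w i) =
    (\<Oplus>\<^bsub>N\<^esub>i\<in>I. c i \<cdot> w i) \<oplus>\<^bsub>N\<^esub> (\<Oplus>\<^bsub>N\<^esub>i\<in>I. d i \<cdot> w i)"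
proof -
  have w: "w i \<in> carrier N" if "i \<in> I" for i using assms(2) that by auto
  have "(\<Oplus>\<^bsub>N\<^esub>i\<in>I. (c i + d i) \<cdot> w i) =
      (\<Oplus>\<^bsub>N\<^esub>i\<in>I. c i \<cdot> w i \<oplus>\<^bsub>N\<^esub> d i \<cdot> w i)"
    using w by (intro N.M.finsum_cong') (auto simp: scalar_smult_add N.smult_closed scalar_closed)
  also have "\<dots> = (\<Oplus>\<^bsub>N\<^esub>i\<in>I. c i \<cdot> w i) \<oplus>\<^bsub>N\<^esub>
      (\<Oplus>\<^bsub>N\<^esub>i\<in>I. d i \<cdot> w i)"
    using w by (intro N.M.finsum_addf) (auto simp: N.smult_closed scalar_closed)
  finally show ?thesis .
qed

lemma scalar_comb_scale:
  assumes "finite I" "w \<in> I \<rightarrow> carrier N"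
  shows "(\<Oplus>\<^bsub>N\<^esub>i\<in>I. (k * c i) \<cdot> w i) =
    k \<cdot> (\<Oplus>\<^bsub>N\<^esub>i\<in>I. c i \<cdot> w i)"
proof -
  have w: "w i \<in> carrier N" if "i \<in> I" for i using assms(2) that by auto
  have "(\<Oplus>\<^bsub>N\<^esub>i\<in>I. (k * c i) \<cdot> w i) =
      (\<Oplus>\<^bsub>N\<^esub>i\<in>I. k \<cdot> (c i \<cdot> w i))"
    using w by (intro N.M.finsum_cong') (auto simp: scalar_smult_mult N.smult_closed scalar_closed)
  also have "\<dots> = k \<cdot> (\<Oplus>\<^bsub>N\<^esub>i\<in>I. c i \<cdot> w i)"
    using w by (intro N.smult_finsum[symmetric] assms(1) scalar_closed) (auto simp: N.smult_closed scalar_closed)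
  finally show ?thesis .
qed

lemma scalar_comb_zero:
  assumes "w \<in> I \<rightarrow> carrier N" "\<And>i. i \<in> I \<Longrightarrow> c i = 0"
  shows "(\<Oplus>\<^bsub>N\<^esub>i\<in>I. c i \<cdot> w i) = \<zero>\<^bsub>N\<^esub>"
  using assms by (intro N.M.add.finprod_one_eqI) (auto simp: scalar_smult_zero Pi_def)

lemma scalar_comb_sum:
  assumes "finite J" "finite I" "w \<in> I \<rightarrow> carrier N"
  shows "(\<Oplus>\<^bsub>N\<^esub>i\<in>I. (\<Sum>j\<in>J. a j * c j i) \<cdot> w i) =
    (\<Oplus>\<^bsub>N\<^esub>j\<in>J. a j \<cdot> (\<Oplus>\<^bsub>N\<^esub>i\<in>I. c j i \<cdot> w i))"
  using assms(1)
proof (induction J)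
  case empty
  show ?case by (simp add: scalar_comb_zero[OF assms(3)])
next
  case (insert j J)
  have cl: "(\<Oplus>\<^bsub>N\<^esub>i\<in>I. c j i \<cdot> w i) \<in> carrier N" for j
    using assms(3) by (intro N.M.finsum_closed) (auto intro!: N.smult_closed scalar_closed)
  have "(\<Oplus>\<^bsub>N\<^esub>i\<in>I. (\<Sum>j\<in>insert j J. a j * c j i) \<cdot> w i) =
      (\<Oplus>\<^bsub>N\<^esub>i\<in>I. (a j * c j i + (\<Sum>j\<in>J. a j * c j i)) \<cdot> w i)"
    using insert.hyps by simp
  also have "\<dots> = a j \<cdot> (\<Oplus>\<^bsub>N\<^esub>i\<in>I. c j i \<cdot> w i) \<oplus>\<^bsub>N\<^esub>
      (\<Oplus>\<^bsub>N\<^esub>i\<in>I. (\<Sum>j\<in>J. a j * c j i) \<cdot> w i)"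
    unfolding scalar_comb_add[OF assms(2,3)] scalar_comb_scale[OF assms(2,3)] by (rule refl)
  also have "\<dots> = (\<Oplus>\<^bsub>N\<^esub>j\<in>insert j J. a j \<cdot>
      (\<Oplus>\<^bsub>N\<^esub>i\<in>I. c j i \<cdot> w i))"
    unfolding insert.IH using insert.hyps
    by (intro N.M.finsum_insert[symmetric]) (auto intro!: N.smult_closed scalar_closed cl)
  finally show ?case .
qed

lemma infinite_dimensional:
  assumes "infinite active"
  shows "\<not> fin_dim (Ext1 A M N)"
proof
  assume "fin_dim (Ext1 A M N)"
  from fin_dim_generators[OF this] obtain I :: "((('m \<Rightarrow> 'r) \<Rightarrow> 'r) \<Rightarrow> 'n) set set" and b
    where I: "finite I" and b: "b \<in> I \<rightarrow> cocycles"
      and gen: "\<forall>f\<in>cocycles. \<exists>c. \<exists>h\<in>coboundaries. \<forall>y\<in>carrier F1.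
        f y = h y \<oplus>\<^bsub>N\<^esub> (\<Oplus>\<^bsub>N\<^esub>i\<in>I. c i \<cdot> b i y)"
    by (elim exE conjE)
  obtain g :: "nat \<Rightarrow> nat" where g: "\<forall>j. infinite {n \<in> active. g n = j}"
    using infinite_nat_partition[OF assms] by (elim exE)
  \<comment> \<open>One element more than the number of generators.\<close>
  define J where "J = {..card I}"
  have w: "(\<lambda>i. value_at (b i) (jump n)) \<in> I \<rightarrow> carrier N" for n
    using b value_at_closed[OF _ jump_in_ann] by (auto simp: Pi_def)
  \<comment> \<open>An admissible increment at index n, non-zero whenever n is active: the
    difference of \<open>pi n\<close> and \<open>pi (Suc n)\<close> applied to a vector that
    distinguishes them.\<close>
  have "\<exists>s. s \<in> carrier N \<and> pi n \<odot>\<^bsub>N\<^esub> s = s \<and> pi (Suc n) \<odot>\<^bsub>N\<^esub> s = \<zero>\<^bsub>N\<^esub> \<and>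
      (n \<in> active \<longrightarrow> s \<noteq> \<zero>\<^bsub>N\<^esub>)" for n
  proof (cases "n \<in> active")
    case True
    then obtain t where t: "t \<in> carrier N" "pi n \<odot>\<^bsub>N\<^esub> t \<noteq> pi (Suc n) \<odot>\<^bsub>N\<^esub> t"
      by (auto simp: active_def)
    have pt: "pi m \<odot>\<^bsub>N\<^esub> t \<in> carrier N" for m by (rule N.smult_closed[OF pi_closed t(1)])
    have ppt: "pi l \<odot>\<^bsub>N\<^esub> (pi m \<odot>\<^bsub>N\<^esub> t) = (pi l \<otimes> pi m) \<odot>\<^bsub>N\<^esub> t" for l m
      by (rule N.smult_assoc[symmetric, OF pi_closed pi_closed t(1)])
    define s where "s = pi n \<odot>\<^bsub>N\<^esub> t \<ominus>\<^bsub>N\<^esub> pi (Suc n) \<odot>\<^bsub>N\<^esub> t"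
    have "s \<in> carrier N" using pt by (simp add: s_def)
    moreover have "pi n \<odot>\<^bsub>N\<^esub> s = s"
      unfolding s_def by (simp only: N.smult_diff_right[OF pi_closed pt pt] ppt pi_idem pi_Suc_right)
    moreover have "pi (Suc n) \<odot>\<^bsub>N\<^esub> s = \<zero>\<^bsub>N\<^esub>"
      unfolding s_def
      by (simp only: N.smult_diff_right[OF pi_closed pt pt] ppt pi_idem pi_Suc_left
          N.M.minus_eq_zero_iff[OF pt pt])
    moreover have "s \<noteq> \<zero>\<^bsub>N\<^esub>"
      unfolding s_def using t(2) by (simp only: N.M.minus_eq_zero_iff[OF pt pt] not_False_eq_True)
    ultimately show ?thesis by metis
  next
    case False
    then show ?thesis using pi_closed by (intro exI[of _ "\<zero>\<^bsub>N\<^esub>"]) simp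
  qed
  then have "\<forall>n. \<exists>s. s \<in> carrier N \<and> pi n \<odot>\<^bsub>N\<^esub> s = s \<and> pi (Suc n) \<odot>\<^bsub>N\<^esub> s = \<zero>\<^bsub>N\<^esub> \<and>
      (n \<in> active \<longrightarrow> s \<noteq> \<zero>\<^bsub>N\<^esub>)" by simp
  from choice[OF this] obtain s where s: "\<forall>n. s n \<in> carrier N \<and> pi n \<odot>\<^bsub>N\<^esub> s n = s n \<and>
      pi (Suc n) \<odot>\<^bsub>N\<^esub> s n = \<zero>\<^bsub>N\<^esub> \<and> (n \<in> active \<longrightarrow> s n \<noteq> \<zero>\<^bsub>N\<^esub>)" by (elim exE)
  \<comment> \<open>The chosen increments, cut down to the indices in block j. Distinct j have
    disjoint supports, each containing infinitely many active indices.\<close>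
  define \<sigma> where "\<sigma> j n = (if g n = j then s n else \<zero>\<^bsub>N\<^esub>)" for j n
  have "\<exists>c. \<exists>m. \<forall>n\<ge>m. \<sigma> j n =
      (\<Oplus>\<^bsub>N\<^esub>i\<in>I. c i \<cdot> value_at (b i) (jump n))" for j
  proof -
    have "\<exists>f\<in>cocycles. \<forall>n. value_at f (jump n) = \<sigma> j n"
    proof (rule exists_cocycle_jump[of "\<sigma> j"])
      show "\<sigma> j n \<in> carrier N" "pi n \<odot>\<^bsub>N\<^esub> \<sigma> j n = \<sigma> j n" "pi (Suc n) \<odot>\<^bsub>N\<^esub> \<sigma> j n = \<zero>\<^bsub>N\<^esub>" for n
        using s pi_closed by (simp_all add: \<sigma>_def)
    qed
    then obtain f where f: "f \<in> cocycles" "\<forall>n. value_at f (jump n) = \<sigma> j n"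
      by (elim bexE)
    obtain c h where h: "h \<in> coboundaries" and fh: "\<forall>y\<in>carrier F1.
        f y = h y \<oplus>\<^bsub>N\<^esub> (\<Oplus>\<^bsub>N\<^esub>i\<in>I. c i \<cdot> b i y)"
      using bspec[OF gen f(1)] by (elim exE bexE)
    \<comment> \<open>From this index on the coboundary contributes nothing, and only the generators
      remain.\<close>
    obtain m where m: "\<forall>n\<ge>m. value_at h (jump n) = \<zero>\<^bsub>N\<^esub>"
      using coboundary_value_at_jump[OF h] by (elim exE)
    have "\<sigma> j n = (\<Oplus>\<^bsub>N\<^esub>i\<in>I. c i \<cdot> value_at (b i) (jump n))" if "m \<le> n" for n
    proof -
      have cl: "(\<Oplus>\<^bsub>N\<^esub>i\<in>I. c i \<cdot> value_at (b i) (jump n)) \<in> carrier N"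
        using w[of n] by (intro N.M.finsum_closed) (auto intro!: N.smult_closed scalar_closed)
      have "value_at f (jump n) = value_at h (jump n) \<oplus>\<^bsub>N\<^esub>
          (\<Oplus>\<^bsub>N\<^esub>i\<in>I. c i \<cdot> value_at (b i) (jump n))"
        unfolding value_at_def by (rule bspec[OF fh unit_in_F1[OF relation_in_Z0[OF jump_in_ann]]])
      then show ?thesis
        using m that cl f(2) by simp
    qed
    then show ?thesis by (intro exI[of _ c] exI[of _ m] allI impI)
  qed
  then have "\<forall>j. \<exists>c. \<exists>m. \<forall>n\<ge>m. \<sigma> j n =
      (\<Oplus>\<^bsub>N\<^esub>i\<in>I. c i \<cdot> value_at (b i) (jump n))" by simp
  from choice[OF this] obtain c where "\<forall>j. \<exists>m. \<forall>n\<ge>m. \<sigma> j n =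
      (\<Oplus>\<^bsub>N\<^esub>i\<in>I. c j i \<cdot> value_at (b i) (jump n))" by (elim exE)
  from choice[OF this] obtain m where m: "\<forall>j. \<forall>n\<ge>m j. \<sigma> j n =
      (\<Oplus>\<^bsub>N\<^esub>i\<in>I. c j i \<cdot> value_at (b i) (jump n))" by (elim exE)
  \<comment> \<open>The coefficient vectors with respect to the generators are dependent, so the
    same combination of the increments vanishes far out.\<close>
  obtain a where a: "\<exists>j\<in>J. a j \<noteq> 0" "\<forall>i\<in>I. (\<Sum>j\<in>J. a j * c j i) = 0"
    using exists_linear_dependence[of I J c] I by (auto simp: J_def)
  then obtain l where l: "l \<in> J" "a l \<noteq> 0" by (elim bexE)
  define m' where "m' = Max (m ` J)"
  have m': "m j \<le> m'" if "j \<in> J" for j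
    using that by (auto simp: m'_def J_def)
  \<comment> \<open>A far out active index in block l isolates the single summand \<open>a l\<close>
    times \<open>s n\<close>, which cannot vanish.\<close>
  obtain n where n: "n > m'" "n \<in> active" "g n = l"
    using spec[OF g, of l] by (auto simp: infinite_nat_iff_unbounded)
  have "(\<Oplus>\<^bsub>N\<^esub>j\<in>J. a j \<cdot> \<sigma> j n) =
      (\<Oplus>\<^bsub>N\<^esub>j\<in>J. a j \<cdot>
        (\<Oplus>\<^bsub>N\<^esub>i\<in>I. c j i \<cdot> value_at (b i) (jump n)))"
  proof (rule N.M.finsum_cong'[OF refl])
    show "(\<lambda>j. a j \<cdot>
        (\<Oplus>\<^bsub>N\<^esub>i\<in>I. c j i \<cdot> value_at (b i) (jump n))) \<in> J \<rightarrow> carrier N"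
      using w[of n] by (intro funcsetI N.smult_closed scalar_closed N.M.finsum_closed) auto
    fix j assume "j \<in> J"
    then have "m j \<le> n" using m' n(1) by fastforce
    then show "a j \<cdot> \<sigma> j n = a j \<cdot>
        (\<Oplus>\<^bsub>N\<^esub>i\<in>I. c j i \<cdot> value_at (b i) (jump n))"
      using m by simp
  qed
  also have "\<dots> = (\<Oplus>\<^bsub>N\<^esub>i\<in>I. (\<Sum>j\<in>J. a j * c j i) \<cdot> value_at (b i) (jump n))"
    using I w by (intro scalar_comb_sum[symmetric]) (auto simp: J_def)
  also have "\<dots> = \<zero>\<^bsub>N\<^esub>"
    using a(2) w by (intro scalar_comb_zero) auto
  finally have "(\<Oplus>\<^bsub>N\<^esub>j\<in>J. a j \<cdot> \<sigma> j n) = \<zero>\<^bsub>N\<^esub>" .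
  moreover have "(\<Oplus>\<^bsub>N\<^esub>j\<in>J. a j \<cdot> \<sigma> j n) =
      (\<Oplus>\<^bsub>N\<^esub>j\<in>J. if l = j then a j \<cdot> s n else \<zero>\<^bsub>N\<^esub>)"
    using s n(3)
    by (intro N.M.finsum_cong') (auto simp: \<sigma>_def scalar_closed N.smult_closed)
  moreover have "\<dots> = a l \<cdot> s n"
    using s l(1) by (intro N.M.add.finprod_singleton) (auto simp: J_def N.smult_closed scalar_closed)
  ultimately have "a l \<cdot> s n = \<zero>\<^bsub>N\<^esub>" by simp
  moreover have "s n \<in> carrier N" using s by simp
  then have "inverse (a l) \<cdot> (a l \<cdot> s n) = s n"
    using scalar_smult_mult[of "s n" "inverse (a l)" "a l"] l(2) by (simp add: scalar_one N.smult_one)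
  ultimately have "s n = \<zero>\<^bsub>N\<^esub>"
    using N.smult_zero_right[OF scalar_closed] by simp
  then show False using s n(2) by simp
qed

theorem Ext1_dichotomy:
  "(carrier (Ext1 A M N) \<noteq> {\<zero>\<^bsub>Ext1 A M N\<^esub>} \<longleftrightarrow> infinite active) \<and>
    (infinite active \<longrightarrow> \<not> fin_dim (Ext1 A M N))"
  using infinite_dimensional fin_dim_if_trivial Ext1_trivial_iff cocycle_trivial_if_finite
  by (metis subsetI)

end

section \<open>Computing in the Leavitt path algebra\<close>

lemma poly_mapping_sum_single:
  "(\<Sum>w\<in>Poly_Mapping.keys x. Poly_Mapping.single w (Poly_Mapping.lookup x w)) = x"
proof (rule poly_mapping_eqI)
  fix k
  have "(\<Sum>w\<in>Poly_Mapping.keys x. Poly_Mapping.lookup (Poly_Mapping.single w (Poly_Mapping.lookup x w)) k) =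
      (\<Sum>w\<in>Poly_Mapping.keys x. if w = k then Poly_Mapping.lookup x k else 0)"
    by (intro sum.cong) (auto simp: lookup_single when_def)
  also have "\<dots> = Poly_Mapping.lookup x k"
    by (simp add: sum.delta in_keys_iff)
  finally show "Poly_Mapping.lookup (\<Sum>w\<in>Poly_Mapping.keys x.
      Poly_Mapping.single w (Poly_Mapping.lookup x w)) k = Poly_Mapping.lookup x k"
    by (simp add: lookup_sum)
qed

text \<open>The \<open>single\<close> case only concerns keys of \<open>x\<close>, so a condition on
  the support of \<open>x\<close> stays available for each monomial.\<close>

lemma poly_mapping_additive_induct [case_names zero single add]:
  fixes x :: "'a \<Rightarrow>\<^sub>0 'b::comm_monoid_add"
  assumes "P 0" "\<And>w c. w \<in> Poly_Mapping.keys x \<Longrightarrow> P (Poly_Mapping.single w c)"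
    "\<And>y z. P y \<Longrightarrow> P z \<Longrightarrow> P (y + z)"
  shows "P x"
proof -
  have "P (\<Sum>w\<in>A. Poly_Mapping.single w (Poly_Mapping.lookup x w))"
    if "finite A" "A \<subseteq> Poly_Mapping.keys x" for A
    using that by (induction A) (auto intro: assms)
  from this[of "Poly_Mapping.keys x"] show ?thesis
    by (simp add: poly_mapping_sum_single)
qed

section \<open>The free algebra on the generators\<close>

lemma letters_zero [simp]: "letters 0 = []"
  by (simp add: zero_fword_def)

lemma letters_plus [simp]: "letters (u + w) = letters u @ letters w"
  by (simp add: plus_fword_def)

lemma free_alg_simps [simp]:
  "mult (free_alg G) = (*)" "\<one>\<^bsub>free_alg G\<^esub> = 1" "\<zero>\<^bsub>free_alg G\<^esub> = 0" "add (free_alg G) = (+)"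
  by (simp_all add: free_alg_def)

lemma carrier_free_alg:
  "x \<in> carrier (free_alg G) \<longleftrightarrow> (\<forall>w\<in>Poly_Mapping.keys x. set (letters w) \<subseteq> lpa_gens G)"
  by (simp add: free_alg_def)

lemma free_alg_closed:
  assumes "x \<in> carrier (free_alg G)" "y \<in> carrier (free_alg G)"
  shows "x + y \<in> carrier (free_alg G)" "x * y \<in> carrier (free_alg G)"
    "- x \<in> carrier (free_alg G)" "x - y \<in> carrier (free_alg G)"
proof -
  have add: "x + y \<in> carrier (free_alg G)"
    if "x \<in> carrier (free_alg G)" "y \<in> carrier (free_alg G)" for x y
    using that keys_add[of x y] by (fastforce simp: carrier_free_alg)
  have minus: "- x \<in> carrier (free_alg G)" if "x \<in> carrier (free_alg G)" for x
    using that by (auto simp: carrier_free_alg in_keys_iff)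
  show "x + y \<in> carrier (free_alg G)" "- x \<in> carrier (free_alg G)"
    using add[OF assms] minus[OF assms(1)] by auto
  show "x * y \<in> carrier (free_alg G)"
    using assms keys_mult[of x y] by (fastforce simp: carrier_free_alg)
  show "x - y \<in> carrier (free_alg G)"
    using add[OF assms(1) minus[OF assms(2)]] by simp
qed

lemma single_in_free_alg:
  "set (letters w) \<subseteq> lpa_gens G \<Longrightarrow> Poly_Mapping.single w c \<in> carrier (free_alg G)"
  by (cases "c = 0") (auto simp: carrier_free_alg)

lemma zero_in_free_alg: "0 \<in> carrier (free_alg G)"
  by (simp add: carrier_free_alg)

lemma sum_in_free_alg:
  "(\<And>i. i \<in> I \<Longrightarrow> f i \<in> carrier (free_alg G)) \<Longrightarrow> sum f I \<in> carrier (free_alg G)"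
  by (induction I rule: infinite_finite_induct) (auto intro: free_alg_closed zero_in_free_alg)

lemma ring_free_alg: "ring (free_alg G :: ('v, 'e, 'k::field) free_elem ring)"
proof (rule ringI)
  let ?F = "free_alg G :: ('v, 'e, 'k) free_elem ring"
  show "abelian_group ?F"
  proof (rule abelian_groupI)
    fix x assume "x \<in> carrier ?F"
    then show "\<exists>y\<in>carrier ?F. y \<oplus>\<^bsub>?F\<^esub> x = \<zero>\<^bsub>?F\<^esub>"
      by (intro bexI[of _ "- x"]) (auto intro: free_alg_closed)
  qed (auto intro: free_alg_closed zero_in_free_alg)
  show "monoid ?F"
    by unfold_locales
       (auto simp: mult.assoc carrier_free_alg[of 1] intro: free_alg_closed)
qed (auto simp: algebra_simps)

lemma free_alg_minus:
  assumes "y \<in> carrier (free_alg G)"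
  shows "x \<ominus>\<^bsub>free_alg G\<^esub> y = x - y"
proof -
  interpret F: ring "free_alg G" by (rule ring_free_alg)
  have "\<ominus>\<^bsub>free_alg G\<^esub> y = - y"
    using assms free_alg_closed(3)[OF assms assms]
    by (intro F.minus_equality) auto
  then show ?thesis by (simp add: F.minus_eq)
qed

abbreviation word_elem :: "('v, 'e) lpa_gen list \<Rightarrow> ('v, 'e, 'k::field) free_elem" where
  "word_elem w \<equiv> Poly_Mapping.single (FWord w) 1"

lemma word_elem_mult: "word_elem u * word_elem w = word_elem (u @ w)"
  by (simp add: mult_single plus_fword_def)

lemma gens_simps [simp]:
  "Vert v \<in> lpa_gens G \<longleftrightarrow> v \<in> verts G" "Edge e \<in> lpa_gens G \<longleftrightarrow> e \<in> arcs G"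
  "Ghost e \<in> lpa_gens G \<longleftrightarrow> e \<in> arcs G"
  by (auto simp: lpa_gens_def)

lemma word_in_free_alg: "set w \<subseteq> lpa_gens G \<Longrightarrow> word_elem w \<in> carrier (free_alg G)"
  by (simp add: single_in_free_alg)

section \<open>The quotient by the ideal of relators\<close>

context fin_digraph begin

lemma relators_subset: "lpa_relators G \<subseteq> carrier (free_alg G)"
proof -
  have v: "tail G e \<in> verts G" "head G e \<in> verts G" if "e \<in> arcs G" for e
    using that by simp_all
  have s: "(\<Sum>e\<in>out_arcs G v. gvar (Edge e) * gvar (Ghost e)) \<in> carrier (free_alg G)" for v
    by (intro sum_in_free_alg free_alg_closed single_in_free_alg) auto
  note [intro!] = free_alg_closed single_in_free_alg zero_in_free_alg
  show ?thesis
    unfolding lpa_relators_def using v s by auto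
qed

lemma ideal_lpa: "ideal (lpa_ideal G) (free_alg G)"
proof -
  interpret F: ring "free_alg G" by (rule ring_free_alg)
  show ?thesis unfolding lpa_ideal_def by (rule F.genideal_ideal[OF relators_subset])
qed

lemma relator_in_ideal: "x \<in> lpa_relators G \<Longrightarrow> x \<in> lpa_ideal G"
proof -
  interpret F: ring "free_alg G" by (rule ring_free_alg)
  show "x \<in> lpa_relators G \<Longrightarrow> x \<in> lpa_ideal G"
    unfolding lpa_ideal_def using F.genideal_self[OF relators_subset] by blast
qed

lemma class_eq_iff:
  assumes "x \<in> carrier (free_alg G)" "y \<in> carrier (free_alg G)"
  shows "lpa_class G x = lpa_class G y \<longleftrightarrow> x - y \<in> lpa_ideal G"
proof -
  interpret I: ideal "lpa_ideal G" "free_alg G" by (rule ideal_lpa)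
  show ?thesis
    unfolding lpa_class_def
    using I.quotient_eq_iff_same_a_r_cos[OF ideal_lpa assms] free_alg_minus[OF assms(2)] by metis
qed

lemma mem_class_iff:
  assumes "x \<in> carrier (free_alg G)"
  shows "y \<in> lpa_class G x \<longleftrightarrow> y \<in> carrier (free_alg G) \<and> lpa_class G y = lpa_class G x"
proof -
  interpret I: ideal "lpa_ideal G" "free_alg G" by (rule ideal_lpa)
  show ?thesis
    unfolding lpa_class_def
    by (metis I.a_elemrcos_carrier I.a_rcos_self I.a_repr_independence' assms)
qed

lemma lpa_simps:
  "carrier (lpa G) = {lpa_class G x | x. x \<in> carrier (free_alg G) \<and> Poly_Mapping.lookup x 0 = 0}"
  "\<one>\<^bsub>lpa G\<^esub> = lpa_class G (\<Sum>v\<in>verts G. word_elem [Vert v])"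
  "\<zero>\<^bsub>lpa G\<^esub> = lpa_ideal G"
  by (simp_all add: lpa_def)

lemma class_zero: "lpa_class G 0 = \<zero>\<^bsub>lpa G\<^esub>"
proof -
  interpret I: ideal "lpa_ideal G" "free_alg G" by (rule ideal_lpa)
  show ?thesis
    using I.a_rcos_const[of 0] additive_subgroup.zero_closed[OF I.additive_subgroup_axioms] by (simp add: lpa_class_def lpa_simps)
qed

lemma class_eq_zero_iff:
  assumes "x \<in> carrier (free_alg G)"
  shows "lpa_class G x = \<zero>\<^bsub>lpa G\<^esub> \<longleftrightarrow> x \<in> lpa_ideal G"
  using class_eq_iff[OF assms zero_in_free_alg] by (simp add: class_zero)

lemma class_add:
  assumes "x \<in> carrier (free_alg G)" "y \<in> carrier (free_alg G)"
  shows "lpa_class G x \<oplus>\<^bsub>lpa G\<^esub> lpa_class G y = lpa_class G (x + y)"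
proof -
  interpret I: ideal "lpa_ideal G" "free_alg G" by (rule ideal_lpa)
  show ?thesis
    using I.a_rcos_sum[OF assms] by (simp add: lpa_class_def lpa_def)
qed

lemma class_mult:
  assumes "x \<in> carrier (free_alg G)" "y \<in> carrier (free_alg G)"
  shows "lpa_class G x \<otimes>\<^bsub>lpa G\<^esub> lpa_class G y = lpa_class G (x * y)"
proof -
  interpret I: ideal "lpa_ideal G" "free_alg G" by (rule ideal_lpa)
  show ?thesis
    using I.rcoset_mult_add[OF assms] by (simp add: lpa_class_def lpa_def)
qed

lemma class_smult:
  assumes "x \<in> carrier (free_alg G)"
  shows "k \<odot>\<^bsub>lpa G\<^esub> lpa_class G x = lpa_class G (Poly_Mapping.single 0 k * x)"
proof -
  interpret I: ideal "lpa_ideal G" "free_alg G" by (rule ideal_lpa)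
  have k: "Poly_Mapping.single 0 k \<in> carrier (free_alg G)"
    by (rule single_in_free_alg) simp
  have "lpa_class G (Poly_Mapping.single 0 k * y) = lpa_class G (Poly_Mapping.single 0 k * x)"
    if "y \<in> lpa_class G x" for y
  proof -
    have y: "y \<in> carrier (free_alg G)" "y - x \<in> lpa_ideal G"
      using that mem_class_iff[OF assms] class_eq_iff[of y x] assms by auto
    have "Poly_Mapping.single 0 k * (y - x) \<in> lpa_ideal G"
      using I.I_l_closed[OF y(2) k] by simp
    then show ?thesis
      by (subst class_eq_iff)
         (auto simp: right_diff_distrib intro!: free_alg_closed(2)[OF k] y(1) assms)
  qed
  moreover have "x \<in> lpa_class G x" using mem_class_iff[OF assms] assms by simp
  ultimately have "(\<Union>y\<in>lpa_class G x. lpa_class G (Poly_Mapping.single 0 k * y)) =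
      lpa_class G (Poly_Mapping.single 0 k * x)"
    by (intro UN_constant_eq ballI)
  then show ?thesis by (simp add: lpa_def)
qed

lemma class_in_carrier:
  "x \<in> carrier (free_alg G) \<Longrightarrow> Poly_Mapping.lookup x 0 = 0 \<Longrightarrow> lpa_class G x \<in> carrier (lpa G)"
  by (auto simp: lpa_simps)

lemma carrier_lpaE:
  assumes "X \<in> carrier (lpa G)"
  obtains x where "x \<in> carrier (free_alg G)" "X = lpa_class G x"
  using assms by (auto simp: lpa_simps)

end

text \<open>The parameter \<open>field_type\<close> only serves to fix the type of coefficients.\<close>

locale leavitt_algebra = fin_digraph G for G :: "('a, 'b) pre_digraph" +
  fixes field_type :: "'k::field itself"
begin

abbreviation L :: "('k, ('a, 'b, 'k) lpa_elem) module" where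
  "L \<equiv> lpa G"

definition word_class :: "('a, 'b) lpa_gen list \<Rightarrow> ('a, 'b, 'k) lpa_elem" where
  "word_class w = lpa_class G (word_elem w)"

lemma lpa_vert_eq: "lpa_vert G v = word_class [Vert v]"
  by (simp add: lpa_vert_def word_class_def)

text \<open>The empty word is excluded because the unit of the free algebra has a constant term, and
  the carrier of L is made of classes without one.\<close>

lemma word_class_closed:
  assumes "set w \<subseteq> lpa_gens G" "w \<noteq> []"
  shows "word_class w \<in> carrier L"
  unfolding word_class_def using assms
  by (intro class_in_carrier word_in_free_alg) (auto simp: lookup_single zero_fword_def when_def)

lemma word_class_mult:
  assumes "set u \<subseteq> lpa_gens G" "set w \<subseteq> lpa_gens G"
  shows "word_class u \<otimes>\<^bsub>L\<^esub> word_class w = word_class (u @ w)"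
  unfolding word_class_def class_mult[OF word_in_free_alg[OF assms(1)] word_in_free_alg[OF assms(2)]]
  by (simp add: word_elem_mult)

text \<open>The congruence rule for rewriting a subword. The contexts may be empty, since cosets
  multiply in the unital quotient.\<close>

lemma word_class_context:
  assumes "word_class u = word_class w"
    "set u \<subseteq> lpa_gens G" "set w \<subseteq> lpa_gens G" "set a \<subseteq> lpa_gens G" "set b \<subseteq> lpa_gens G"
  shows "word_class (a @ u @ b) = word_class (a @ w @ b)"
  using assms(1) word_class_mult[of a "u @ b"] word_class_mult[of u b]
    word_class_mult[of a "w @ b"] word_class_mult[of w b] assms(2-)
  by (metis Un_least set_append)

lemma word_class_zero_context:
  assumes "word_class u = \<zero>\<^bsub>L\<^esub>"
    "set u \<subseteq> lpa_gens G" "set a \<subseteq> lpa_gens G" "set b \<subseteq> lpa_gens G"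
  shows "word_class (a @ u @ b) = \<zero>\<^bsub>L\<^esub>"
proof -
  interpret I: ideal "lpa_ideal G :: ('a, 'b, 'k) free_elem set" "free_alg G" by (rule ideal_lpa)
  note c = word_in_free_alg[OF assms(2)] word_in_free_alg[OF assms(3)] word_in_free_alg[OF assms(4)]
  have "(word_elem u :: ('a, 'b, 'k) free_elem) \<in> lpa_ideal G"
    using assms(1) c(1) class_eq_zero_iff unfolding word_class_def by blast
  then have "word_elem a * (word_elem u * word_elem b) \<in> (lpa_ideal G :: ('a, 'b, 'k) free_elem set)"
    using I.I_l_closed[OF I.I_r_closed c(2)] c(3) by simp
  then have "word_elem (a @ u @ b) \<in> (lpa_ideal G :: ('a, 'b, 'k) free_elem set)"
    by (simp add: word_elem_mult)
  then show ?thesis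
    unfolding word_class_def using assms(2-) by (subst class_eq_zero_iff) (auto intro!: word_in_free_alg)
qed

lemma word_class_eqI:
  assumes "word_elem u - word_elem w \<in> (lpa_relators G :: ('a, 'b, 'k) free_elem set)"
    "set u \<subseteq> lpa_gens G" "set w \<subseteq> lpa_gens G"
  shows "word_class u = word_class w"
  unfolding word_class_def
  by (subst class_eq_iff) (intro word_in_free_alg relator_in_ideal assms)+

lemma word_class_zeroI:
  assumes "word_elem u \<in> (lpa_relators G :: ('a, 'b, 'k) free_elem set)" "set u \<subseteq> lpa_gens G"
  shows "word_class u = \<zero>\<^bsub>L\<^esub>"
  unfolding word_class_def
  by (subst class_eq_zero_iff) (intro word_in_free_alg relator_in_ideal assms)+

lemma relatorsI:
  shows "v \<in> verts G \<Longrightarrow> u \<in> verts G \<Longrightarrow>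
      gvar (Vert v) * gvar (Vert u) - (if v = u then gvar (Vert v) else 0) \<in> lpa_relators G"
    and "e \<in> arcs G \<Longrightarrow> gvar (Vert (tail G e)) * gvar (Edge e) - gvar (Edge e) \<in> lpa_relators G"
    and "e \<in> arcs G \<Longrightarrow> gvar (Edge e) * gvar (Vert (head G e)) - gvar (Edge e) \<in> lpa_relators G"
    and "e \<in> arcs G \<Longrightarrow> gvar (Vert (head G e)) * gvar (Ghost e) - gvar (Ghost e) \<in> lpa_relators G"
    and "e \<in> arcs G \<Longrightarrow> gvar (Ghost e) * gvar (Vert (tail G e)) - gvar (Ghost e) \<in> lpa_relators G"
    and "e \<in> arcs G \<Longrightarrow> f \<in> arcs G \<Longrightarrow>
      gvar (Ghost e) * gvar (Edge f) - (if e = f then gvar (Vert (head G e)) else 0) \<in> lpa_relators G"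
    and "v \<in> verts G \<Longrightarrow> finite (out_arcs G v) \<Longrightarrow> out_arcs G v \<noteq> {} \<Longrightarrow>
      gvar (Vert v) - (\<Sum>e\<in>out_arcs G v. gvar (Edge e) * gvar (Ghost e)) \<in> lpa_relators G"
  unfolding lpa_relators_def
  subgoal by (rule UnI1, rule UnI1, rule UnI1, rule UnI1, rule UnI1, rule UnI1, rule CollectI, intro exI conjI, rule refl)
  subgoal by (rule UnI1, rule UnI1, rule UnI1, rule UnI1, rule UnI1, rule UnI2, rule CollectI, intro exI conjI, rule refl)
  subgoal by (rule UnI1, rule UnI1, rule UnI1, rule UnI1, rule UnI2, rule CollectI, intro exI conjI, rule refl)
  subgoal by (rule UnI1, rule UnI1, rule UnI1, rule UnI2, rule CollectI, intro exI conjI, rule refl)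
  subgoal by (rule UnI1, rule UnI1, rule UnI2, rule CollectI, intro exI conjI, rule refl)
  subgoal by (rule UnI1, rule UnI2, rule CollectI, intro exI conjI, rule refl)
  subgoal by (rule UnI2, rule CollectI, intro exI conjI, rule refl)
  done

lemma lpa_relations:
  shows "v \<in> verts G \<Longrightarrow> word_class [Vert v, Vert v] = word_class [Vert v]"
    and "v \<in> verts G \<Longrightarrow> u \<in> verts G \<Longrightarrow> v \<noteq> u \<Longrightarrow>
      word_class [Vert v, Vert u] = \<zero>\<^bsub>L\<^esub>"
    and "e \<in> arcs G \<Longrightarrow> word_class [Vert (tail G e), Edge e] = word_class [Edge e]"
    and "e \<in> arcs G \<Longrightarrow> word_class [Edge e, Vert (head G e)] = word_class [Edge e]"
    and "e \<in> arcs G \<Longrightarrow> word_class [Vert (head G e), Ghost e] = word_class [Ghost e]"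
    and "e \<in> arcs G \<Longrightarrow> word_class [Ghost e, Vert (tail G e)] = word_class [Ghost e]"
    and "e \<in> arcs G \<Longrightarrow> word_class [Ghost e, Edge e] = word_class [Vert (head G e)]"
    and "e \<in> arcs G \<Longrightarrow> f \<in> arcs G \<Longrightarrow> e \<noteq> f \<Longrightarrow>
      word_class [Ghost e, Edge f] = \<zero>\<^bsub>L\<^esub>"
proof -
  note r = relatorsI[unfolded word_elem_mult append.simps]
  show "v \<in> verts G \<Longrightarrow> word_class [Vert v, Vert v] = word_class [Vert v]"
    using r(1)[of v v] by (intro word_class_eqI) simp_all
  show "v \<in> verts G \<Longrightarrow> u \<in> verts G \<Longrightarrow> v \<noteq> u \<Longrightarrow>
      word_class [Vert v, Vert u] = \<zero>\<^bsub>L\<^esub>"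
    using r(1)[of v u] by (intro word_class_zeroI) simp_all
  assume e: "e \<in> arcs G"
  show "word_class [Vert (tail G e), Edge e] = word_class [Edge e]"
    "word_class [Edge e, Vert (head G e)] = word_class [Edge e]"
    "word_class [Vert (head G e), Ghost e] = word_class [Ghost e]"
    "word_class [Ghost e, Vert (tail G e)] = word_class [Ghost e]"
    using e by (intro word_class_eqI r; simp)+
  show "word_class [Ghost e, Edge e] = word_class [Vert (head G e)]"
    using r(6)[of e e] e by (intro word_class_eqI) simp_all
  show "f \<in> arcs G \<Longrightarrow> e \<noteq> f \<Longrightarrow> word_class [Ghost e, Edge f] = \<zero>\<^bsub>L\<^esub>"
    using r(6)[of e f] e by (intro word_class_zeroI) simp_all
qed

lemma CK2:
  assumes "v \<in> verts G" "out_arcs G v \<noteq> {}"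
  shows "word_class [Vert v] = lpa_class G (\<Sum>e\<in>out_arcs G v. word_elem [Edge e, Ghost e])"
proof -
  have s: "(\<Sum>e\<in>out_arcs G v. word_elem [Edge e, Ghost e]) \<in> (carrier (free_alg G) :: ('a, 'b, 'k) free_elem set)"
    by (intro sum_in_free_alg word_in_free_alg) auto
  have "finite (out_arcs G v)" by (simp add: out_arcs_def)
  then have "word_elem [Vert v] - (\<Sum>e\<in>out_arcs G v. word_elem [Edge e, Ghost e]) \<in>
      (lpa_relators G :: ('a, 'b, 'k) free_elem set)"
    using relatorsI(7)[of v] assms by (simp add: word_elem_mult)
  then show ?thesis
    unfolding word_class_def using assms(1) s
    by (subst class_eq_iff) (auto intro!: word_in_free_alg relator_in_ideal)
qed

end

section \<open>The action on infinite paths\<close>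

text \<open>One summand of \<open>free_act\<close>, with \<open>c\<close> the product of both
  coefficients. It vanishes at c = 0 and is additive in \<open>c\<close>; hence the sums may range
  over any finite sets containing the supports, and biadditivity follows.\<close>

definition act_single ::
  "('v, 'e) pre_digraph \<Rightarrow> ('v, 'e) lpa_gen fword \<Rightarrow> 'e stream \<Rightarrow> 'k::field \<Rightarrow> 'e stream \<Rightarrow>\<^sub>0 'k" where
  "act_single G w q c = (case word_act G (letters w) q of None \<Rightarrow> 0 | Some q' \<Rightarrow> Poly_Mapping.single q' c)"

lemma act_single_zero [simp]: "act_single G w q 0 = 0"
  by (simp add: act_single_def split: option.split)

lemma act_single_add: "act_single G w q (c + d) = act_single G w q c + act_single G w q d"
  by (simp add: act_single_def single_add split: option.split)

lemma free_act_eq_sum: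
  assumes "finite A" "Poly_Mapping.keys x \<subseteq> A" "finite B" "Poly_Mapping.keys m \<subseteq> B"
  shows "free_act G x m =
    (\<Sum>w\<in>A. \<Sum>q\<in>B. act_single G w q (Poly_Mapping.lookup x w * Poly_Mapping.lookup m q))"
proof -
  have "free_act G x m = (\<Sum>w\<in>Poly_Mapping.keys x. \<Sum>q\<in>Poly_Mapping.keys m.
      act_single G w q (Poly_Mapping.lookup x w * Poly_Mapping.lookup m q))"
    by (simp add: free_act_def act_single_def)
  also have "\<dots> = (\<Sum>w\<in>A. \<Sum>q\<in>Poly_Mapping.keys m.
      act_single G w q (Poly_Mapping.lookup x w * Poly_Mapping.lookup m q))"
    using assms(1,2) by (intro sum.mono_neutral_left) (auto simp: in_keys_iff)
  also have "\<dots> = (\<Sum>w\<in>A. \<Sum>q\<in>B. act_single G w q (Poly_Mapping.lookup x w * Poly_Mapping.lookup m q))"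
    using assms(3,4) by (intro sum.cong sum.mono_neutral_left) (auto simp: in_keys_iff)
  finally show ?thesis .
qed

lemma free_act_zero [simp]: "free_act G 0 m = 0" "free_act G x 0 = 0"
  by (simp_all add: free_act_def)

lemma free_act_single:
  "free_act G (Poly_Mapping.single w c) (Poly_Mapping.single q d) = act_single G w q (c * d)"
  by (subst free_act_eq_sum[of "{w}" _ "{q}"]) auto

lemma free_act_add_left: "free_act G (x + y) m = free_act G x m + free_act G y m"
proof -
  define A where "A = Poly_Mapping.keys x \<union> Poly_Mapping.keys y"
  have A: "finite A" "Poly_Mapping.keys x \<subseteq> A" "Poly_Mapping.keys y \<subseteq> A"
    "Poly_Mapping.keys (x + y) \<subseteq> A"
    using keys_add[of x y] by (auto simp: A_def)
  note B = finite_keys[of m] order_refl[of "Poly_Mapping.keys m"]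
  show ?thesis
    unfolding free_act_eq_sum[OF A(1,2) B] free_act_eq_sum[OF A(1,3) B] free_act_eq_sum[OF A(1,4) B]
    by (simp add: lookup_add distrib_right act_single_add sum.distrib)
qed

lemma free_act_add_right: "free_act G x (m + n) = free_act G x m + free_act G x n"
proof -
  define B where "B = Poly_Mapping.keys m \<union> Poly_Mapping.keys n"
  have B: "finite B" "Poly_Mapping.keys m \<subseteq> B" "Poly_Mapping.keys n \<subseteq> B"
    "Poly_Mapping.keys (m + n) \<subseteq> B"
    using keys_add[of m n] by (auto simp: B_def)
  note A = finite_keys[of x] order_refl[of "Poly_Mapping.keys x"]
  show ?thesis
    unfolding free_act_eq_sum[OF A B(1,2)] free_act_eq_sum[OF A B(1,3)] free_act_eq_sum[OF A B(1,4)]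
    by (simp add: lookup_add distrib_left act_single_add sum.distrib)
qed

lemma free_act_minus_left: "free_act G (- x) m = - free_act G x m"
  using free_act_add_left[of G "- x" x m] by (simp add: eq_neg_iff_add_eq_0)

lemma free_act_diff_left: "free_act G (x - y) m = free_act G x m - free_act G y m"
  using free_act_add_left[of G x "- y" m] by (simp add: free_act_minus_left)

lemma free_act_sum_left: "free_act G (sum f I) m = (\<Sum>i\<in>I. free_act G (f i) m)"
  by (induction I rule: infinite_finite_induct) (simp_all add: free_act_add_left)

lemma word_act_append: "word_act G (u @ w) q = Option.bind (word_act G w q) (word_act G u)"
  by (induction u) simp_all

text \<open>Both sides are additive in all three arguments, so the claim reduces to monomials, where
  it is \<open>word_act_append\<close>.\<close>

lemma free_act_mult: "free_act G (x * y) m = free_act G x (free_act G y m)"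
proof (induction m rule: poly_mapping_additive_induct)
  case (single q k)
  show ?case
  proof (induction y rule: poly_mapping_additive_induct)
    case (single w d)
    show ?case
    proof (induction x rule: poly_mapping_additive_induct)
      case (single u c)
      show ?case
        by (cases "word_act G (letters w) q")
           (simp_all add: mult_single free_act_single act_single_def word_act_append mult.assoc)
    qed (simp_all add: free_act_add_left distrib_right)
  qed (simp_all add: free_act_add_left free_act_add_right distrib_left)
qed (simp_all add: free_act_add_right)

lemma free_act_word:
  "free_act G (word_elem w) (Poly_Mapping.single q c) =
    (case word_act G w q of None \<Rightarrow> 0 | Some q' \<Rightarrow> Poly_Mapping.single q' c)"
  by (simp add: free_act_single act_single_def)

lemma keys_free_act:
  assumes "Poly_Mapping.keys m \<subseteq> S"
    "\<And>w q q'. w \<in> Poly_Mapping.keys x \<Longrightarrow> q \<in> S \<Longrightarrow> word_act G (letters w) q = Some q' \<Longrightarrow> q' \<in> S"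
  shows "Poly_Mapping.keys (free_act G x m) \<subseteq> S"
proof (induction m rule: poly_mapping_additive_induct)
  case (single q c)
  then have q: "q \<in> S" using assms(1) by blast
  show ?case
  proof (induction x rule: poly_mapping_additive_induct)
    case (single w d)
    then show ?case
      using assms(2)[OF _ q] by (auto simp: free_act_single act_single_def split: option.split if_splits)
  next
    case (add y z)
    then show ?case using keys_add by (fastforce simp: free_act_add_left)
  qed simp
next
  case (add y z)
  then show ?case using keys_add by (fastforce simp: free_act_add_right)
qed simp

context leavitt_algebra begin

lemma inf_path_Cons:
  assumes "e \<in> arcs G" "inf_path G q" "head G e = tail G (shd q)"
  shows "inf_path G (e ## q)"
  unfolding inf_path_def
proof
  fix i
  show "(e ## q) !! i \<in> arcs G \<and> head G ((e ## q) !! i) = tail G ((e ## q) !! Suc i)"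
    using assms by (cases i) (auto simp: inf_path_def)
qed

lemma inf_path_stl: "inf_path G q \<Longrightarrow> inf_path G (stl q)"
  unfolding inf_path_def by (metis snth.simps(2))

lemma inf_path_shd: "inf_path G q \<Longrightarrow> shd q \<in> arcs G"
  unfolding inf_path_def by (metis snth.simps(1))

lemma gen_act_path_class:
  assumes "g \<in> lpa_gens G" "q \<in> path_class G p" "gen_act G g q = Some q'"
  shows "q' \<in> path_class G p"
proof -
  have q: "inf_path G q" "tail_equiv p q" using assms(2) by (auto simp: path_class_def)
  obtain m n where mn: "sdrop m p = sdrop n q" using q(2) by (auto simp: tail_equiv_def)
  show ?thesis
  proof (cases g)
    case (Vert v)
    then show ?thesis using assms by (auto split: if_splits)
  next
    case (Edge e)
    then have q': "q' = e ## q" "head G e = tail G (shd q)" "e \<in> arcs G"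
      using assms by (auto split: if_splits)
    have "sdrop m p = sdrop (Suc n) q'" using mn q' by simp
    then show ?thesis
      using inf_path_Cons[OF q'(3) q(1) q'(2)] q'(1) unfolding path_class_def tail_equiv_def by blast
  next
    case (Ghost e)
    then have q': "q' = stl q" using assms by (auto split: if_splits)
    have "sdrop (Suc m) p = sdrop n q'"
      using mn q' by (metis sdrop_simps(2) sdrop_stl)
    then show ?thesis
      using inf_path_stl[OF q(1)] q' unfolding path_class_def tail_equiv_def by blast
  qed
qed

lemma word_act_path_class:
  assumes "set w \<subseteq> lpa_gens G" "q \<in> path_class G p" "word_act G w q = Some q'"
  shows "q' \<in> path_class G p"
  using assms
proof (induction w arbitrary: q')
  case (Cons g w)
  then obtain r where "word_act G w q = Some r" "gen_act G g r = Some q'"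
    by (auto simp: bind_eq_Some_conv)
  then show ?case using Cons gen_act_path_class[of g r p q'] by auto
qed simp

lemma keys_free_act_path_class:
  assumes "x \<in> carrier (free_alg G)" "Poly_Mapping.keys m \<subseteq> path_class G p"
  shows "Poly_Mapping.keys (free_act G x m) \<subseteq> path_class G p"
  using assms word_act_path_class by (intro keys_free_act) (auto simp: carrier_free_alg)

lemma relator_acts_zero:
  assumes "x \<in> lpa_relators G" "inf_path G q"
  shows "free_act G x (Poly_Mapping.single q c) = 0"
proof -
  have q: "shd q \<in> arcs G" using assms(2) by (rule inf_path_shd)
  have hq: "head G (shd q) = tail G (shd (stl q))"
    using assms(2) unfolding inf_path_def by (metis snth.simps)
  \<comment> \<open>Among the ghosts of the edges leaving v, only that of the first edge of q can
    act on q without giving zero; its edge then restores q.\<close>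
  have CK: "free_act G (\<Sum>e\<in>out_arcs G v. word_elem [Edge e, Ghost e]) (Poly_Mapping.single q c) =
      (if v = tail G (shd q) then Poly_Mapping.single q c else 0)" for v
  proof -
    have "free_act G (\<Sum>e\<in>out_arcs G v. word_elem [Edge e, Ghost e]) (Poly_Mapping.single q c) =
        (\<Sum>e\<in>out_arcs G v. if e = shd q then Poly_Mapping.single q c else 0)"
      unfolding free_act_sum_left using hq by (intro sum.cong) (auto simp: free_act_word)
    also have "\<dots> = (if v = tail G (shd q) then Poly_Mapping.single q c else 0)"
      using q by (subst sum.delta) (auto simp: out_arcs_def)
    finally show ?thesis .
  qed
  show ?thesis
    using assms(1) q hq unfolding lpa_relators_def word_elem_mult append.simps
    by (auto simp: free_act_diff_left free_act_word CK split: if_splits)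
qed

text \<open>The elements that annihilate every vector supported in the class form a two-sided ideal
  containing the relators. Quantifying over all vectors is what closure under right multiplication
  requires.\<close>

lemma ideal_acts_zero:
  fixes x :: "('a, 'b, 'k) free_elem" and m :: "'b stream \<Rightarrow>\<^sub>0 'k"
  assumes "x \<in> lpa_ideal G" "Poly_Mapping.keys m \<subseteq> path_class G p"
  shows "free_act G x m = 0"
proof -
  interpret F: ring "free_alg G :: ('a, 'b, 'k) free_elem ring" by (rule ring_free_alg)
  define I where "I = {x \<in> carrier (free_alg G :: ('a, 'b, 'k) free_elem ring).
    \<forall>m :: 'b stream \<Rightarrow>\<^sub>0 'k. Poly_Mapping.keys m \<subseteq> path_class G p \<longrightarrow> free_act G x m = 0}"
  have "ideal I (free_alg G)"
  proof (rule idealI[OF F.ring_axioms])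
    show "subgroup I (add_monoid (free_alg G))"
    proof (rule group.subgroupI[OF F.a_group])
      show "I \<noteq> {}" using zero_in_free_alg[of G] by (auto simp: I_def)
      fix x assume x: "x \<in> I"
      have "\<ominus>\<^bsub>free_alg G\<^esub> x = - x"
        using x free_alg_closed(3)[of x G x]
        by (intro F.minus_equality) (auto simp: I_def)
      moreover have "- x \<in> I"
        using x by (auto simp: I_def free_act_minus_left intro: free_alg_closed)
      ultimately show "inv\<^bsub>add_monoid (free_alg G)\<^esub> x \<in> I" by (simp add: a_inv_def)
      fix y assume "y \<in> I"
      then show "x \<otimes>\<^bsub>add_monoid (free_alg G)\<^esub> y \<in> I"
        using x by (auto simp: I_def free_act_add_left intro: free_alg_closed)
    qed (auto simp: I_def)
  next
    fix a x :: "('a, 'b, 'k) free_elem" assume "a \<in> I" "x \<in> carrier (free_alg G)"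
    then show "x \<otimes>\<^bsub>free_alg G\<^esub> a \<in> I" "a \<otimes>\<^bsub>free_alg G\<^esub> x \<in> I"
      using keys_free_act_path_class[of x _ p]
      by (auto simp: I_def free_act_mult intro: free_alg_closed)
  qed
  moreover have "lpa_relators G \<subseteq> I"
  proof
    fix x :: "('a, 'b, 'k) free_elem" assume x: "x \<in> lpa_relators G"
    have "free_act G x m = 0" if "Poly_Mapping.keys m \<subseteq> path_class G p" for m :: "'b stream \<Rightarrow>\<^sub>0 'k"
    proof (induction m rule: poly_mapping_additive_induct)
      case (single q c)
      then have "inf_path G q" using that by (auto simp: path_class_def)
      then show ?case by (rule relator_acts_zero[OF x])
    qed (simp_all add: free_act_add_right)
    then show "x \<in> I" using x relators_subset by (auto simp: I_def)
  qed
  ultimately have "lpa_ideal G \<subseteq> I"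
    unfolding lpa_ideal_def by (rule F.genideal_minimal)
  then show ?thesis using assms by (auto simp: I_def)
qed

lemma chen_module_simps:
  "carrier (chen_module G p) = {m. Poly_Mapping.keys m \<subseteq> path_class G p}"
  "\<zero>\<^bsub>chen_module G p\<^esub> = 0" "add (chen_module G p) = (+)"
  by (simp_all add: chen_module_def)

text \<open>The action uses a representative picked by choice; any two differ by an element of the
  ideal, which acts as zero.\<close>

lemma chen_smult:
  fixes x :: "('a, 'b, 'k) free_elem"
  assumes "x \<in> carrier (free_alg G)" "m \<in> carrier (chen_module G p)"
  shows "lpa_class G x \<odot>\<^bsub>chen_module G p\<^esub> m = free_act G x m"
proof -
  define y where "y = (SOME y. y \<in> lpa_class G x)"
  have "x \<in> lpa_class G x" using mem_class_iff[OF assms(1)] assms(1) by simp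
  then have "y \<in> lpa_class G x" unfolding y_def by (rule someI)
  then have "y - x \<in> lpa_ideal G"
    using mem_class_iff[OF assms(1)] class_eq_iff[OF _ assms(1)] by blast
  then have "free_act G y m = free_act G x m"
    using ideal_acts_zero[of "y - x" m p] assms(2) by (simp add: chen_module_simps free_act_diff_left)
  then show ?thesis by (simp add: chen_module_def y_def)
qed

lemma word_smult_single:
  assumes "set w \<subseteq> lpa_gens G" "q \<in> path_class G p"
  shows "word_class w \<odot>\<^bsub>chen_module G p\<^esub> Poly_Mapping.single q c =
    (case word_act G w q of None \<Rightarrow> 0 | Some q' \<Rightarrow> Poly_Mapping.single q' c)"
  unfolding word_class_def using assms
  by (subst chen_smult) (auto simp: word_in_free_alg chen_module_simps free_act_word)

text \<open>The ring axioms of L are assumed here; in the theorem they are supplied by the module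
  T.\<close>

lemma left_module_chen:
  assumes R: "ring L"
  shows "left_module L (chen_module G p)"
proof -
  let ?A = L
  let ?M = "chen_module G p :: (('a, 'b, 'k) lpa_elem, 'b stream \<Rightarrow>\<^sub>0 'k) module"
  have group: "abelian_group ?M"
  proof (rule abelian_groupI)
    fix x assume "x \<in> carrier ?M"
    then show "\<exists>y\<in>carrier ?M. y \<oplus>\<^bsub>?M\<^esub> x = \<zero>\<^bsub>?M\<^esub>"
      by (intro bexI[of _ "- x"]) (auto simp: chen_module_simps in_keys_iff)
  next
    fix x y assume "x \<in> carrier ?M" "y \<in> carrier ?M"
    then show "x \<oplus>\<^bsub>?M\<^esub> y \<in> carrier ?M"
      using keys_add[of x y] by (auto simp: chen_module_simps)
  qed (auto simp: chen_module_simps algebra_simps)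
  have closed: "free_act G x m \<in> carrier ?M" if "x \<in> carrier (free_alg G)" "m \<in> carrier ?M" for x m
    using keys_free_act_path_class[of x m p] that by (simp add: chen_module_simps)
  show ?thesis
  proof (intro left_module.intro left_module_axioms.intro R group)
    fix a b m assume a: "a \<in> carrier ?A" and b: "b \<in> carrier ?A" and m: "m \<in> carrier ?M"
    obtain x where x: "x \<in> carrier (free_alg G)" "a = lpa_class G x" using a by (rule carrier_lpaE)
    obtain y where y: "y \<in> carrier (free_alg G)" "b = lpa_class G y" using b by (rule carrier_lpaE)
    show "a \<odot>\<^bsub>?M\<^esub> m \<in> carrier ?M"
      unfolding x(2) chen_smult[OF x(1) m] by (rule closed[OF x(1) m])
    show "(a \<oplus>\<^bsub>?A\<^esub> b) \<odot>\<^bsub>?M\<^esub> m = a \<odot>\<^bsub>?M\<^esub> m \<oplus>\<^bsub>?M\<^esub> b \<odot>\<^bsub>?M\<^esub> m"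
      unfolding x(2) y(2) class_add[OF x(1) y(1)] chen_smult[OF x(1) m] chen_smult[OF y(1) m]
        chen_smult[OF free_alg_closed(1)[OF x(1) y(1)] m]
      by (simp add: free_act_add_left chen_module_simps)
    show "(a \<otimes>\<^bsub>?A\<^esub> b) \<odot>\<^bsub>?M\<^esub> m = a \<odot>\<^bsub>?M\<^esub> (b \<odot>\<^bsub>?M\<^esub> m)"
      unfolding x(2) y(2) class_mult[OF x(1) y(1)] chen_smult[OF y(1) m]
        chen_smult[OF x(1) closed[OF y(1) m]] chen_smult[OF free_alg_closed(2)[OF x(1) y(1)] m]
      by (simp add: free_act_mult)
    fix m' assume m': "m' \<in> carrier ?M"
    then have s: "m + m' \<in> carrier ?M"
      using m keys_add[of m m'] by (auto simp: chen_module_simps)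
    show "a \<odot>\<^bsub>?M\<^esub> (m \<oplus>\<^bsub>?M\<^esub> m') = a \<odot>\<^bsub>?M\<^esub> m \<oplus>\<^bsub>?M\<^esub> a \<odot>\<^bsub>?M\<^esub> m'"
      unfolding x(2) chen_module_simps(3) chen_smult[OF x(1) m] chen_smult[OF x(1) m']
      unfolding chen_smult[OF x(1) s] by (rule free_act_add_right)
  next
    fix m assume m: "m \<in> carrier ?M"
    have "(\<Sum>v\<in>verts G. word_elem [Vert v]) \<in> carrier (free_alg G :: ('a, 'b, 'k) free_elem ring)"
      by (intro sum_in_free_alg word_in_free_alg) auto
    then have "\<one>\<^bsub>?A\<^esub> \<odot>\<^bsub>?M\<^esub> m = free_act G (\<Sum>v\<in>verts G. word_elem [Vert v]) m"
      unfolding lpa_simps using m by (rule chen_smult)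
    also have "\<dots> = m"
    proof (induction m rule: poly_mapping_additive_induct)
      case (single q c)
      then have "tail G (shd q) \<in> verts G"
        using m inf_path_shd by (auto simp: chen_module_simps path_class_def)
      have "free_act G (\<Sum>v\<in>verts G. word_elem [Vert v]) (Poly_Mapping.single q c) =
          (\<Sum>v\<in>verts G. if v = tail G (shd q) then Poly_Mapping.single q c else 0)"
        unfolding free_act_sum_left by (intro sum.cong) (auto simp: free_act_word)
      also have "\<dots> = Poly_Mapping.single q c"
        using \<open>tail G (shd q) \<in> verts G\<close> by (simp add: sum.delta)
      finally show ?case .
    qed (simp_all add: free_act_add_right)
    finally show "\<one>\<^bsub>?A\<^esub> \<odot>\<^bsub>?M\<^esub> m = m" .
  qed
qed

end

section \<open>Initial segments of an infinite path\<close>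

text \<open>Each letter beyond the first \<open>length u\<close> ones is determined by the letter
  \<open>length u\<close> places before it.\<close>

lemma eq_cycle_if_eq_shift:
  assumes "u \<noteq> []" "r = u @- r"
  shows "r = cycle u"
proof -
  have "r !! i = cycle u !! i" for i
  proof (induction i rule: less_induct)
    case (less i)
    have r: "r !! i = (if i < length u then u ! i else r !! (i - length u))"
      using assms(2) by (metis shift_snth)
    have c: "cycle u !! i = (if i < length u then u ! i else cycle u !! (i - length u))"
      using Stream.cycle_decomp[OF assms(1)] by (metis shift_snth)
    show ?case
    proof (cases "i < length u")
      case False
      then have "i - length u < i" using assms(1) by (cases u) auto
      then show ?thesis unfolding r c using less by simp
    qed (simp only: r c if_True)
  qed
  then have "snth r = snth (cycle u)" by (rule ext)
  then show ?thesis by (metis stream_smap_nats)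
qed

context leavitt_algebra begin

lemma inf_path_sdrop: "inf_path G q \<Longrightarrow> inf_path G (sdrop n q)"
  by (induction n arbitrary: q) (auto intro: inf_path_stl)

lemma inf_path_arc: "inf_path G q \<Longrightarrow> q !! i \<in> arcs G"
  and inf_path_step: "inf_path G q \<Longrightarrow> head G (q !! i) = tail G (q !! Suc i)"
  by (auto simp: inf_path_def)

lemma set_stake_subset: "inf_path G q \<Longrightarrow> set (stake n q) \<subseteq> arcs G"
  by (auto simp: in_set_conv_nth inf_path_arc)

lemma edges_gens: "inf_path G q \<Longrightarrow> set (map Edge (stake n q)) \<subseteq> lpa_gens G"
  using set_stake_subset[of q n] by auto

lemma cas_stake:
  assumes "inf_path G q" shows "cas (tail G (shd q)) (stake n q) (tail G (q !! n))"
  using assms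
proof (induction n arbitrary: q)
  case (Suc n)
  then show ?case
    using inf_path_stl[OF Suc.prems] inf_path_step[OF Suc.prems, of 0] by simp
qed simp

text \<open>The place where irrationality is used. If the same tail of p began at two positions of
  q, it would be the infinite power of the segment of q between them, which is then a closed
  path.\<close>

lemma irrational_sdrop_inj:
  assumes "irrational_path G p" "inf_path G q" "sdrop j q = sdrop n p" "sdrop k q = sdrop n p"
  shows "j = k"
proof -
  have False if jk: "j < k" and "sdrop j q = sdrop n p" "sdrop k q = sdrop n p" for j k
  proof -
    define r where "r = sdrop j q"
    define c where "c = stake (k - j) r"
    have "sdrop (k - j) (sdrop j q) = sdrop k q"
      using jk by (simp add: sdrop_add)
    then have "sdrop (k - j) r = r"
      using that by (simp add: r_def)
    then have r: "r = c @- r"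
      unfolding c_def by (metis stake_sdrop)
    have c: "c \<noteq> []" using jk by (simp add: c_def)
    have path: "inf_path G r" unfolding r_def by (rule inf_path_sdrop[OF assms(2)])
    have "r !! (k - j) = shd r"
      using \<open>sdrop (k - j) r = r\<close> by (metis sdrop_simps(1))
    then have "awalk (tail G (shd r)) c (tail G (shd r))"
      unfolding awalk_def c_def
      using cas_stake[OF path, of "k - j"] set_stake_subset[OF path] inf_path_shd[OF path] by simp
    then have "closed_path G c"
      using c unfolding closed_path_def by blast
    moreover have "sdrop n p = sdrop 0 (Stream.cycle c)"
      using eq_cycle_if_eq_shift[OF c r] that by (simp add: r_def)
    then have "tail_equiv p (Stream.cycle c)" unfolding tail_equiv_def by blast
    ultimately show False
      using assms(1) unfolding irrational_path_def rational_path_def by blast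
  qed
  then show ?thesis using assms(3,4) by (metis linorder_neqE_nat)
qed

text \<open>A word for \<alpha>_n. The leading vertex keeps it non-empty for n = 0, where \<alpha>_0
  is the vertex s(p); \<open>ghost_word\<close> ends in this vertex for the same reason.\<close>

definition path_word :: "'b stream \<Rightarrow> nat \<Rightarrow> ('a, 'b) lpa_gen list" where
  "path_word p n = Vert (tail G (shd p)) # map Edge (stake n p)"

definition ghost_word :: "'b stream \<Rightarrow> nat \<Rightarrow> ('a, 'b) lpa_gen list" where
  "ghost_word p n = map Ghost (rev (stake n p)) @ [Vert (tail G (shd p))]"

definition path_proj :: "'b stream \<Rightarrow> nat \<Rightarrow> ('a, 'b, 'k) lpa_elem" where
  "path_proj p n = word_class (path_word p n @ ghost_word p n)"

lemma path_word_simps: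
  "path_word p 0 = [Vert (tail G (shd p))]"
  "path_word p (Suc n) = path_word p n @ [Edge (p !! n)]"
  "ghost_word p 0 = [Vert (tail G (shd p))]"
  "ghost_word p (Suc n) = [Ghost (p !! n)] @ ghost_word p n"
  by (simp_all add: path_word_def ghost_word_def stake_Suc del: stake.simps(2))

lemma path_word_gens:
  assumes "inf_path G p"
  shows "set (path_word p n) \<subseteq> lpa_gens G" "set (ghost_word p n) \<subseteq> lpa_gens G"
  using inf_path_shd[OF assms] inf_path_arc[OF assms]
  by (induction n) (auto simp: path_word_simps)

lemma word_class_head_cong:
  assumes "word_class u = word_class w"
    "set u \<subseteq> lpa_gens G" "set w \<subseteq> lpa_gens G" "set b \<subseteq> lpa_gens G"
  shows "word_class (u @ b) = word_class (w @ b)"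
  using word_class_context[OF assms(1-3), of "[]" b] assms(4) by simp

lemma word_class_tail_cong:
  assumes "word_class u = word_class w"
    "set u \<subseteq> lpa_gens G" "set w \<subseteq> lpa_gens G" "set a \<subseteq> lpa_gens G"
  shows "word_class (a @ u) = word_class (a @ w)"
  using word_class_context[OF assms(1-3), of a "[]"] assms(4) by simp

lemma path_word_vertex:
  assumes "inf_path G p"
  shows "word_class (path_word p n @ [Vert (tail G (p !! n))]) = word_class (path_word p n)"
proof (cases n)
  case 0
  then show ?thesis
    using lpa_relations(1)[of "tail G (shd p)"] inf_path_shd[OF assms] by (simp add: path_word_simps)
next
  case (Suc k)
  have "word_class (path_word p k @ [Edge (p !! k), Vert (head G (p !! k))]) =
      word_class (path_word p k @ [Edge (p !! k)])"
    using inf_path_arc[OF assms, of k] path_word_gens[OF assms]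
    by (intro word_class_tail_cong lpa_relations) auto
  then show ?thesis
    using Suc inf_path_step[OF assms, of k] by (simp add: path_word_simps)
qed

lemma ghost_word_vertex:
  assumes "inf_path G p"
  shows "word_class (Vert (tail G (p !! n)) # ghost_word p n) = word_class (ghost_word p n)"
proof (cases n)
  case 0
  then show ?thesis
    using lpa_relations(1)[of "tail G (shd p)"] inf_path_shd[OF assms] by (simp add: path_word_simps)
next
  case (Suc k)
  have "word_class ([Vert (head G (p !! k)), Ghost (p !! k)] @ ghost_word p k) =
      word_class ([Ghost (p !! k)] @ ghost_word p k)"
    using inf_path_arc[OF assms, of k] path_word_gens[OF assms]
    by (intro word_class_head_cong lpa_relations) auto
  then show ?thesis
    using Suc inf_path_step[OF assms, of k] by (simp add: path_word_simps)
qed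

text \<open>The inner block is reduced to a vertex first, which is absorbed before (CK1) cancels the
  outer pair.\<close>

lemma ghost_path_word:
  assumes "inf_path G p"
  shows "word_class (ghost_word p n @ path_word p n) = word_class [Vert (tail G (p !! n))]"
proof (induction n)
  case 0
  show ?case
    using lpa_relations(1)[of "tail G (shd p)"] inf_path_shd[OF assms] by (simp add: path_word_simps)
next
  case (Suc n)
  let ?e = "p !! n"
  have e: "?e \<in> arcs G" by (rule inf_path_arc[OF assms])
  note g = path_word_gens[OF assms, of n]
  have "word_class ([Ghost ?e] @ (ghost_word p n @ path_word p n) @ [Edge ?e]) =
      word_class ([Ghost ?e] @ [Vert (tail G ?e)] @ [Edge ?e])"
    using e g by (intro word_class_context Suc.IH) auto
  also have "\<dots> = word_class ([Ghost ?e] @ [Edge ?e])"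
    using e word_class_head_cong[OF lpa_relations(6)[OF e], of "[Edge ?e]"] by simp
  also have "\<dots> = word_class [Vert (head G ?e)]"
    using lpa_relations(7)[OF e] by simp
  finally show ?case
    using inf_path_step[OF assms, of n] by (simp add: path_word_simps)
qed

lemma path_proj_closed: "inf_path G p \<Longrightarrow> path_proj p n \<in> carrier L"
  unfolding path_proj_def using path_word_gens[of p n]
  by (intro word_class_closed) (auto simp: path_word_def)

lemma path_proj_mult:
  assumes "inf_path G p"
  shows "path_proj p n \<otimes>\<^bsub>L\<^esub> path_proj p n = path_proj p n"
    and "path_proj p n \<otimes>\<^bsub>L\<^esub> path_proj p (Suc n) = path_proj p (Suc n)"
    and "path_proj p (Suc n) \<otimes>\<^bsub>L\<^esub> path_proj p n = path_proj p (Suc n)"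
proof -
  let ?a = "path_word p n" and ?b = "ghost_word p n" and ?e = "p !! n"
  have e: "?e \<in> arcs G" by (rule inf_path_arc[OF assms])
  note g = path_word_gens[OF assms]
  \<comment> \<open>The identity \<alpha>_n \<alpha>_n^* \<alpha>_n = \<alpha>_n in context yields
    the first two products. The third one uses \<alpha>_n^* \<alpha>_n \<alpha>_n^* = \<alpha>_n^*
    instead.\<close>
  have reduce: "word_class (u @ ?a @ ?b @ ?a @ w) = word_class (u @ ?a @ w)"
    if "set u \<subseteq> lpa_gens G" "set w \<subseteq> lpa_gens G" for u w
  proof -
    have "word_class ((u @ ?a) @ (?b @ ?a) @ w) = word_class ((u @ ?a) @ [Vert (tail G ?e)] @ w)"
      using that g e by (intro word_class_context ghost_path_word assms) auto
    also have "\<dots> = word_class (u @ (?a @ [Vert (tail G ?e)]) @ w)" by simp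
    also have "\<dots> = word_class (u @ ?a @ w)"
      using that g e by (intro word_class_context path_word_vertex assms) auto
    finally show ?thesis by simp
  qed
  have m: "path_proj p i \<otimes>\<^bsub>L\<^esub> path_proj p j =
      word_class (path_word p i @ ghost_word p i @ path_word p j @ ghost_word p j)" for i j
    unfolding path_proj_def using g by (subst word_class_mult) auto
  show "path_proj p n \<otimes>\<^bsub>L\<^esub> path_proj p n = path_proj p n"
    unfolding m using reduce[of "[]" ?b] g by (simp add: path_proj_def)
  show "path_proj p n \<otimes>\<^bsub>L\<^esub> path_proj p (Suc n) = path_proj p (Suc n)"
    unfolding m using reduce[of "[]" "[Edge ?e] @ ghost_word p (Suc n)"] g[of "Suc n"] e
    by (simp add: path_proj_def path_word_simps)
  have "word_class ((path_word p (Suc n) @ [Ghost ?e]) @ (?b @ ?a) @ ?b) =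
      word_class ((path_word p (Suc n) @ [Ghost ?e]) @ [Vert (tail G ?e)] @ ?b)"
    using g e by (intro word_class_context ghost_path_word assms) auto
  also have "\<dots> = word_class ((path_word p (Suc n) @ [Ghost ?e]) @ Vert (tail G ?e) # ?b)" by simp
  also have "\<dots> = word_class ((path_word p (Suc n) @ [Ghost ?e]) @ ?b)"
    using g e ghost_word_vertex[OF assms, of n] by (intro word_class_tail_cong) auto
  finally show "path_proj p (Suc n) \<otimes>\<^bsub>L\<^esub> path_proj p n = path_proj p (Suc n)"
    unfolding m by (simp add: path_proj_def path_word_simps)
qed

lemma word_act_ghosts: "word_act G (map Ghost (rev (stake n p))) p = Some (sdrop n p)"
proof (induction n)
  case (Suc n)
  have "word_act G (map Ghost (rev (stake (Suc n) p))) p = gen_act G (Ghost (p !! n)) (sdrop n p)"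
    using Suc by (simp add: stake_Suc del: stake.simps(2) gen_act.simps)
  also have "\<dots> = Some (sdrop (Suc n) p)"
    by (simp add: sdrop_simps del: sdrop.simps(2))
  finally show ?case .
qed simp

lemma word_act_edges:
  assumes "inf_path G q" shows "word_act G (map Edge (stake n q)) (sdrop n q) = Some q"
  using assms
proof (induction n arbitrary: q)
  case (Suc n)
  then show ?case
    using inf_path_stl[OF Suc.prems] inf_path_step[OF Suc.prems, of 0] by simp
qed simp

lemma word_act_path_proj:
  assumes "inf_path G p"
  shows "word_act G (path_word p n @ ghost_word p n) p = Some p"
proof -
  have "word_act G (map Edge (stake n p)) (sdrop n p) = Some p"
    by (rule word_act_edges[OF assms])
  then show ?thesis
    unfolding path_word_def ghost_word_def by (simp add: word_act_append word_act_ghosts)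
qed

section \<open>The annihilator of an irrational path\<close>

text \<open>Inserting s(e) before e, or r(f) after f, brings two distinct vertices next to each
  other.\<close>

lemma nonadjacent_zero:
  assumes "e \<in> arcs G"
  shows "v \<in> verts G \<Longrightarrow> v \<noteq> tail G e \<Longrightarrow> word_class [Vert v, Edge e] = \<zero>\<^bsub>L\<^esub>"
    and "f \<in> arcs G \<Longrightarrow> head G f \<noteq> tail G e \<Longrightarrow> word_class [Edge f, Edge e] = \<zero>\<^bsub>L\<^esub>"
proof -
  show *: "word_class [Vert v, Edge e] = \<zero>\<^bsub>L\<^esub>"
    if "v \<in> verts G" "v \<noteq> tail G e" for v
  proof -
    have "word_class ([Vert v] @ [Edge e]) = word_class ([Vert v] @ [Vert (tail G e), Edge e])"
      using assms that by (intro word_class_tail_cong lpa_relations(3)[symmetric]) auto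
    also have "\<dots> = word_class ([] @ [Vert v, Vert (tail G e)] @ [Edge e])" by simp
    also have "\<dots> = \<zero>\<^bsub>L\<^esub>"
      using assms that by (intro word_class_zero_context lpa_relations(2)) auto
    finally show ?thesis by simp
  qed
  show "word_class [Edge f, Edge e] = \<zero>\<^bsub>L\<^esub>"
    if "f \<in> arcs G" "head G f \<noteq> tail G e"
  proof -
    have "word_class ([Edge f] @ [Edge e]) = word_class ([Edge f, Vert (head G f)] @ [Edge e])"
      using assms that by (intro word_class_head_cong lpa_relations(4)[symmetric]) auto
    also have "\<dots> = word_class ([Edge f] @ [Vert (head G f), Edge e] @ [])" by simp
    also have "\<dots> = \<zero>\<^bsub>L\<^esub>"
      using assms that by (intro word_class_zero_context *) auto
    finally show ?thesis by simp
  qed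
qed

text \<open>A generator multiplies an initial segment of q exactly as it acts on q, and shortens it
  by at most one edge. Two edges are required because a ghost removes the first one and leaves a
  vertex that the second has to absorb.\<close>

lemma gen_times_path:
  assumes g: "g \<in> lpa_gens G" and q: "inf_path G q" and j: "2 \<le> j"
  shows "gen_act G g q = None \<Longrightarrow>
      word_class (g # map Edge (stake j q)) = \<zero>\<^bsub>L\<^esub>"
    and "gen_act G g q = Some q' \<Longrightarrow> \<exists>i. j \<le> Suc i \<and> sdrop i q' = sdrop j q \<and>
      word_class (g # map Edge (stake j q)) = word_class (map Edge (stake i q'))"
proof -
  obtain i where i: "j = Suc (Suc i)" using j by (metis Suc_le_D numeral_2_eq_2 Suc_le_mono)
  let ?e = "shd q" and ?q = "stl q"
  have e: "?e \<in> arcs G" "shd ?q \<in> arcs G" "inf_path G ?q"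
    using inf_path_shd inf_path_stl q by auto
  have h: "head G ?e = tail G (shd ?q)" using inf_path_step[OF q, of 0] by simp
  have s: "map Edge (stake j q) = [Edge ?e] @ map Edge (stake (Suc i) ?q)"
    "map Edge (stake j q) = [Edge ?e, Edge (shd ?q)] @ map Edge (stake i (stl ?q))"
    by (simp_all add: i)
  have gens: "set (map Edge (stake n ?q)) \<subseteq> lpa_gens G" "set (map Edge (stake n (stl ?q))) \<subseteq> lpa_gens G" for n
    by (rule edges_gens[OF e(3)], rule edges_gens[OF inf_path_stl[OF e(3)]])
  have zero: "word_class (g # map Edge (stake j q)) = \<zero>\<^bsub>L\<^esub>"
    if "word_class [g, Edge ?e] = \<zero>\<^bsub>L\<^esub>"
    using word_class_zero_context[OF that, of "[]" "map Edge (stake (Suc i) ?q)"] g e gens[of "Suc i"]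
    by (simp add: s(1) del: stake.simps(2))
  show "word_class (g # map Edge (stake j q)) = \<zero>\<^bsub>L\<^esub>"
    if "gen_act G g q = None"
    using that g e
    by (intro zero) (cases g; auto simp: nonadjacent_zero[OF e(1)] lpa_relations(8) split: if_splits)
  show "\<exists>i. j \<le> Suc i \<and> sdrop i q' = sdrop j q \<and>
      word_class (g # map Edge (stake j q)) = word_class (map Edge (stake i q'))"
    if act: "gen_act G g q = Some q'"
  proof (cases g)
    case (Vert v)
    then have v: "v = tail G ?e" "q' = q" using act by (auto split: if_splits)
    have "word_class ([Vert v, Edge ?e] @ map Edge (stake (Suc i) ?q)) =
        word_class ([Edge ?e] @ map Edge (stake (Suc i) ?q))"
      using e gens[of "Suc i"] unfolding v by (intro word_class_head_cong lpa_relations(3)) auto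
    then show ?thesis
      using v Vert by (intro exI[of _ j]) (simp add: s(1) del: stake.simps(2))
  next
    case (Edge f)
    then have "q' = f ## q" using act by (auto split: if_splits)
    then show ?thesis
      using Edge by (intro exI[of _ "Suc j"]) simp
  next
    case (Ghost f)
    then have f: "f = ?e" "q' = ?q" using act by (auto split: if_splits)
    have "word_class ([Ghost ?e, Edge ?e] @ map Edge (stake (Suc i) ?q)) =
        word_class ([Vert (head G ?e)] @ map Edge (stake (Suc i) ?q))"
      using e gens[of "Suc i"] by (intro word_class_head_cong lpa_relations(7)) auto
    also have "\<dots> = word_class ([Vert (tail G (shd ?q)), Edge (shd ?q)] @ map Edge (stake i (stl ?q)))"
      by (simp add: h)
    also have "\<dots> = word_class ([Edge (shd ?q)] @ map Edge (stake i (stl ?q)))"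
      using e gens(2)[of i] by (intro word_class_head_cong lpa_relations(3)) auto
    finally show ?thesis
      using f Ghost by (intro exI[of _ "Suc i"]) (simp add: i)
  qed
qed

text \<open>Each letter of \<open>w\<close> uses up at most one edge. Since \<open>w\<close> is
  shorter than n, at least two edges remain whenever a further letter is applied, as
  \<open>gen_times_path\<close> demands.\<close>

lemma word_times_path:
  assumes p: "inf_path G p"
  shows "set w \<subseteq> lpa_gens G \<Longrightarrow> length w < n \<Longrightarrow>
    (word_act G w p = None \<longrightarrow> word_class (w @ map Edge (stake n p)) = \<zero>\<^bsub>L\<^esub>) \<and>
    (\<forall>q. word_act G w p = Some q \<longrightarrow> (\<exists>j. n \<le> j + length w \<and> sdrop j q = sdrop n p \<and>
      word_class (w @ map Edge (stake n p)) = word_class (map Edge (stake j q))))"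
proof (induction w)
  case Nil
  show ?case by auto
next
  case (Cons g w)
  have gens: "set w \<subseteq> lpa_gens G" "g \<in> lpa_gens G" "set (map Edge (stake n p)) \<subseteq> lpa_gens G"
    using Cons.prems edges_gens[OF p, of n] by simp_all
  show ?case
  proof (cases "word_act G w p")
    case None
    then have "word_class (w @ map Edge (stake n p)) = \<zero>\<^bsub>L\<^esub>"
      using Cons by simp
    then have "word_class ([g] @ (w @ map Edge (stake n p)) @ []) = \<zero>\<^bsub>L\<^esub>"
      using gens by (intro word_class_zero_context) auto
    then show ?thesis using None by simp
  next
    case (Some q)
    then obtain j where j: "n \<le> j + length w" "sdrop j q = sdrop n p"
      "word_class (w @ map Edge (stake n p)) = word_class (map Edge (stake j q))"
      using Cons by auto
    have "p \<in> path_class G p" unfolding path_class_def tail_equiv_def using p by blast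
    then have q: "inf_path G q"
      using word_act_path_class[OF gens(1) _ Some, of p] by (simp add: path_class_def)
    have j2: "2 \<le> j" using j(1) Cons.prems(2) by simp
    have "set (map Edge (stake j q)) \<subseteq> lpa_gens G" by (rule edges_gens[OF q])
    then have eq: "word_class ([g] @ (w @ map Edge (stake n p))) =
        word_class ([g] @ map Edge (stake j q))"
      using gens by (intro word_class_tail_cong j(3)) auto
    note g = gen_times_path[OF gens(2) q j2]
    show ?thesis
    proof (intro conjI impI allI)
      assume "word_act G (g # w) p = None"
      then show "word_class ((g # w) @ map Edge (stake n p)) = \<zero>\<^bsub>L\<^esub>"
        using eq g(1) Some by simp
    next
      fix q' assume "word_act G (g # w) p = Some q'"
      then have "gen_act G g q = Some q'" using Some by simp
      from g(2)[OF this] obtain i where "j \<le> Suc i" "sdrop i q' = sdrop j q"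
        "word_class (g # map Edge (stake j q)) = word_class (map Edge (stake i q'))"
        by blast
      then show "\<exists>j. n \<le> j + length (g # w) \<and> sdrop j q' = sdrop n p \<and>
          word_class ((g # w) @ map Edge (stake n p)) = word_class (map Edge (stake j q'))"
        using j eq by (intro exI[of _ i]) simp
    qed
  qed
qed

lemma self_in_path_class: "inf_path G p \<Longrightarrow> p \<in> path_class G p"
  unfolding path_class_def tail_equiv_def by blast

lemma ideal_sum:
  assumes "\<And>i. i \<in> I \<Longrightarrow> f i \<in> lpa_ideal G"
  shows "sum f I \<in> lpa_ideal G"
  using assms
proof (induction I rule: infinite_finite_induct)
  case (insert i I)
  interpret I: ideal "lpa_ideal G" "free_alg G" by (rule ideal_lpa)
  show ?case
    using insert additive_subgroup.a_closed[OF I.additive_subgroup_axioms, of "f i" "sum f I"] by simp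
qed (use additive_subgroup.zero_closed[OF ideal.axioms(1)[OF ideal_lpa]] in \<open>simp_all add: free_alg_simps\<close>)

lemma smult_in_ideal:
  assumes "x \<in> lpa_ideal G"
  shows "Poly_Mapping.single 0 k * x \<in> lpa_ideal G"
proof -
  interpret I: ideal "lpa_ideal G" "free_alg G" by (rule ideal_lpa)
  show ?thesis
    using I.I_l_closed[OF assms single_in_free_alg, of 0 k] by simp
qed

text \<open>
  For large \<open>N\<close> every monomial \<open>w\<close> with \<open>w p = q\<close> satisfies \<open>w e\<^sub>1 \<dots> e\<^sub>N = f\<^sub>1 \<dots> f\<^sub>j\<close>, where
  \<open>f\<^sub>1 \<dots> f\<^sub>j\<close> is an initial segment of \<open>q\<close>. As \<open>p\<close> is irrational, its length \<open>j\<close> depends on \<open>q\<close>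
  and \<open>N\<close> only, so cancellation in \<open>x p = 0\<close> already takes place in \<open>x e\<^sub>1 \<dots> e\<^sub>N\<close>.
\<close>

lemma annihilates_initial_segment:
  fixes x :: "('a, 'b, 'k) free_elem"
  assumes p: "irrational_path G p" and x: "x \<in> carrier (free_alg G)"
    and zero: "free_act G x (Poly_Mapping.single p 1) = 0"
  shows "\<exists>n>0. x * word_elem (map Edge (stake n p)) \<in> lpa_ideal G"
proof -
  have path: "inf_path G p" using p by (simp add: irrational_path_def)
  let ?K = "Poly_Mapping.keys x"
  \<comment> \<open>Exceeds the length of every monomial of \<open>x\<close>; the inserted 0 keeps
    the maximum defined for x = 0.\<close>
  define N where "N = Suc (Max (insert 0 ((\<lambda>w. length (letters w)) ` ?K)))"
  have N: "length (letters w) < N" if "w \<in> ?K" for w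
    using that by (auto simp: N_def less_Suc_eq_le)
  let ?E = "map Edge (stake N p)"
  \<comment> \<open>Unique by irrationality, and independent of the monomial that leads from p to
    q.\<close>
  define J where "J q = (THE j. sdrop j q = sdrop N p)" for q
  define P :: "'b stream \<Rightarrow> ('a, 'b) lpa_gen fword" where "P q = FWord (map Edge (stake (J q) q))"
    for q :: "'b stream"
  have gens: "set (letters w) \<subseteq> lpa_gens G" if "w \<in> ?K" for w
    using that x by (simp add: carrier_free_alg)
  have q_path: "inf_path G q" if "w \<in> ?K" "word_act G (letters w) p = Some q" for w q
    using word_act_path_class[OF gens[OF that(1)] self_in_path_class[OF path] that(2)]
    by (simp add: path_class_def)
  \<comment> \<open>The path to which the term of \<open>w\<close> reduces after multiplication by
    e_1 ... e_N, with its coefficient, or 0 if \<open>w\<close> kills p.\<close>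
  define r where "r w = (case word_act G (letters w) p of None \<Rightarrow> 0
    | Some q \<Rightarrow> Poly_Mapping.single (P q) (Poly_Mapping.lookup x w))" for w
  have r_ideal: "Poly_Mapping.single w (Poly_Mapping.lookup x w) * word_elem ?E - r w \<in> lpa_ideal G"
    if w: "w \<in> ?K" for w
  proof -
    let ?c = "Poly_Mapping.lookup x w"
    have wE: "word_elem (letters w @ ?E) \<in> (carrier (free_alg G) :: ('a, 'b, 'k) free_elem set)"
      using gens[OF w] edges_gens[OF path, of N] by (intro word_in_free_alg) simp
    have s: "Poly_Mapping.single w ?c * word_elem ?E =
        Poly_Mapping.single 0 ?c * word_elem (letters w @ ?E)"
      by (simp add: mult_single plus_fword_def zero_fword_def)
    note t = word_times_path[OF path gens[OF w] N[OF w]]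
    show ?thesis
    proof (cases "word_act G (letters w) p")
      case None
      then have "word_class (letters w @ ?E) = \<zero>\<^bsub>L\<^esub>"
        using t by blast
      then have "word_elem (letters w @ ?E) \<in> (lpa_ideal G :: ('a, 'b, 'k) free_elem set)"
        using class_eq_zero_iff[OF wE] unfolding word_class_def by blast
      then show ?thesis
        using None by (simp add: s r_def smult_in_ideal)
    next
      case (Some q)
      obtain j where j: "sdrop j q = sdrop N p"
        "word_class (letters w @ ?E) = word_class (map Edge (stake j q))"
        using t Some by blast
      have q: "inf_path G q" by (rule q_path[OF w Some])
      have "J q = j"
        unfolding J_def using j(1) irrational_sdrop_inj[OF p q] by blast
      then have Pq: "P q = FWord (map Edge (stake j q))" by (simp add: P_def)
      have "word_elem (letters w @ ?E) - word_elem (map Edge (stake j q)) \<in> (lpa_ideal G :: ('a, 'b, 'k) free_elem set)"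
        using class_eq_iff[OF wE word_in_free_alg[OF edges_gens[OF q]]] j(2)
        unfolding word_class_def by blast
      note smult_in_ideal[OF this, of ?c]
      moreover have "Poly_Mapping.single 0 ?c * word_elem (map Edge (stake j q)) = r w"
        by (simp add: r_def Some Pq mult_single)
      ultimately show ?thesis by (simp only: s right_diff_distrib)
    qed
  qed
  define Q where "Q = {q. \<exists>w\<in>?K. word_act G (letters w) p = Some q}"
  have "Q \<subseteq> (\<lambda>w. the (word_act G (letters w) p)) ` ?K"
    by (force simp: Q_def)
  then have Q: "finite Q" by (rule finite_subset) simp
  \<comment> \<open>The linear extension of q \<mapsto> P q on the finitely many paths that occur.
    It carries x p = 0 over to the free algebra, where it says that the reduced terms
    \<open>r w\<close> add up to 0.\<close>
  define lin where "lin m = (\<Sum>q\<in>Q. Poly_Mapping.single (P q) (Poly_Mapping.lookup m q))"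
    for m :: "'b stream \<Rightarrow>\<^sub>0 'k"
  have lin_add: "lin (m + m') = lin m + lin m'" and lin_zero: "lin 0 = 0" for m m'
    by (simp_all add: lin_def lookup_add single_add sum.distrib)
  have lin_sum: "lin (sum f A) = (\<Sum>a\<in>A. lin (f a))" for f :: "('a, 'b) lpa_gen fword \<Rightarrow> _" and A
    by (induction A rule: infinite_finite_induct) (simp_all add: lin_add lin_zero)
  have lin_single: "lin (Poly_Mapping.single q c) = Poly_Mapping.single (P q) c" if "q \<in> Q" for q c
  proof -
    have "lin (Poly_Mapping.single q c) = (\<Sum>q'\<in>Q. if q = q' then Poly_Mapping.single (P q) c else 0)"
      unfolding lin_def by (intro sum.cong) (auto simp: lookup_single when_def)
    then show ?thesis using Q that by simp
  qed
  have "free_act G x (Poly_Mapping.single p 1) =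
      (\<Sum>w\<in>?K. act_single G w p (Poly_Mapping.lookup x w))"
    by (subst free_act_eq_sum[of ?K _ "{p}"]) simp_all
  then have "0 = (\<Sum>w\<in>?K. lin (act_single G w p (Poly_Mapping.lookup x w)))"
    using zero lin_zero lin_sum by metis
  also have "\<dots> = (\<Sum>w\<in>?K. r w)"
  proof (rule sum.cong[OF refl])
    fix w assume "w \<in> ?K"
    then show "lin (act_single G w p (Poly_Mapping.lookup x w)) = r w"
      using lin_single lin_zero by (auto simp: act_single_def r_def Q_def split: option.split)
  qed
  \<comment> \<open>As the terms \<open>r w\<close> cancel, subtracting them changes nothing, and
    every remaining difference lies in the ideal.\<close>
  finally have "x * word_elem ?E =
      (\<Sum>w\<in>?K. Poly_Mapping.single w (Poly_Mapping.lookup x w) * word_elem ?E - r w)"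
    by (subst (1) poly_mapping_sum_single[of x, symmetric]) (simp add: sum_distrib_right sum_subtractf)
  then have "x * word_elem ?E \<in> lpa_ideal G"
    using ideal_sum[OF r_ideal] by simp
  then show ?thesis by (intro exI[of _ N]) (simp add: N_def)
qed

lemma path_proj_fixes:
  assumes "inf_path G p"
  shows "path_proj p n \<odot>\<^bsub>chen_module G p\<^esub> (Poly_Mapping.single p c :: 'b stream \<Rightarrow>\<^sub>0 'k) = Poly_Mapping.single p c"
  unfolding path_proj_def using path_word_gens[OF assms]
  by (subst word_smult_single) (auto simp: self_in_path_class assms word_act_path_proj)

text \<open>If x kills p, then x \<alpha>_n = 0 for some n, hence x \<pi>_n = 0. The converse holds
  since \<pi>_n fixes p.\<close>

lemma annihilator_irrational:
  assumes R: "ring L"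
    and p: "irrational_path G p" and X: "X \<in> carrier L"
  shows "X \<odot>\<^bsub>chen_module G p\<^esub> Poly_Mapping.single p 1 = \<zero>\<^bsub>chen_module G p\<^esub> \<longleftrightarrow>
    (\<exists>n. X \<otimes>\<^bsub>L\<^esub> path_proj p n = \<zero>\<^bsub>L\<^esub>)"
proof -
  interpret M: left_module L "chen_module G p"
    by (rule left_module_chen[OF R])
  have path: "inf_path G p" using p by (simp add: irrational_path_def)
  have pM: "Poly_Mapping.single p 1 \<in> carrier (chen_module G p)"
    using self_in_path_class[OF path] by (simp add: chen_module_simps)
  obtain x where x: "x \<in> carrier (free_alg G)" "X = lpa_class G x"
    using X by (rule carrier_lpaE)
  show ?thesis
  proof
    assume "X \<odot>\<^bsub>chen_module G p\<^esub> Poly_Mapping.single p 1 = \<zero>\<^bsub>chen_module G p\<^esub>"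
    then have "free_act G x (Poly_Mapping.single p 1) = 0"
      unfolding x(2) chen_smult[OF x(1) pM] by (simp add: chen_module_simps)
    from annihilates_initial_segment[OF p x(1) this] obtain n where
      n: "n > 0" "x * word_elem (map Edge (stake n p)) \<in> lpa_ideal G" by blast
    let ?E = "map Edge (stake n p)"
    obtain i where i: "n = Suc i" using n(1) by (cases n) auto
    note g = path_word_gens[OF path, of n] edges_gens[OF path, of n]
    have e: "shd p \<in> arcs G" by (rule inf_path_shd[OF path])
    \<comment> \<open>For n > 0 the first edge absorbs the leading vertex, so \<pi>_n is the edge
      word, known to be killed by X from the left, times the ghost word.\<close>
    have "path_proj p n = word_class ([Vert (tail G (shd p)), Edge (shd p)] @ map Edge (stake i (stl p)) @ ghost_word p n)"
      by (simp add: path_proj_def path_word_def i)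
    also have "\<dots> = word_class ([Edge (shd p)] @ map Edge (stake i (stl p)) @ ghost_word p n)"
    proof -
      have "set (map Edge (stake i (stl p)) @ ghost_word p n) \<subseteq> lpa_gens G"
        using g(2) edges_gens[OF inf_path_stl[OF path], of i] by (simp only: set_append Un_least)
      then show ?thesis using e by (intro word_class_head_cong lpa_relations(3)) simp_all
    qed
    also have "\<dots> = word_class (?E @ ghost_word p n)" by (simp add: i)
    also have "\<dots> = word_class ?E \<otimes>\<^bsub>L\<^esub> word_class (ghost_word p n)"
      by (rule word_class_mult[symmetric, OF g(3,2)])
    finally have pi: "path_proj p n = word_class ?E \<otimes>\<^bsub>L\<^esub> word_class (ghost_word p n)" .
    have c: "word_class ?E \<in> carrier L"
      "word_class (ghost_word p n) \<in> carrier L"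
      by (rule word_class_closed[OF g(3)], simp add: i) (rule word_class_closed[OF g(2)], simp add: ghost_word_def)
    have "X \<otimes>\<^bsub>L\<^esub> word_class ?E = \<zero>\<^bsub>L\<^esub>"
      unfolding x(2) word_class_def class_mult[OF x(1) word_in_free_alg[OF g(3)]]
      using n(2) by (subst class_eq_zero_iff) (intro free_alg_closed x(1) word_in_free_alg g(3))+
    then have "X \<otimes>\<^bsub>L\<^esub> path_proj p n = \<zero>\<^bsub>L\<^esub>"
      unfolding pi using M.R.m_assoc[OF X c] c by simp
    then show "\<exists>n. X \<otimes>\<^bsub>L\<^esub> path_proj p n = \<zero>\<^bsub>L\<^esub>" by blast
  next
    assume "\<exists>n. X \<otimes>\<^bsub>L\<^esub> path_proj p n = \<zero>\<^bsub>L\<^esub>"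
    then obtain n where n: "X \<otimes>\<^bsub>L\<^esub> path_proj p n = \<zero>\<^bsub>L\<^esub>" by blast
    have "X \<odot>\<^bsub>chen_module G p\<^esub> (path_proj p n \<odot>\<^bsub>chen_module G p\<^esub> Poly_Mapping.single p 1) =
        \<zero>\<^bsub>chen_module G p\<^esub>"
      using M.smult_assoc[OF X path_proj_closed[OF path] pM, of n] n M.smult_zero_left[OF pM] by simp
    then show "X \<odot>\<^bsub>chen_module G p\<^esub> Poly_Mapping.single p 1 = \<zero>\<^bsub>chen_module G p\<^esub>"
      by (simp only: path_proj_fixes[OF path])
  qed
qed

lemma path_generates:
  assumes path: "inf_path G p" and m: "m \<in> carrier (chen_module G p)"
  shows "\<exists>X\<in>carrier L. X \<odot>\<^bsub>chen_module G p\<^esub> Poly_Mapping.single p 1 = (m :: 'b stream \<Rightarrow>\<^sub>0 'k)"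
proof -
  have pM: "Poly_Mapping.single p (1 :: 'k) \<in> carrier (chen_module G p)"
    using self_in_path_class[OF path] by (simp add: chen_module_simps)
  have "\<exists>x\<in>carrier (free_alg G). Poly_Mapping.lookup x 0 = 0 \<and> free_act G x (Poly_Mapping.single p 1) = m"
  proof (induction m rule: poly_mapping_additive_induct)
    case zero
    show ?case by (intro bexI[of _ 0]) (simp_all add: zero_in_free_alg)
  next
    case (single q c)
    then have q: "q \<in> path_class G p" using m by (auto simp: chen_module_simps)
    then have qp: "inf_path G q" by (simp add: path_class_def)
    obtain i j where ij: "sdrop i p = sdrop j q" using q by (auto simp: path_class_def tail_equiv_def)
    \<comment> \<open>Strip the first i edges from p and put the first j edges of q in front of the
      common tail. The vertex keeps the word non-empty for i = j = 0.\<close>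
    let ?w = "Vert (tail G (shd q)) # map Edge (stake j q) @ map Ghost (rev (stake i p))"
    have "word_act G ?w p = Some q"
      using word_act_edges[OF qp, of j] by (simp add: word_act_append word_act_ghosts ij)
    moreover have "Poly_Mapping.single (FWord ?w) c \<in> carrier (free_alg G)"
      using inf_path_shd[OF qp] set_stake_subset[OF qp, of j] set_stake_subset[OF path, of i]
      by (intro single_in_free_alg) auto
    ultimately show ?case
      by (intro bexI[of _ "Poly_Mapping.single (FWord ?w) c"])
         (auto simp: free_act_single act_single_def lookup_single zero_fword_def when_def)
  next
    case (add y z)
    then obtain x x' where "x \<in> carrier (free_alg G)" "Poly_Mapping.lookup x 0 = 0"
      "free_act G x (Poly_Mapping.single p 1) = y" "x' \<in> carrier (free_alg G)"
      "Poly_Mapping.lookup x' 0 = 0" "free_act G x' (Poly_Mapping.single p 1) = z" by blast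
    then show ?case
      by (intro bexI[of _ "x + x'"]) (auto simp: lookup_add free_act_add_left intro: free_alg_closed)
  qed
  then obtain x where "x \<in> carrier (free_alg G)" "Poly_Mapping.lookup x 0 = 0"
    "free_act G x (Poly_Mapping.single p 1) = m" by blast
  then show ?thesis
    using chen_smult[OF _ pM] class_in_carrier by blast
qed

end

section \<open>Scalars\<close>

lemma single_zero_commute:
  fixes y :: "('v, 'e, 'k::field) free_elem"
  shows "Poly_Mapping.single 0 k * y = y * Poly_Mapping.single 0 k"
  by (induction y rule: poly_mapping_additive_induct)
     (simp_all add: mult_single mult.commute distrib_left distrib_right)

context leavitt_algebra begin

lemma one_in_free_alg:
  "(\<Sum>v\<in>verts G. word_elem [Vert v]) \<in> (carrier (free_alg G) :: ('a, 'b, 'k) free_elem set)"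
  by (intro sum_in_free_alg word_in_free_alg) auto

lemma scalar_in_free_alg: "Poly_Mapping.single 0 k \<in> carrier (free_alg G)"
  by (rule single_in_free_alg) simp

lemma lpa_scalar_eq:
  fixes k :: 'k
  shows "k \<odot>\<^bsub>L\<^esub> \<one>\<^bsub>L\<^esub> =
    lpa_class G (Poly_Mapping.single 0 k * (\<Sum>v\<in>verts G. word_elem [Vert v]))"
  unfolding lpa_simps by (rule class_smult[OF one_in_free_alg])

lemma lpa_scalar_closed: "k \<odot>\<^bsub>L\<^esub> \<one>\<^bsub>L\<^esub> \<in> carrier L"
  unfolding lpa_scalar_eq
proof (rule class_in_carrier)
  show "Poly_Mapping.single 0 k * (\<Sum>v\<in>verts G. word_elem [Vert v]) \<in> carrier (free_alg G)"
    by (intro free_alg_closed scalar_in_free_alg one_in_free_alg)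
  show "Poly_Mapping.lookup (Poly_Mapping.single 0 k * (\<Sum>v\<in>verts G. word_elem [Vert v])) 0 = 0"
    by (simp add: sum_distrib_left mult_single lookup_sum lookup_single zero_fword_def plus_fword_def when_def)
qed

context
  assumes R: "ring L"
begin

interpretation R: ring L
  by (rule R)

lemma lpa_scalar_mult:
  assumes "X \<in> carrier L"
  shows "(k \<odot>\<^bsub>L\<^esub> \<one>\<^bsub>L\<^esub>) \<otimes>\<^bsub>L\<^esub> X = k \<odot>\<^bsub>L\<^esub> X"
    and "X \<otimes>\<^bsub>L\<^esub> (k \<odot>\<^bsub>L\<^esub> \<one>\<^bsub>L\<^esub>) = k \<odot>\<^bsub>L\<^esub> X"
proof -
  let ?u = "\<Sum>v\<in>verts G. word_elem [Vert v] :: ('a, 'b, 'k) free_elem"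
  let ?k = "Poly_Mapping.single 0 k :: ('a, 'b, 'k) free_elem"
  obtain x where x: "x \<in> carrier (free_alg G)" "X = lpa_class G x"
    using assms by (rule carrier_lpaE)
  note u = one_in_free_alg and k = scalar_in_free_alg[of k]
  have "(k \<odot>\<^bsub>L\<^esub> \<one>\<^bsub>L\<^esub>) \<otimes>\<^bsub>L\<^esub> X = lpa_class G (?k * (?u * x))"
    unfolding lpa_scalar_eq x(2) class_mult[OF free_alg_closed(2)[OF k u] x(1)] by (simp add: mult.assoc)
  also have "\<dots> = k \<odot>\<^bsub>L\<^esub> (\<one>\<^bsub>L\<^esub> \<otimes>\<^bsub>L\<^esub> X)"
    unfolding lpa_simps x(2) class_mult[OF u x(1)] class_smult[OF free_alg_closed(2)[OF u x(1)]] by (rule refl)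
  finally show "(k \<odot>\<^bsub>L\<^esub> \<one>\<^bsub>L\<^esub>) \<otimes>\<^bsub>L\<^esub> X = k \<odot>\<^bsub>L\<^esub> X"
    using assms by simp
  have "X \<otimes>\<^bsub>L\<^esub> (k \<odot>\<^bsub>L\<^esub> \<one>\<^bsub>L\<^esub>) = lpa_class G (?k * (x * ?u))"
    unfolding lpa_scalar_eq x(2) class_mult[OF x(1) free_alg_closed(2)[OF k u]]
    by (simp only: mult.assoc[symmetric] single_zero_commute[of k x])
  also have "\<dots> = k \<odot>\<^bsub>L\<^esub> (X \<otimes>\<^bsub>L\<^esub> \<one>\<^bsub>L\<^esub>)"
    unfolding lpa_simps x(2) class_mult[OF x(1) u] class_smult[OF free_alg_closed(2)[OF x(1) u]] by (rule refl)
  finally show "X \<otimes>\<^bsub>L\<^esub> (k \<odot>\<^bsub>L\<^esub> \<one>\<^bsub>L\<^esub>) = k \<odot>\<^bsub>L\<^esub> X"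
    using assms by simp
qed

lemma lpa_algebra_modules:
  assumes "left_module L M" "left_module L N"
  shows "algebra_modules L M N"
proof (intro algebra_modules.intro algebra_modules_axioms.intro assms)
  let ?A = L
  note u = one_in_free_alg
  fix k l :: 'k
  show c: "k \<odot>\<^bsub>?A\<^esub> \<one>\<^bsub>?A\<^esub> \<in> carrier ?A" for k by (rule lpa_scalar_closed)
  show "(k \<odot>\<^bsub>?A\<^esub> \<one>\<^bsub>?A\<^esub>) \<otimes>\<^bsub>?A\<^esub> a = a \<otimes>\<^bsub>?A\<^esub> (k \<odot>\<^bsub>?A\<^esub> \<one>\<^bsub>?A\<^esub>)" if "a \<in> carrier ?A" for a
    using lpa_scalar_mult[OF that] by simp
  show "(k + l) \<odot>\<^bsub>?A\<^esub> \<one>\<^bsub>?A\<^esub> = k \<odot>\<^bsub>?A\<^esub> \<one>\<^bsub>?A\<^esub> \<oplus>\<^bsub>?A\<^esub> l \<odot>\<^bsub>?A\<^esub> \<one>\<^bsub>?A\<^esub>"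
    unfolding lpa_scalar_eq
      class_add[OF free_alg_closed(2)[OF scalar_in_free_alg u] free_alg_closed(2)[OF scalar_in_free_alg u]]
    by (simp add: single_add distrib_right)
  show "(k * l) \<odot>\<^bsub>?A\<^esub> \<one>\<^bsub>?A\<^esub> = (k \<odot>\<^bsub>?A\<^esub> \<one>\<^bsub>?A\<^esub>) \<otimes>\<^bsub>?A\<^esub> (l \<odot>\<^bsub>?A\<^esub> \<one>\<^bsub>?A\<^esub>)"
  proof -
    have "(k \<odot>\<^bsub>?A\<^esub> \<one>\<^bsub>?A\<^esub>) \<otimes>\<^bsub>?A\<^esub> (l \<odot>\<^bsub>?A\<^esub> \<one>\<^bsub>?A\<^esub>) = k \<odot>\<^bsub>?A\<^esub> (l \<odot>\<^bsub>?A\<^esub> \<one>\<^bsub>?A\<^esub>)"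
      by (rule lpa_scalar_mult(1)[OF c])
    also have "\<dots> = (k * l) \<odot>\<^bsub>?A\<^esub> \<one>\<^bsub>?A\<^esub>"
      unfolding lpa_scalar_eq class_smult[OF free_alg_closed(2)[OF scalar_in_free_alg u]]
      by (simp only: mult_single mult.assoc[symmetric] add_0)
    finally show ?thesis by (rule sym)
  qed
  show "1 \<odot>\<^bsub>?A\<^esub> \<one>\<^bsub>?A\<^esub> = \<one>\<^bsub>?A\<^esub>"
    unfolding lpa_scalar_eq by (simp add: lpa_simps single_one)
qed

end

section \<open>Chen simple modules\<close>

lemma word_act_ghosts_eq:
  "word_act G (map Ghost (rev (stake n p))) r =
    (if stake n r = stake n p then Some (sdrop n r) else None)"
proof (induction n)
  case (Suc n)
  have "word_act G (map Ghost (rev (stake (Suc n) p))) r =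
      Option.bind (if stake n r = stake n p then Some (sdrop n r) else None) (gen_act G (Ghost (p !! n)))"
    using Suc by (simp add: stake_Suc del: stake.simps(2) gen_act.simps)
  also have "\<dots> = (if stake (Suc n) r = stake (Suc n) p then Some (sdrop (Suc n) r) else None)"
    by (auto simp: stake_Suc sdrop_simps simp del: stake.simps(2) sdrop.simps(2))
  finally show ?case .
qed simp

text \<open>\<pi>_n fixes the basis paths that begin with e_1 ... e_n and kills the others. Thus p
  is always fixed, and any other path is killed once n passes a position where it differs from
  p.\<close>

lemma path_proj_stable_single:
  assumes p: "inf_path G p" and r: "r \<in> path_class G q"
  shows "\<exists>m. \<forall>n\<ge>m. path_proj p n \<odot>\<^bsub>chen_module G q\<^esub> (Poly_Mapping.single r c :: 'b stream \<Rightarrow>\<^sub>0 'k) =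
    path_proj p (Suc n) \<odot>\<^bsub>chen_module G q\<^esub> Poly_Mapping.single r c"
proof -
  have act: "path_proj p n \<odot>\<^bsub>chen_module G q\<^esub> (Poly_Mapping.single r c :: 'b stream \<Rightarrow>\<^sub>0 'k) =
      (case word_act G (path_word p n @ ghost_word p n) r of None \<Rightarrow> 0 | Some q' \<Rightarrow> Poly_Mapping.single q' c)" for n
    unfolding path_proj_def using path_word_gens[OF p] r by (subst word_smult_single) auto
  show ?thesis
  proof (cases "r = p")
    case True
    then show ?thesis unfolding act by (simp add: word_act_path_proj[OF p])
  next
    case False
    then obtain k where k: "r !! k \<noteq> p !! k" by (metis stream_smap_nats ext)
    have "word_act G (path_word p n @ ghost_word p n) r = None" if "k < n" for n
    proof -
      have "stake n r \<noteq> stake n p" using k that by (metis stake_nth)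
      then show ?thesis
        by (auto simp: ghost_word_def word_act_append word_act_ghosts_eq bind_eq_None_conv)
    qed
    then show ?thesis
      unfolding act by (intro exI[of _ "Suc k"]) (simp add: Suc_le_eq)
  qed
qed

lemma path_proj_stable_chen:
  assumes R: "ring L"
    and p: "inf_path G p" and t: "t \<in> carrier (chen_module G q)"
  shows "\<exists>m. \<forall>n\<ge>m. path_proj p n \<odot>\<^bsub>chen_module G q\<^esub> (t :: 'b stream \<Rightarrow>\<^sub>0 'k) =
    path_proj p (Suc n) \<odot>\<^bsub>chen_module G q\<^esub> t"
proof -
  interpret M: left_module L "chen_module G q"
    by (rule left_module_chen[OF R])
  \<comment> \<open>Membership in the carrier is carried through the induction, since additivity of
    the action is only available there.\<close>
  have "t \<in> carrier (chen_module G q) \<and> (\<exists>m. \<forall>n\<ge>m. path_proj p n \<odot>\<^bsub>chen_module G q\<^esub> t =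
    path_proj p (Suc n) \<odot>\<^bsub>chen_module G q\<^esub> t)"
  proof (induction t rule: poly_mapping_additive_induct)
    case zero
    have "path_proj p n \<odot>\<^bsub>chen_module G q\<^esub> (0 :: 'b stream \<Rightarrow>\<^sub>0 'k) = 0" for n
      using M.smult_zero_right[OF path_proj_closed[OF p, of n]] unfolding chen_module_simps(2) .
    then show ?case by (simp add: chen_module_simps)
  next
    case (single r c)
    then have r: "r \<in> path_class G q" using t by (auto simp: chen_module_simps)
    show ?case
    proof
      show "Poly_Mapping.single r c \<in> carrier (chen_module G q)" using r by (simp add: chen_module_simps)
    qed (rule path_proj_stable_single[OF p r])
  next
    case (add y z)
    then obtain m m' where yz: "y \<in> carrier (chen_module G q)" "z \<in> carrier (chen_module G q)"
      and m: "\<forall>n\<ge>m. path_proj p n \<odot>\<^bsub>chen_module G q\<^esub> y = path_proj p (Suc n) \<odot>\<^bsub>chen_module G q\<^esub> y"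
        "\<forall>n\<ge>m'. path_proj p n \<odot>\<^bsub>chen_module G q\<^esub> z = path_proj p (Suc n) \<odot>\<^bsub>chen_module G q\<^esub> z"
      by blast
    have s: "y + z = y \<oplus>\<^bsub>chen_module G q\<^esub> z" by (simp add: chen_module_simps)
    have stable: "path_proj p n \<odot>\<^bsub>chen_module G q\<^esub> (y + z) = path_proj p (Suc n) \<odot>\<^bsub>chen_module G q\<^esub> (y + z)"
      if "max m m' \<le> n" for n
    proof -
      have "path_proj p n \<odot>\<^bsub>chen_module G q\<^esub> y = path_proj p (Suc n) \<odot>\<^bsub>chen_module G q\<^esub> y"
        "path_proj p n \<odot>\<^bsub>chen_module G q\<^esub> z = path_proj p (Suc n) \<odot>\<^bsub>chen_module G q\<^esub> z"
        by (rule m(1)[rule_format], use that in simp) (rule m(2)[rule_format], use that in simp)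
      then show ?thesis
        unfolding s M.smult_r_distr[OF path_proj_closed[OF p] yz] by (simp only:)
    qed
    show ?case
    proof (intro conjI exI[of _ "max m m'"] allI impI)
      show "y + z \<in> carrier (chen_module G q)" unfolding s by (rule M.M.a_closed[OF yz])
    qed (rule stable)
  qed
  then show ?thesis by blast
qed

section \<open>The simple module of a sink\<close>

context
  fixes w :: 'a
  assumes sink: "is_sink G w"
begin

lemma sink_gens: "Vert w \<in> lpa_gens G" and sink_tail: "e \<in> arcs G \<Longrightarrow> tail G e \<noteq> w"
  using sink by (auto simp: is_sink_def out_arcs_def)

text \<open>e^* = e^* s(e), and s(e) differs from w because no edge leaves a sink.\<close>

lemma ghost_sink_zero:
  assumes e: "e \<in> arcs G"
  shows "word_class [Ghost e, Vert w] = \<zero>\<^bsub>L\<^esub>"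
proof -
  have "word_class ([Ghost e] @ [Vert w]) = word_class ([Ghost e, Vert (tail G e)] @ [Vert w])"
    using e sink_gens by (intro word_class_head_cong lpa_relations(6)[symmetric]) auto
  also have "\<dots> = word_class ([Ghost e] @ [Vert (tail G e), Vert w] @ [])" by simp
  also have "\<dots> = \<zero>\<^bsub>L\<^esub>"
    using e sink_gens sink_tail[OF e] by (intro word_class_zero_context lpa_relations(2)) auto
  finally show ?thesis by simp
qed

lemma vert_sink_path:
  assumes "v \<in> verts G" "set l \<subseteq> arcs G"
  shows "word_class (Vert v # map Edge l @ [Vert w]) = \<zero>\<^bsub>L\<^esub> \<or>
    word_class (Vert v # map Edge l @ [Vert w]) = word_class (map Edge l @ [Vert w])"
proof (cases l)
  case Nil
  then show ?thesis
    using lpa_relations(1)[OF assms(1)] lpa_relations(2)[OF assms(1), of w] sink_gens by (cases "v = w") auto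
next
  case (Cons e l')
  have g: "set (map Edge l' @ [Vert w]) \<subseteq> lpa_gens G" and e: "e \<in> arcs G"
    using assms(2) Cons sink_gens by auto
  show ?thesis
  proof (cases "v = tail G e")
    case True
    have "word_class ([Vert v, Edge e] @ map Edge l' @ [Vert w]) =
        word_class ([Edge e] @ map Edge l' @ [Vert w])"
      unfolding True by (rule word_class_head_cong[OF lpa_relations(3)[OF e] _ _ g]) (use e in simp_all)
    then show ?thesis using Cons by simp
  next
    case False
    have "word_class ([] @ [Vert v, Edge e] @ map Edge l' @ [Vert w]) = \<zero>\<^bsub>L\<^esub>"
      by (rule word_class_zero_context[OF nonadjacent_zero(1)[OF e assms(1) False] _ _ g])
         (use e assms(1) in simp_all)
    then show ?thesis using Cons by simp
  qed
qed

lemma ghost_sink_path: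
  assumes e: "e \<in> arcs G" and l: "set l \<subseteq> arcs G"
  shows "word_class (Ghost e # map Edge l @ [Vert w]) = \<zero>\<^bsub>L\<^esub> \<or>
    (\<exists>l'. l = e # l' \<and> word_class (Ghost e # map Edge l @ [Vert w]) =
      word_class (map Edge l' @ [Vert w]))"
proof (cases l)
  case Nil
  then show ?thesis using ghost_sink_zero[OF e] by simp
next
  case (Cons f l')
  have g: "set (map Edge l' @ [Vert w]) \<subseteq> lpa_gens G" and f: "f \<in> arcs G" and l': "set l' \<subseteq> arcs G"
    using l Cons sink_gens by auto
  show ?thesis
  proof (cases "e = f")
    case True
    have "word_class ([Ghost e, Edge e] @ map Edge l' @ [Vert w]) =
        word_class ([Vert (head G e)] @ map Edge l' @ [Vert w])"
      by (rule word_class_head_cong[OF lpa_relations(7)[OF e] _ _ g]) (use e in simp_all)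
    then show ?thesis
      using vert_sink_path[of "head G e" l'] e l' Cons True by auto
  next
    case False
    have "word_class ([] @ [Ghost e, Edge f] @ map Edge l' @ [Vert w]) = \<zero>\<^bsub>L\<^esub>"
      by (rule word_class_zero_context[OF lpa_relations(8)[OF e f False] _ _ g]) (use e f in simp_all)
    then show ?thesis using Cons by simp
  qed
qed

text \<open>A normal form: reading from the right, each ghost cancels against an edge or produces
  zero, in particular when it reaches w. The edges that remain are not claimed to form a path; only
  the absence of ghosts is used.\<close>

lemma word_sink:
  "set u \<subseteq> lpa_gens G \<Longrightarrow> word_class (u @ [Vert w]) = \<zero>\<^bsub>L\<^esub> \<or>
    (\<exists>l. set l \<subseteq> arcs G \<and> word_class (u @ [Vert w]) = word_class (map Edge l @ [Vert w]))"
proof (induction u)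
  case Nil
  show ?case by (intro disjI2 exI[of _ "[]"]) simp
next
  case (Cons g u)
  then have g: "set [g] \<subseteq> lpa_gens G" and u: "set (u @ [Vert w]) \<subseteq> lpa_gens G" using sink_gens by auto
  show ?case
  proof (cases "word_class (u @ [Vert w]) = \<zero>\<^bsub>L\<^esub>")
    case True
    then show ?thesis using word_class_zero_context[OF True u g, of "[]"] by simp
  next
    case False
    then obtain l where l: "set l \<subseteq> arcs G"
      "word_class (u @ [Vert w]) = word_class (map Edge l @ [Vert w])"
      using Cons by auto
    have "set (map Edge l @ [Vert w]) \<subseteq> lpa_gens G" using l(1) sink_gens by auto
    from word_class_tail_cong[OF l(2) u this g]
    have eq: "word_class ((g # u) @ [Vert w]) = word_class (g # map Edge l @ [Vert w])"
      by simp
    show ?thesis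
    proof (cases g)
      case (Vert v)
      then show ?thesis using vert_sink_path[of v l] l(1) g eq by auto
    next
      case (Edge e)
      then show ?thesis using eq l(1) g by (intro disjI2 exI[of _ "e # l"]) simp
    next
      case (Ghost e)
      then show ?thesis using ghost_sink_path[of e l] l(1) g eq by auto
    qed
  qed
qed

text \<open>Every ghost cancels one edge or gives zero. As there are more ghosts than edges, some
  ghost would have to meet the sink.\<close>

lemma ghosts_sink_zero:
  assumes "inf_path G q" "set l \<subseteq> arcs G" "length l < n"
  shows "word_class (map Ghost (rev (stake n q)) @ map Edge l @ [Vert w]) = \<zero>\<^bsub>L\<^esub>"
  using assms
proof (induction l arbitrary: q n rule: length_induct)
  case (1 l)
  then obtain i where i: "n = Suc i" by (cases n) auto
  let ?g = "map Ghost (rev (stake i (stl q)))"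
  have q: "shd q \<in> arcs G" "inf_path G (stl q)"
    using "1.prems"(1) by (auto intro: inf_path_shd inf_path_stl)
  have g: "set ?g \<subseteq> lpa_gens G" using set_stake_subset[OF q(2), of i] by auto
  have eq: "map Ghost (rev (stake n q)) @ map Edge l @ [Vert w] = ?g @ (Ghost (shd q) # map Edge l @ [Vert w])"
    by (simp add: i)
  have r: "set (Ghost (shd q) # map Edge l @ [Vert w]) \<subseteq> lpa_gens G"
    using "1.prems"(2) q(1) sink_gens by auto
  show ?case
    using ghost_sink_path[OF q(1) "1.prems"(2)]
  proof
    assume z: "word_class (Ghost (shd q) # map Edge l @ [Vert w]) = \<zero>\<^bsub>L\<^esub>"
    show ?thesis unfolding eq using word_class_zero_context[OF z r g, of "[]"] by simp
  next
    assume "\<exists>l'. l = shd q # l' \<and> word_class (Ghost (shd q) # map Edge l @ [Vert w]) =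
      word_class (map Edge l' @ [Vert w])"
    then obtain l' where l': "l = shd q # l'" "word_class (Ghost (shd q) # map Edge l @ [Vert w]) =
      word_class (map Edge l' @ [Vert w])" by blast
    have "set (map Edge l' @ [Vert w]) \<subseteq> lpa_gens G"
      using "1.prems"(2) l'(1) sink_gens by auto
    from word_class_tail_cong[OF l'(2) r this g] show ?thesis
      unfolding eq using "1.IH" l'(1) q(2) "1.prems"(2,3) i by simp
  qed
qed

lemma path_proj_sink_zero:
  assumes p: "inf_path G p" and u: "set u \<subseteq> lpa_gens G"
  shows "\<exists>m. \<forall>n\<ge>m. word_class ((path_word p n @ ghost_word p n) @ u @ [Vert w]) =
    \<zero>\<^bsub>L\<^esub>"
proof -
  \<comment> \<open>The vertex that closes the ghost word is moved over to \<open>u\<close>, so that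
    the normal form of the rest directly follows the ghosts.\<close>
  let ?v = "Vert (tail G (shd p)) :: ('a, 'b) lpa_gen"
  have v: "set (?v # u) \<subseteq> lpa_gens G" using u inf_path_shd[OF p] by simp
  have vg: "set ((?v # u) @ [Vert w]) \<subseteq> lpa_gens G" using v sink_gens by simp
  define c where "c n = path_word p n @ map Ghost (rev (stake n p))" for n
  have c: "set (c n) \<subseteq> lpa_gens G" for n
    using path_word_gens[OF p, of n] by (simp add: c_def ghost_word_def)
  have eq: "(path_word p n @ ghost_word p n) @ u @ [Vert w] = c n @ ((?v # u) @ [Vert w])" for n
    by (simp add: c_def ghost_word_def)
  show ?thesis
    using word_sink[OF v]
  proof
    assume z: "word_class ((?v # u) @ [Vert w]) = \<zero>\<^bsub>L\<^esub>"
    show ?thesis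
      unfolding eq using word_class_zero_context[OF z vg c, of "[]"] by simp
  next
    assume "\<exists>l. set l \<subseteq> arcs G \<and> word_class ((?v # u) @ [Vert w]) =
      word_class (map Edge l @ [Vert w])"
    then obtain l where l: "set l \<subseteq> arcs G" "word_class ((?v # u) @ [Vert w]) =
      word_class (map Edge l @ [Vert w])" by blast
    have lg: "set (map Edge l @ [Vert w]) \<subseteq> lpa_gens G" using l(1) sink_gens by auto
    have "word_class (c n @ ((?v # u) @ [Vert w])) = \<zero>\<^bsub>L\<^esub>" if "length l < n" for n
    proof -
      have "word_class (c n @ ((?v # u) @ [Vert w])) = word_class (c n @ map Edge l @ [Vert w])"
        by (rule word_class_tail_cong[OF l(2) vg lg c])
      also have "\<dots> = word_class (path_word p n @ (map Ghost (rev (stake n p)) @ map Edge l @ [Vert w]) @ [])"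
        by (simp add: c_def)
      also have "\<dots> = \<zero>\<^bsub>L\<^esub>"
      proof (rule word_class_zero_context[OF ghosts_sink_zero[OF p l(1) that]])
        show "set (map Ghost (rev (stake n p)) @ map Edge l @ [Vert w]) \<subseteq> lpa_gens G"
          using lg c[of n] by (simp add: c_def)
      qed (use path_word_gens[OF p] in simp_all)
      finally show ?thesis .
    qed
    then show ?thesis
      unfolding eq by (intro exI[of _ "Suc (length l)"]) (simp add: Suc_le_eq)
  qed
qed

lemma path_proj_stable_sink:
  assumes R: "ring L"
    and p: "inf_path G p" and t: "t \<in> carrier (sink_module G w)"
  shows "\<exists>m. \<forall>n\<ge>m. path_proj p n \<otimes>\<^bsub>L\<^esub> t = \<zero>\<^bsub>L\<^esub>"
proof -
  interpret R: ring L by (rule R)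
  interpret I: ideal "lpa_ideal G :: ('a, 'b, 'k) free_elem set" "free_alg G" by (rule ideal_lpa)
  from t obtain a where a: "a \<in> carrier L" "t = a \<otimes>\<^bsub>L\<^esub> lpa_vert G w"
    by (auto simp: sink_module_def)
  obtain x where x: "x \<in> carrier (free_alg G)" "a = lpa_class G x" using a(1) by (rule carrier_lpaE)
  let ?w = "word_elem [Vert w] :: ('a, 'b, 'k) free_elem"
  have w: "?w \<in> carrier (free_alg G)" using sink_gens by (intro word_in_free_alg) simp
  have t': "t = lpa_class G (x * ?w)"
    unfolding a(2) x(2) lpa_vert_eq word_class_def by (rule class_mult[OF x(1) w])
  let ?pi = "\<lambda>n. word_elem (path_word p n @ ghost_word p n) :: ('a, 'b, 'k) free_elem"
  have pi: "?pi n \<in> carrier (free_alg G)" for n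
    using path_word_gens[OF p] by (intro word_in_free_alg) simp
  have "\<exists>m. \<forall>n\<ge>m. ?pi n * (x * ?w) \<in> lpa_ideal G"
  proof (induction x rule: poly_mapping_additive_induct)
    case zero
    show ?case using additive_subgroup.zero_closed[OF I.additive_subgroup_axioms] by simp
  next
    case (single u c)
    then have u: "set (letters u) \<subseteq> lpa_gens G" using x(1) by (simp add: carrier_free_alg)
    obtain m where m: "\<forall>n\<ge>m. word_class ((path_word p n @ ghost_word p n) @ letters u @ [Vert w]) =
        \<zero>\<^bsub>L\<^esub>"
      using path_proj_sink_zero[OF p u] by blast
    have "?pi n * (Poly_Mapping.single u c * ?w) \<in> lpa_ideal G" if "m \<le> n" for n
    proof -
      let ?v = "(path_word p n @ ghost_word p n) @ letters u @ [Vert w]"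
      have "set ?v \<subseteq> lpa_gens G" using path_word_gens[OF p] u sink_gens by simp
      then have "(word_elem ?v :: ('a, 'b, 'k) free_elem) \<in> lpa_ideal G"
        using m that class_eq_zero_iff[OF word_in_free_alg] unfolding word_class_def by blast
      then have "Poly_Mapping.single 0 c * word_elem ?v \<in> (lpa_ideal G :: ('a, 'b, 'k) free_elem set)"
        by (rule smult_in_ideal)
      then show ?thesis by (simp add: mult_single plus_fword_def zero_fword_def)
    qed
    then show ?case by blast
  next
    case (add y z)
    then obtain m m' where m: "\<forall>n\<ge>m. ?pi n * (y * ?w) \<in> lpa_ideal G"
      "\<forall>n\<ge>m'. ?pi n * (z * ?w) \<in> lpa_ideal G" by blast
    have "?pi n * ((y + z) * ?w) \<in> lpa_ideal G" if "max m m' \<le> n" for n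
      using m that additive_subgroup.a_closed[OF I.additive_subgroup_axioms, of "?pi n * (y * ?w)" "?pi n * (z * ?w)"]
      by (simp add: distrib_left distrib_right)
    then show ?case by blast
  qed
  then obtain m where m: "\<forall>n\<ge>m. ?pi n * (x * ?w) \<in> lpa_ideal G" by blast
  have "path_proj p n \<otimes>\<^bsub>L\<^esub> t = \<zero>\<^bsub>L\<^esub>" if "m \<le> n" for n
    unfolding t' path_proj_def word_class_def class_mult[OF pi free_alg_closed(2)[OF x(1) w]]
    using m that class_eq_zero_iff[OF free_alg_closed(2)[OF pi free_alg_closed(2)[OF x(1) w]]] by blast
  then show ?thesis by blast
qed

end

lemma path_proj_stable:
  fixes T :: "(('a, 'b, 'k) lpa_elem, 't) module"
  assumes T: "chen_simple G T" and p: "inf_path G p" and t: "t \<in> carrier T"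
  shows "\<exists>m. \<forall>n\<ge>m. path_proj p n \<odot>\<^bsub>T\<^esub> t = path_proj p (Suc n) \<odot>\<^bsub>T\<^esub> t"
proof -
  interpret T: left_module "L" T using T by (simp add: chen_simple_def)
  have pc: "path_proj p n \<in> carrier L" for n
    by (rule path_proj_closed[OF p])
  \<comment> \<open>Stated for an arbitrary carrier type, as the two kinds of Chen simple modules
    have different ones.\<close>
  have transfer: "\<exists>c\<in>carrier C. \<forall>a\<in>carrier L. a \<odot>\<^bsub>T\<^esub> t = h (a \<odot>\<^bsub>C\<^esub> c)"
    if h: "h \<in> mod_hom L C T" "bij_betw h (carrier C) (carrier T)"
    for h and C :: "(('a, 'b, 'k) lpa_elem, 'c) module"
  proof -
    obtain c where c: "c \<in> carrier C" "t = h c" using h(2) t by (auto simp: bij_betw_def)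
    then show ?thesis using h(1) by (intro bexI[of _ c]) (auto simp: mod_hom_def)
  qed
  from T consider (path) q where "mod_isomorphic L (chen_module G q) T"
    | (sink) w where "is_sink G w" "mod_isomorphic L (sink_module G w) T"
    unfolding chen_simple_def by blast
  then show ?thesis
  proof cases
    case (path q)
    then obtain h where h: "h \<in> mod_hom L (chen_module G q) T"
      "bij_betw h (carrier (chen_module G q)) (carrier T)"
      unfolding mod_isomorphic_def by blast
    obtain c where c: "c \<in> carrier (chen_module G q)" "\<forall>a\<in>carrier L. a \<odot>\<^bsub>T\<^esub> t = h (a \<odot>\<^bsub>chen_module G q\<^esub> c)"
      using transfer[OF h] by blast
    show ?thesis
      using path_proj_stable_chen[OF T.R.ring_axioms p c(1)] c(2) pc by metis
  next
    case (sink w)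
    then obtain h where h: "h \<in> mod_hom L (sink_module G w) T"
      "bij_betw h (carrier (sink_module G w)) (carrier T)"
      unfolding mod_isomorphic_def by blast
    obtain c where c: "c \<in> carrier (sink_module G w)" "\<forall>a\<in>carrier L. a \<odot>\<^bsub>T\<^esub> t = h (a \<odot>\<^bsub>sink_module G w\<^esub> c)"
      using transfer[OF h] by blast
    obtain m where m: "\<forall>n\<ge>m. path_proj p n \<otimes>\<^bsub>L\<^esub> c = \<zero>\<^bsub>L\<^esub>"
      using path_proj_stable_sink[OF sink(1) T.R.ring_axioms p c(1)] by blast
    \<comment> \<open>Only eventual constancy is required, so \<open>h\<close> at zero need not be
      evaluated.\<close>
    have "path_proj p n \<odot>\<^bsub>T\<^esub> t = h \<zero>\<^bsub>L\<^esub>" if "m \<le> n" for n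
      using bspec[OF c(2) pc[of n]] m that by (simp add: sink_module_def)
    then show ?thesis by (intro exI[of _ m]) simp
  qed
qed

section \<open>Exits\<close>

lemma exits_active_iff:
  fixes T :: "(('a, 'b, 'k) lpa_elem, 't) module"
  assumes T: "left_module L T" and p: "inf_path G p"
  shows "head G ` exits G p n \<inter> U_set G T \<noteq> {} \<longleftrightarrow>
    (\<exists>t\<in>carrier T. path_proj p n \<odot>\<^bsub>T\<^esub> t \<noteq> path_proj p (Suc n) \<odot>\<^bsub>T\<^esub> t)"
proof -
  interpret T: left_module "L" T by fact
  let ?e = "p !! n" and ?a = "path_word p n" and ?b = "ghost_word p n"
  let ?V = "Vert (tail G (p !! n)) :: ('a, 'b) lpa_gen"
  have e: "?e \<in> arcs G" by (rule inf_path_arc[OF p])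
  have v: "tail G ?e \<in> verts G" using e by simp
  note g = path_word_gens[OF p]
  have ab: "?a \<noteq> []" "?b \<noteq> []" by (simp_all add: path_word_def ghost_word_def)
  have act: "word_class u \<odot>\<^bsub>T\<^esub> (word_class x \<odot>\<^bsub>T\<^esub> t) = (word_class (u @ x) \<odot>\<^bsub>T\<^esub> t)"
    if "set u \<subseteq> lpa_gens G" "u \<noteq> []" "set x \<subseteq> lpa_gens G" "x \<noteq> []" "t \<in> carrier T" for u x t
    using T.smult_assoc[OF word_class_closed[OF that(1,2)] word_class_closed[OF that(3,4)] that(5)]
    by (simp add: word_class_mult[OF that(1,3)])
  have zero: "word_class u = \<zero>\<^bsub>L\<^esub> \<Longrightarrow> t \<in> carrier T \<Longrightarrow>
      word_class u \<odot>\<^bsub>T\<^esub> t = \<zero>\<^bsub>T\<^esub>" for u t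
    by simp
  show ?thesis
  proof
    assume "head G ` exits G p n \<inter> U_set G T \<noteq> {}"
    then obtain f t where f: "f \<in> arcs G" "tail G f = tail G ?e" "f \<noteq> ?e"
      and t: "t \<in> carrier T" "word_class [Vert (head G f)] \<odot>\<^bsub>T\<^esub> t \<noteq> \<zero>\<^bsub>T\<^esub>"
      by (auto simp: exits_def U_set_def lpa_vert_eq)
    have Vf: "word_class [?V, Edge f] = word_class [Edge f]"
      using lpa_relations(3)[OF f(1)] by (simp add: f(2))
    \<comment> \<open>\<alpha>_n^* \<alpha>_n is the vertex s(e_{n+1}) = s(f), which f
      absorbs.\<close>
    have mid: "word_class (u @ (?b @ ?a) @ [Edge f]) = word_class (u @ [Edge f])"
      if u: "set u \<subseteq> lpa_gens G" for u
    proof -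
      have "word_class (u @ (?b @ ?a) @ [Edge f]) = word_class (u @ [?V] @ [Edge f])"
        using u f(1) g v by (intro word_class_context ghost_path_word[OF p]) auto
      also have "\<dots> = word_class (u @ [Edge f])"
        using word_class_tail_cong[OF Vf _ _ u] f(1) v by simp
      finally show ?thesis .
    qed
    \<comment> \<open>The vector \<alpha>_n f t is fixed by \<pi>_n, and killed by \<pi>_{n+1}
      because e_{n+1}^* f = 0.\<close>
    define s where "s = word_class (?a @ [Edge f]) \<odot>\<^bsub>T\<^esub> t"
    have gs: "set (?a @ [Edge f]) \<subseteq> lpa_gens G" using g f(1) by simp
    have s: "s \<in> carrier T"
      unfolding s_def using t(1) gs by (intro T.smult_closed word_class_closed) simp_all
    have s1: "path_proj p n \<odot>\<^bsub>T\<^esub> s = s"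
      unfolding s_def path_proj_def using mid[of ?a] g ab f(1) t(1) by (subst act) simp_all
    have s2: "path_proj p (Suc n) \<odot>\<^bsub>T\<^esub> s = \<zero>\<^bsub>T\<^esub>"
    proof -
      have u: "set (path_word p (Suc n) @ [Ghost ?e]) \<subseteq> lpa_gens G" using g e by simp
      have "word_class ((path_word p (Suc n) @ ghost_word p (Suc n)) @ (?a @ [Edge f])) =
          word_class ((path_word p (Suc n) @ [Ghost ?e]) @ (?b @ ?a) @ [Edge f])"
        by (simp add: path_word_simps)
      also have "\<dots> = word_class (path_word p (Suc n) @ [Ghost ?e, Edge f] @ [])"
        using mid[OF u] by simp
      also have "\<dots> = \<zero>\<^bsub>L\<^esub>"
        using g e f by (intro word_class_zero_context lpa_relations(8)) auto
      finally have z: "word_class ((path_word p (Suc n) @ ghost_word p (Suc n)) @ (?a @ [Edge f])) =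
          \<zero>\<^bsub>L\<^esub>" .
      have "path_proj p (Suc n) \<odot>\<^bsub>T\<^esub> s =
          word_class ((path_word p (Suc n) @ ghost_word p (Suc n)) @ (?a @ [Edge f])) \<odot>\<^bsub>T\<^esub> t"
        unfolding s_def path_proj_def using g[of "Suc n"] gs t(1)
        by (intro act) (auto simp: path_word_def)
      then show ?thesis using zero[OF z t(1)] by simp
    qed
    \<comment> \<open>Multiplication by f^* \<alpha>_n^* recovers r(f) t, which is non-zero; hence
      so is s.\<close>
    have "word_class ([Ghost f] @ ?b) \<odot>\<^bsub>T\<^esub> s = word_class [Vert (head G f)] \<odot>\<^bsub>T\<^esub> t"
    proof -
      have "word_class ([Ghost f] @ ?b) \<odot>\<^bsub>T\<^esub> s = word_class (([Ghost f] @ ?b) @ (?a @ [Edge f])) \<odot>\<^bsub>T\<^esub> t"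
        unfolding s_def using g gs f(1) t(1) by (intro act) auto
      also have "word_class (([Ghost f] @ ?b) @ (?a @ [Edge f])) = word_class [Vert (head G f)]"
        using mid[of "[Ghost f]"] f(1) lpa_relations(7)[OF f(1)] by simp
      finally show ?thesis .
    qed
    then have "s \<noteq> \<zero>\<^bsub>T\<^esub>"
      using t(2) T.smult_zero_right[OF word_class_closed, of "[Ghost f] @ ?b"] g f(1) by auto
    then show "\<exists>t\<in>carrier T. path_proj p n \<odot>\<^bsub>T\<^esub> t \<noteq> path_proj p (Suc n) \<odot>\<^bsub>T\<^esub> t"
      using s s1 s2 by (intro bexI[of _ s]) auto
  next
    assume "\<exists>t\<in>carrier T. path_proj p n \<odot>\<^bsub>T\<^esub> t \<noteq> path_proj p (Suc n) \<odot>\<^bsub>T\<^esub> t"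
    then obtain t where t: "t \<in> carrier T" "path_proj p n \<odot>\<^bsub>T\<^esub> t \<noteq> path_proj p (Suc n) \<odot>\<^bsub>T\<^esub> t"
      by blast
    show "head G ` exits G p n \<inter> U_set G T \<noteq> {}"
    proof (rule ccontr)
      assume none: "\<not> ?thesis"
      let ?m = "\<lambda>f. ?a @ [Edge f, Ghost f] @ ?b"
      have mg: "set (?m f) \<subseteq> lpa_gens G" if "f \<in> arcs G" for f using g that by simp
      have sum_closed: "(\<Sum>f\<in>F. word_elem (?m f)) \<in> (carrier (free_alg G) :: ('a, 'b, 'k) free_elem set)"
        if "F \<subseteq> arcs G" for F
        using that by (intro sum_in_free_alg word_in_free_alg mg) auto
      have sum_class_closed: "lpa_class G (\<Sum>f\<in>F. word_elem (?m f)) \<in> carrier L"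
        if "F \<subseteq> arcs G" for F
        using sum_closed[OF that]
        by (rule class_in_carrier) (simp add: lookup_sum lookup_single zero_fword_def when_def)
      have sum_insert: "lpa_class G (\<Sum>f\<in>insert f F. word_elem (?m f)) \<odot>\<^bsub>T\<^esub> t =
          word_class (?m f) \<odot>\<^bsub>T\<^esub> t \<oplus>\<^bsub>T\<^esub> lpa_class G (\<Sum>f\<in>F. word_elem (?m f)) \<odot>\<^bsub>T\<^esub> t"
        if "finite F" "f \<notin> F" "insert f F \<subseteq> arcs G" for f F
      proof -
        have fF: "f \<in> arcs G" "F \<subseteq> arcs G" using that by auto
        have "lpa_class G (\<Sum>f\<in>insert f F. word_elem (?m f)) =
            word_class (?m f) \<oplus>\<^bsub>L\<^esub> lpa_class G (\<Sum>f\<in>F. word_elem (?m f))"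
          unfolding word_class_def class_add[OF word_in_free_alg[OF mg[OF fF(1)]] sum_closed[OF fF(2)]]
            sum.insert[OF that(1,2)] by (rule refl)
        moreover have "word_class (?m f) \<in> carrier L"
          using mg[OF fF(1)] by (rule word_class_closed) simp
        ultimately show ?thesis
          using T.smult_l_distr[OF _ sum_class_closed[OF fF(2)] t(1)] by simp
      qed
      \<comment> \<open>f^* = r(f) f^*, and r(f) annihilates T when it lies outside U(T).\<close>
      have exit_zero: "word_class (?m f) \<odot>\<^bsub>T\<^esub> t = \<zero>\<^bsub>T\<^esub>" if f: "f \<in> exits G p n" for f
      proof -
        have fa: "f \<in> arcs G" using f by (simp add: exits_def)
        have gb: "set (Ghost f # ?b) \<subseteq> lpa_gens G" using g fa by simp
        have "word_class ([Vert (head G f), Ghost f] @ ?b) = word_class ([Ghost f] @ ?b)"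
          using fa g by (intro word_class_head_cong lpa_relations(5)) auto
        then have "word_class (Ghost f # ?b) \<odot>\<^bsub>T\<^esub> t = word_class ([Vert (head G f)] @ (Ghost f # ?b)) \<odot>\<^bsub>T\<^esub> t"
          by simp
        also have "\<dots> = word_class [Vert (head G f)] \<odot>\<^bsub>T\<^esub> (word_class (Ghost f # ?b) \<odot>\<^bsub>T\<^esub> t)"
          using gb fa t(1) by (intro act[symmetric]) auto
        also have "\<dots> = \<zero>\<^bsub>T\<^esub>"
        proof -
          have "word_class (Ghost f # ?b) \<odot>\<^bsub>T\<^esub> t \<in> carrier T"
            using gb t(1) by (intro T.smult_closed word_class_closed) auto
          moreover have "head G f \<in> head G ` exits G p n" "head G f \<in> verts G" using f fa by auto
          ultimately show ?thesis using none by (auto simp: U_set_def lpa_vert_eq)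
        qed
        finally have z: "word_class (Ghost f # ?b) \<odot>\<^bsub>T\<^esub> t = \<zero>\<^bsub>T\<^esub>" .
        have "word_class (?m f) \<odot>\<^bsub>T\<^esub> t = word_class (?a @ [Edge f]) \<odot>\<^bsub>T\<^esub> (word_class (Ghost f # ?b) \<odot>\<^bsub>T\<^esub> t)"
          using act[of "?a @ [Edge f]" "Ghost f # ?b" t] g gb fa t(1) by simp
        also have "\<dots> = \<zero>\<^bsub>T\<^esub>"
          unfolding z using g fa by (intro T.smult_zero_right word_class_closed) auto
        finally show ?thesis .
      qed
      have exits_sum: "lpa_class G (\<Sum>f\<in>F. word_elem (?m f)) \<odot>\<^bsub>T\<^esub> t = \<zero>\<^bsub>T\<^esub>"
        if "finite F" "F \<subseteq> exits G p n" for F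
        using that
      proof (induction F)
        case empty
        show ?case using t(1) by (simp add: class_zero)
      next
        case (insert f F)
        then have "insert f F \<subseteq> arcs G" by (auto simp: exits_def)
        then show ?case
          using insert exit_zero[of f] sum_insert[of F f] by simp
      qed
      have out: "out_arcs G (tail G ?e) = insert ?e (exits G p n)"
        using e by (auto simp: out_arcs_def exits_def)
      have fin: "finite (exits G p n)" and ex: "exits G p n \<subseteq> arcs G" "?e \<notin> exits G p n"
        by (auto simp: exits_def)
      \<comment> \<open>Insert the vertex s(e_{n+1}) in the middle of \<pi>_n and expand it by
        (CK2). The summand of e_{n+1} is \<pi>_{n+1}; the others belong to the exits.\<close>
      have "path_proj p n = word_class (?a @ [?V] @ ?b)"
      proof -
        have "set (?a @ [?V]) \<subseteq> lpa_gens G" using g v by simp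
        from word_class_head_cong[OF path_word_vertex[OF p] this g]
        show ?thesis by (simp add: path_proj_def)
      qed
      also have "\<dots> = word_class ?a \<otimes>\<^bsub>L\<^esub> (word_class [?V] \<otimes>\<^bsub>L\<^esub> word_class ?b)"
        using g v by (simp add: word_class_mult)
      also have "word_class [?V] = lpa_class G (\<Sum>f\<in>out_arcs G (tail G ?e). word_elem [Edge f, Ghost f])"
        using v out by (intro CK2) auto
      also have "word_class ?a \<otimes>\<^bsub>L\<^esub> (\<dots> \<otimes>\<^bsub>L\<^esub> word_class ?b) =
          lpa_class G (\<Sum>f\<in>out_arcs G (tail G ?e). word_elem (?m f))"
      proof -
        let ?S = "\<Sum>f\<in>out_arcs G (tail G ?e). word_elem [Edge f, Ghost f] :: ('a, 'b, 'k) free_elem"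
        have S: "?S \<in> carrier (free_alg G)"
          by (intro sum_in_free_alg word_in_free_alg) auto
        note wa = word_in_free_alg[OF g(1)[of n]] and wb = word_in_free_alg[OF g(2)[of n]]
        show ?thesis
          unfolding word_class_def class_mult[OF S wb] class_mult[OF wa free_alg_closed(2)[OF S wb]]
          by (simp add: sum_distrib_left sum_distrib_right word_elem_mult)
      qed
      finally have "path_proj p n \<odot>\<^bsub>T\<^esub> t = word_class (?m ?e) \<odot>\<^bsub>T\<^esub> t \<oplus>\<^bsub>T\<^esub>
          lpa_class G (\<Sum>f\<in>exits G p n. word_elem (?m f)) \<odot>\<^bsub>T\<^esub> t"
        using sum_insert[OF fin ex(2)] ex(1) e by (simp add: out)
      moreover have "word_class (?m ?e) = path_proj p (Suc n)"
        by (simp add: path_proj_def path_word_simps)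
      ultimately have "path_proj p n \<odot>\<^bsub>T\<^esub> t = path_proj p (Suc n) \<odot>\<^bsub>T\<^esub> t"
        using exits_sum[OF fin order_refl] T.smult_closed[OF path_proj_closed[OF p] t(1)] by simp
      with t(2) show False by simp
    qed
  qed
qed

end

theorem theorem3p21:
  fixes G :: "('v, 'e) pre_digraph"
    and p :: "'e stream"
    and T :: "(('v, 'e, 'k::field) lpa_elem, 't) module"
  assumes "fin_digraph G"
    and "irrational_path G p"
    and "chen_simple G T"
  shows "(carrier (Ext1 (lpa G) (chen_module G p) T) \<noteq> {\<zero>\<^bsub>Ext1 (lpa G) (chen_module G p) T\<^esub>}
            \<longleftrightarrow> infinite {i. head G ` exits G p i \<inter> U_set G T \<noteq> {}}) \<and>
         (infinite {i. head G ` exits G p i \<inter> U_set G T \<noteq> {}}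
            \<longrightarrow> \<not> fin_dim (Ext1 (lpa G) (chen_module G p) T))"
proof -
  interpret fin_digraph G by fact
  interpret leavitt_algebra G "TYPE('k)" by unfold_locales
  have T: "left_module (lpa G) T" using assms(3) by (simp add: chen_simple_def)
  interpret T: left_module "lpa G" T by (rule T)
  note R = T.R.ring_axioms
  have p: "inf_path G p" using assms(2) by (simp add: irrational_path_def)
  interpret E: filtered_cyclic_ext "lpa G" "chen_module G p" T "Poly_Mapping.single p 1" "path_proj p"
  proof (intro filtered_cyclic_ext.intro cyclic_ext.intro cyclic_ext_axioms.intro
      filtered_cyclic_ext_axioms.intro lpa_algebra_modules[OF R left_module_chen[OF R] T])
    show "Poly_Mapping.single p 1 \<in> carrier (chen_module G p)"
      using self_in_path_class[OF p] by (simp add: chen_module_simps)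
  qed (fact path_generates[OF p] path_proj_closed[OF p] path_proj_mult[OF p]
      annihilator_irrational[OF R assms(2)] path_proj_stable[OF assms(3) p])+
  have "E.active = {i. head G ` exits G p i \<inter> U_set G T \<noteq> {}}"
    unfolding E.active_def using exits_active_iff[OF T p] by blast
  then show ?thesis using E.Ext1_dichotomy by simp
qed

end
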